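(* Let $m>1$ be an integer, let $\ell$ be an odd integer, and let $J$ be the finite $2$-group with generators $A,B$ defined in the context. For every $x,y\in Z_1(J)$ the assignment $A\mapsto Ax$, $B\mapsto By$ extends to a central automorphism $\Omega_{(x,y)}$ of $J$ that fixes $Z_2(J)$ pointwise. Moreover, the corresponding map $\Omega:Z_1(J)\times Z_1(J)\to\mathrm{Aut}(J)$, $(x,y)\mapsto\Omega_{(x,y)}$, is a group monomorphism whose image is $\mathrm{Aut}_1(J)$. In particular, $|\mathrm{Aut}_1(J)|=2^{2m}$.
   Context: Notation: $[a,b]=a^{-1}b^{-1}ab$, $b^a=a^{-1}ba$, $\alpha=1+2^m\ell$. The group is $$J=\langle A,B\mid A^{[A,B]}=A^{\alpha},\ B^{[B,A]}=B^{\alpha},\ A^{2^{3m-1}}=B^{2^{3m-1}}=1\rangle.$$ For a group $T$, $Z_0(T)=1, Z_1(T),Z_2(T),\dots$ denotes the upper central series, and $\mathrm{Aut}_i(T)$ is the kernel of the canonical map $\mathrm{Aut}(T)\to\mathrm{Aut}(T/Z_i(T))$. An automorphism of $T$ is central if it belongs to $\mathrm{Aut}_1(T)$. *)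

theory Defs
  imports "HOL-Algebra.Bij" "HOL-Algebra.Coset" "HOL-Algebra.Generated_Groups"
begin

section \<open>Groups given by generators and relations\<close>

text \<open>A word is a list of signed letters: \<^term>\<open>(g, True)\<close> stands for the generator \<open>g\<close> and
  \<^term>\<open>(g, False)\<close> for its formal inverse. A relation \<open>u = v\<close> is a pair of words.\<close>

type_synonym 'g word = "('g \<times> bool) list"

definition winv :: "'g word \<Rightarrow> 'g word" where
  "winv w = rev (map (\<lambda>(g, s). (g, \<not> s)) w)"

definition wpow :: "'g word \<Rightarrow> int \<Rightarrow> 'g word" where
  "wpow w k = (if 0 \<le> k then concat (replicate (nat k) w)
               else concat (replicate (nat (- k)) (winv w)))"

definition wcomm :: "'g word \<Rightarrow> 'g word \<Rightarrow> 'g word" where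
  "wcomm a b = winv a @ winv b @ a @ b"

definition wconj :: "'g word \<Rightarrow> 'g word \<Rightarrow> 'g word" where
  "wconj b a = winv a @ b @ a"

inductive pres_eq :: "('g word \<times> 'g word) set \<Rightarrow> 'g word \<Rightarrow> 'g word \<Rightarrow> bool"
  for R :: "('g word \<times> 'g word) set" where
  pe_refl: "pres_eq R u u"
| pe_sym: "pres_eq R u v \<Longrightarrow> pres_eq R v u"
| pe_trans: "pres_eq R u v \<Longrightarrow> pres_eq R v w \<Longrightarrow> pres_eq R u w"
| pe_append: "pres_eq R u u' \<Longrightarrow> pres_eq R v v' \<Longrightarrow> pres_eq R (u @ v) (u' @ v')"
| pe_cancel: "pres_eq R [(g, s), (g, \<not> s)] []"
| pe_rel: "(u, v) \<in> R \<Longrightarrow> pres_eq R u v"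

definition wclass :: "('g word \<times> 'g word) set \<Rightarrow> 'g word \<Rightarrow> 'g word set" where
  "wclass R w = {v. pres_eq R w v}"

definition presented_group :: "('g word \<times> 'g word) set \<Rightarrow> 'g word set monoid" where
  "presented_group R = \<lparr>carrier = range (wclass R),
     mult = (\<lambda>U V. {w. \<exists>u\<in>U. \<exists>v\<in>V. pres_eq R (u @ v) w}),
     one = wclass R []\<rparr>"

definition pres_gen :: "('g word \<times> 'g word) set \<Rightarrow> 'g \<Rightarrow> 'g word set" where
  "pres_gen R g = wclass R [(g, True)]"

lemma wclass_eq_iff: "wclass R u = wclass R v \<longleftrightarrow> pres_eq R u v"
  unfolding wclass_def by (blast intro: pe_refl pe_sym pe_trans)

lemma wclass_mult [simp]:
  "wclass R u \<otimes>\<^bsub>presented_group R\<^esub> wclass R v = wclass R (u @ v)"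
proof -
  have "(\<exists>u'\<in>wclass R u. \<exists>v'\<in>wclass R v. pres_eq R (u' @ v') w) \<longleftrightarrow> pres_eq R (u @ v) w" for w
    unfolding wclass_def using pe_trans[OF pe_append] pe_refl by blast
  then show ?thesis
    by (simp add: presented_group_def wclass_def)
qed

lemma winv_Cons: "winv ((g, s) # w) = winv w @ [(g, \<not> s)]"
  by (simp add: winv_def)

lemma winv_winv [simp]: "winv (winv w) = w"
  by (induction w) (auto simp: winv_def rev_map)

lemma pres_eq_winv: "pres_eq R (winv w @ w) []"
proof (induction w)
  case Nil
  show ?case by (simp add: winv_def pe_refl)
next
  case (Cons x w)
  obtain g s where x: "x = (g, s)" by fastforce
  have "pres_eq R ([(g, \<not> s), (g, s)]) []"
    using pe_cancel[of R g "\<not> s"] by simp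
  then have "pres_eq R (winv w @ [(g, \<not> s), (g, s)] @ w) (winv w @ [] @ w)"
    by (intro pe_append pe_refl)
  then have "pres_eq R (winv (x # w) @ x # w) (winv w @ w)"
    by (simp add: x winv_Cons)
  from pe_trans[OF this Cons] show ?case .
qed

lemma wclass_closed [simp]: "wclass R u \<in> carrier (presented_group R)"
  by (simp add: presented_group_def)

lemma carrier_presented_group: "carrier (presented_group R) = range (wclass R)"
  by (simp add: presented_group_def)

lemma one_presented_group: "\<one>\<^bsub>presented_group R\<^esub> = wclass R []"
  by (simp add: presented_group_def)

lemma group_presented_group: "group (presented_group R)"
proof (rule groupI)
  fix x assume "x \<in> carrier (presented_group R)"
  then obtain u where u: "x = wclass R u" by (auto simp: carrier_presented_group)
  show "\<exists>y\<in>carrier (presented_group R).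
          y \<otimes>\<^bsub>presented_group R\<^esub> x = \<one>\<^bsub>presented_group R\<^esub>"
    by (rule bexI[of _ "wclass R (winv u)"])
      (simp_all add: u one_presented_group wclass_eq_iff pres_eq_winv)
qed (auto simp: carrier_presented_group one_presented_group)

lemma inv_wclass: "inv\<^bsub>presented_group R\<^esub> (wclass R u) = wclass R (winv u)"
proof -
  interpret group "presented_group R" by (rule group_presented_group)
  show ?thesis
    by (rule inv_equality)
      (simp_all add: one_presented_group wclass_eq_iff pres_eq_winv)
qed

lemma wclass_nat_pow:
  "wclass R u [^]\<^bsub>presented_group R\<^esub> (n::nat) = wclass R (concat (replicate n u))"
proof -
  interpret group "presented_group R" by (rule group_presented_group)
  have "concat (replicate n u) @ u = u @ concat (replicate n u)" for n
    by (induction n) auto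
  then show ?thesis
    by (induction n) (simp_all add: one_presented_group)
qed

lemma wclass_int_pow:
  "wclass R u [^]\<^bsub>presented_group R\<^esub> (k::int) = wclass R (wpow u k)"
proof -
  interpret group "presented_group R" by (rule group_presented_group)
  have "inv\<^bsub>presented_group R\<^esub> (wclass R (concat (replicate n u)))
      = wclass R (concat (replicate n (winv u)))" for n
    using nat_pow_inv[of "wclass R u" n] by (simp only: wclass_nat_pow inv_wclass wclass_closed)
  then show ?thesis
    unfolding int_pow_def2 wpow_def wclass_nat_pow by (cases "k < 0") simp_all
qed

fun word_eval :: "('a, 'b) monoid_scheme \<Rightarrow> ('g \<Rightarrow> 'a) \<Rightarrow> 'g word \<Rightarrow> 'a" where
  "word_eval G f [] = \<one>\<^bsub>G\<^esub>"
| "word_eval G f ((g, s) # w) =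
     (if s then f g else inv\<^bsub>G\<^esub> (f g)) \<otimes>\<^bsub>G\<^esub> word_eval G f w"

lemma (in group) word_eval_closed:
  "range f \<subseteq> carrier G \<Longrightarrow> word_eval G f w \<in> carrier G"
proof (induction w)
  case (Cons x w)
  obtain g s where x: "x = (g, s)" by fastforce
  have "f g \<in> carrier G" using Cons.prems by auto
  with Cons show ?case by (simp add: x)
qed simp

lemma (in group) word_eval_append:
  assumes "range f \<subseteq> carrier G"
  shows "word_eval G f (u @ v) = word_eval G f u \<otimes> word_eval G f v"
proof (induction u)
  case Nil
  show ?case using assms by (simp add: word_eval_closed)
next
  case (Cons x u)
  obtain g s where x: "x = (g, s)" by fastforce
  have "f g \<in> carrier G" using assms by auto
  with assms Cons show ?case by (simp add: x m_assoc word_eval_closed)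
qed

lemma (in group) word_eval_cong:
  assumes f: "range f \<subseteq> carrier G"
    and R: "\<And>u v. (u, v) \<in> R \<Longrightarrow> word_eval G f u = word_eval G f v"
    and "pres_eq R u v"
  shows "word_eval G f u = word_eval G f v"
  using assms(3)
proof induction
  case (pe_cancel g s)
  have "f g \<in> carrier G" using f by auto
  then show ?case by simp
qed (use f in \<open>simp_all add: R word_eval_append\<close>)

theorem presented_group_universal:
  assumes "group G" and f: "range f \<subseteq> carrier G"
    and R: "\<And>u v. (u, v) \<in> R \<Longrightarrow> word_eval G f u = word_eval G f v"
  shows "\<exists>h \<in> hom (presented_group R) G. \<forall>g. h (pres_gen R g) = f g"
proof -
  interpret group G by fact
  define h where "h U = word_eval G f (SOME w. w \<in> U)" for U
  have h: "h (wclass R w) = word_eval G f w" for w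
  proof -
    have "pres_eq R w (SOME v. v \<in> wclass R w)"
      by (rule someI2[of _ w]) (simp_all add: wclass_def pe_refl)
    then show ?thesis
      unfolding h_def using word_eval_cong[OF f R, of R w "SOME v. v \<in> wclass R w"] by simp
  qed
  have "h \<in> hom (presented_group R) G"
    by (auto simp: hom_def h carrier_presented_group f word_eval_closed word_eval_append)
  moreover have "h (pres_gen R g) = f g" for g
    using f subsetD[OF f rangeI, of g] by (simp add: pres_gen_def h)
  ultimately show ?thesis by blast
qed

lemma presented_group_generated:
  "generate (presented_group R) (range (pres_gen R)) = carrier (presented_group R)"
proof -
  let ?H = "generate (presented_group R) (range (pres_gen R))"
  interpret group "presented_group R" by (rule group_presented_group)
  have "wclass R w \<in> ?H" for w
  proof (induction w)
    case Nil
    show ?case using generate.one[of "presented_group R"] by (simp add: one_presented_group)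
  next
    case (Cons x w)
    obtain g s where x: "x = (g, s)" by fastforce
    have "wclass R [(g, s)] \<in> ?H"
    proof (cases s)
      case True
      then show ?thesis
        using generate.incl[of "pres_gen R g" "range (pres_gen R)" "presented_group R"]
        by (simp add: pres_gen_def)
    next
      case False
      then show ?thesis
        using generate.inv[of "pres_gen R g" "range (pres_gen R)" "presented_group R"]
        by (simp add: pres_gen_def inv_wclass winv_def)
    qed
    from generate.eng[OF this Cons] show ?case by (simp add: x)
  qed
  moreover have "?H \<subseteq> carrier (presented_group R)"
    by (rule generate_incl) (auto simp: pres_gen_def carrier_presented_group)
  ultimately show ?thesis by (auto simp: carrier_presented_group)
qed


section \<open>The group \<open>J\<close>\<close>

datatype gen = GA | GB

definition J_alpha :: "nat \<Rightarrow> int \<Rightarrow> int" where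
  "J_alpha m l = 1 + 2 ^ m * l"

definition J_rels :: "nat \<Rightarrow> int \<Rightarrow> (gen word \<times> gen word) set" where
  "J_rels m l =
    (let a = [(GA, True)]; b = [(GB, True)] in
     {(wconj a (wcomm a b), wpow a (J_alpha m l)),
      (wconj b (wcomm b a), wpow b (J_alpha m l)),
      (wpow a (2 ^ (3 * m - 1)), []),
      (wpow b (2 ^ (3 * m - 1)), [])})"

definition J_group :: "nat \<Rightarrow> int \<Rightarrow> gen word set monoid" where
  "J_group m l = presented_group (J_rels m l)"

definition J_A :: "nat \<Rightarrow> int \<Rightarrow> gen word set" where
  "J_A m l = pres_gen (J_rels m l) GA"

definition J_B :: "nat \<Rightarrow> int \<Rightarrow> gen word set" where
  "J_B m l = pres_gen (J_rels m l) GB"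

lemma J_relations:
  fixes m :: nat and l :: int
  defines "J \<equiv> J_group m l" and "a \<equiv> J_A m l" and "b \<equiv> J_B m l"
  defines "comm \<equiv> \<lambda>x y. inv\<^bsub>J\<^esub> x \<otimes>\<^bsub>J\<^esub> inv\<^bsub>J\<^esub> y \<otimes>\<^bsub>J\<^esub> x \<otimes>\<^bsub>J\<^esub> y"
  shows "inv\<^bsub>J\<^esub> (comm a b) \<otimes>\<^bsub>J\<^esub> a \<otimes>\<^bsub>J\<^esub> comm a b = a [^]\<^bsub>J\<^esub> (1 + 2 ^ m * l)"
    and "inv\<^bsub>J\<^esub> (comm b a) \<otimes>\<^bsub>J\<^esub> b \<otimes>\<^bsub>J\<^esub> comm b a = b [^]\<^bsub>J\<^esub> (1 + 2 ^ m * l)"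
    and "a [^]\<^bsub>J\<^esub> ((2::int) ^ (3 * m - 1)) = \<one>\<^bsub>J\<^esub>"
    and "b [^]\<^bsub>J\<^esub> ((2::int) ^ (3 * m - 1)) = \<one>\<^bsub>J\<^esub>"
  unfolding assms J_group_def J_A_def J_B_def pres_gen_def inv_wclass wclass_mult
    wclass_int_pow one_presented_group wclass_eq_iff append_assoc
  by (rule pe_rel; simp add: J_rels_def Let_def wconj_def wcomm_def J_alpha_def)+


section \<open>Upper central series and the groups \<open>Aut\<^sub>i\<close>\<close>

definition group_center :: "('a, 'b) monoid_scheme \<Rightarrow> 'a set" where
  "group_center G = {z \<in> carrier G. \<forall>g \<in> carrier G. z \<otimes>\<^bsub>G\<^esub> g = g \<otimes>\<^bsub>G\<^esub> z}"

primrec upper_central :: "('a, 'b) monoid_scheme \<Rightarrow> nat \<Rightarrow> 'a set" where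
  "upper_central G 0 = {\<one>\<^bsub>G\<^esub>}"
| "upper_central G (Suc i) =
     {z \<in> carrier G. upper_central G i #>\<^bsub>G\<^esub> z \<in> group_center (G Mod upper_central G i)}"

text \<open>The automorphism of \<open>G/N\<close> induced by \<open>f\<close> sends a coset, as a set, to its image under \<open>f\<close>;
  it is restricted to the carrier because the elements of \<^const>\<open>AutoGroup\<close> are extensional
  functions.\<close>

definition induced_aut :: "('a, 'b) monoid_scheme \<Rightarrow> 'a set \<Rightarrow> ('a \<Rightarrow> 'a) \<Rightarrow> 'a set \<Rightarrow> 'a set" where
  "induced_aut G N f = (\<lambda>C \<in> carrier (G Mod N). f ` C)"

definition Aut_sub :: "nat \<Rightarrow> ('a, 'b) monoid_scheme \<Rightarrow> ('a \<Rightarrow> 'a) set" where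
  "Aut_sub i G =
     kernel (AutoGroup G) (AutoGroup (G Mod upper_central G i)) (induced_aut G (upper_central G i))"

definition central_automorphism :: "('a, 'b) monoid_scheme \<Rightarrow> ('a \<Rightarrow> 'a) \<Rightarrow> bool" where
  "central_automorphism G f \<longleftrightarrow> f \<in> Aut_sub 1 G"

end

theory Submission
  imports Defs "HOL-Number_Theory.Cong"
begin

text \<open>
  Write \<open>C = [A, B]\<close>, \<open>P = 2\<^sup>2\<^sup>m\<^sup>-\<^sup>1\<close>, \<open>Q = 2\<^sup>3\<^sup>m\<^sup>-\<^sup>1\<close> and \<open>Z\<close> for the centre of \<open>J\<close>.  If \<open>x\<close> and \<open>y\<close>
  are central, then \<open>A x\<close> and \<open>B y\<close> have the same commutator \<open>C\<close> as \<open>A\<close> and \<open>B\<close>, so they satisfy the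
  defining relations as soon as the exponent of \<open>Z\<close> divides \<open>2\<^sup>m\<close>.  The resulting endomorphism
  multiplies each \<open>g\<close> by a central element; it fixes \<open>C\<close>, and it fixes \<open>A\<^sup>i\<close> whenever \<open>2\<^sup>m\<close>
  divides \<open>i\<close>.  If every element of \<open>Z\<^sub>2\<close> has the form \<open>A\<^sup>i C\<^sup>k\<close> with \<open>P\<close> dividing \<open>i\<close>, the
  endomorphism is the identity on \<open>Z\<^sub>2\<close>, hence bijective, and composition of two such maps multiplies
  the parameters.  Conversely a central automorphism is determined by the central factors by which
  it moves \<open>A\<close> and \<open>B\<close>.  So everything rests on two facts: \<open>Z\<close> is cyclic of order \<open>2\<^sup>m\<close>,
  generated by \<open>A\<^sup>P\<close> (\<open>center_eq\<close>, \<open>card_center\<close>), and \<open>Z\<^sub>2\<close> is as described (\<open>second_center\<close>).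

  Upper bounds for \<open>Z\<close> and \<open>Z\<^sub>2\<close> come from a normal form.  Since \<open>B\<^sup>-\<^sup>1 A B = A C\<close> and \<open>C\<close> acts on
  \<open>A\<close> and \<open>B\<close> by powers, \<open>(A C)\<^sup>n\<close> is \<open>A\<^sup>s C\<^sup>n\<close> with \<open>s = s n\<close> a geometric sum (\<open>AC_pow\<close>), and every
  element is a product \<open>B\<^sup>j A\<^sup>i C\<^sup>k\<close>.  Evaluating \<open>A\<^sup>\<alpha> B\<close> in two ways gives \<open>A\<^sup>P B\<^sup>P = 1\<close>
  (\<open>B_2h2\<close>, \<open>B_P\<close>), whence \<open>A\<^sup>P\<close> is central and \<open>C\<^sup>P\<close> is a power of \<open>A\<close>.  An element that
  commutes with \<open>A\<close> up to a central factor must then be \<open>A\<^sup>i C\<^sup>k\<close> (\<open>almost_centralises_A\<close>).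

  These arguments need that \<open>J\<close> does not collapse: \<open>A\<close> has order exactly \<open>Q\<close>, and \<open>B\<^sup>n\<close> lies in
  \<open>\<langle>A\<rangle>\<langle>C\<rangle>\<close> only if \<open>P\<close> divides \<open>n\<close>.  Both are read off from a permutation representation
  (\<open>macdonald_model\<close>).  The expected action of \<open>J\<close> on the cosets of \<open>\<langle>A\<^sup>x C\<rangle>\<close>, where
  \<open>x = h (1 - h)\<close> and \<open>h = (\<alpha> - 1) / 2\<close>, is explicit: the coset of \<open>B\<^sup>j A\<^sup>i\<close> is given by \<open>j\<close> modulo
  \<open>P\<close> and \<open>u = i - j\<close> modulo \<open>Q\<close>, and \<open>A\<^sup>-\<^sup>1\<close>, \<open>B\<close> and \<open>C\<close> become polynomial maps.  This \<open>x\<close> is chosen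
  so that \<open>\<langle>A\<^sup>x C\<rangle>\<close> meets the centre trivially, although \<open>\<langle>C\<rangle>\<close> does not.  All
  relations except \<open>C\<^sup>-\<^sup>1 A C = A\<^sup>\<alpha>\<close> are polynomial congruences.  For that one, the map \<open>D\<close> with
  \<open>C\<^sup>-\<^sup>1 A\<^sup>-\<^sup>1 C = A\<^sup>-\<^sup>1 D\<close> is computed, and \<open>D = A\<^sup>-\<^sup>2\<^sup>h\<close> is proved by comparing how both
  sides move past \<open>B\<close> (\<open>power_unique\<close>), which avoids iterating the map of \<open>A\<^sup>-\<^sup>1\<close>.
\<close>

section \<open>Binomial coefficients of integers\<close>

definition choose2 :: "int \<Rightarrow> int" where "choose2 j = j * (j - 1) div 2"

definition choose3 :: "int \<Rightarrow> int" where "choose3 j = j * (j - 1) * (j - 2) div 6"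

lemma two_choose2: "2 * choose2 j = j * (j - 1)"
  unfolding choose2_def by simp

lemma choose2_add: "choose2 (j + k) = choose2 j + choose2 k + j * k"
proof -
  have "2 * choose2 (j + k) = 2 * (choose2 j + choose2 k + j * k)"
    by (simp add: two_choose2 distrib_left) (simp add: algebra_simps)
  then show ?thesis by simp
qed

text \<open>The substitution turns an identity between polynomials in \<open>j\<close> and \<open>choose2 j\<close> into an identity
  between polynomials in \<open>k\<close>, which is decided by multiplying out.\<close>

lemma choose2_parametrised:
  obtains k where "j = 2 * k \<and> choose2 j = k * (2 * k - 1) \<or> j = 2 * k + 1 \<and> choose2 j = k * (2 * k + 1)"
proof (cases "even j")
  case True
  then obtain k where "j = 2 * k" ..
  then show ?thesis using that two_choose2[of j] by auto
next
  case False
  then obtain k where "j = 2 * k + 1" ..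
  then show ?thesis using that[of k] two_choose2[of j] by auto
qed

lemma three_choose3: "3 * choose3 j = choose2 j * (j - 2)"
proof -
  have "3 dvd j * (j - 1) * (j - 2)"
  proof -
    have "j mod 3 = 0 \<or> j mod 3 = 1 \<or> j mod 3 = 2" by presburger
    then consider "j mod 3 = 0" | "j mod 3 = 1" | "j mod 3 = 2" by blast
    then show ?thesis
    proof cases
      case 1 then have "3 dvd j" by presburger
      then show ?thesis by simp
    next
      case 2 then have "3 dvd j - 1" by presburger
      then show ?thesis by simp
    next
      case 3 then have "3 dvd j - 2" by presburger
      then show ?thesis by simp
    qed
  qed
  moreover have "2 dvd j * (j - 1) * (j - 2)" by simp
  ultimately have "2 * 3 dvd j * (j - 1) * (j - 2)"
    by (intro divides_mult) simp_all
  then have "6 * choose3 j = j * (j - 1) * (j - 2)" unfolding choose3_def by simp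
  also have "\<dots> = 2 * choose2 j * (j - 2)" by (simp add: two_choose2)
  finally show ?thesis by simp
qed

lemma choose2_Suc: "choose2 (j + 1) = choose2 j + j"
  using choose2_add[of j 1] by (simp add: choose2_def)

lemma choose2_of_nat: "choose2 (int n) = int (n choose 2)"
proof (induction n)
  case (Suc n)
  have "choose2 (int (Suc n)) = choose2 (int n) + int n"
    using choose2_Suc[of "int n"] by (simp add: add.commute)
  with Suc show ?case by (simp add: numeral_2_eq_2)
qed (simp add: choose2_def)

lemma choose3_Suc: "choose3 (j + 1) = choose3 j + choose2 j"
proof -
  have "2 * (3 * choose3 (j + 1)) = 2 * (3 * (choose3 j + choose2 j))"
    unfolding three_choose3 distrib_left[of 3] choose2_Suc
    using two_choose2[of j] by (simp add: algebra_simps)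
  then show ?thesis by simp
qed

lemma choose3_of_nat: "choose3 (int n) = int (n choose 3)"
proof (induction n)
  case (Suc n)
  have "choose3 (int (Suc n)) = choose3 (int n) + choose2 (int n)"
    using choose3_Suc[of "int n"] by (simp add: add.commute)
  with Suc show ?case
    by (simp add: choose2_of_nat numeral_3_eq_3 numeral_2_eq_2)
qed (simp add: choose3_def)

section \<open>Congruences for the exponents\<close>

text \<open>The integer \<open>\<ell>\<close> of the presentation matters only modulo \<open>2\<^sup>2\<^sup>m\<^sup>-\<^sup>1\<close>, because \<open>\<alpha>\<close> matters only
  modulo the order of \<open>A\<close>.  It is therefore represented by a positive \<open>r\<close>, so that \<open>\<alpha>\<close> and \<open>2 h\<close>
  can serve as numbers of iterations.\<close>

locale macdonald_parameters =
  fixes m :: nat and r :: int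
  assumes m_gt_1: "1 < m" and odd_r: "odd r" and r_pos: "0 < r"
begin

text \<open>In the group, \<open>Q\<close> is the order of \<open>A\<close>, and \<open>P\<close> is the order of \<open>B\<close> and of \<open>C\<close> modulo
  \<open>\<langle>A\<rangle>\<close>.  Exponents become polynomials in \<open>h\<close> in which \<open>4 h\<^sup>3\<close> vanishes modulo \<open>Q\<close> and
  \<open>2 h\<^sup>2\<close> vanishes modulo \<open>P\<close>; these two facts truncate every series below.\<close>

definition h :: int where "h = 2 ^ (m - 1) * r"
definition P :: int where "P = 2 ^ (2 * m - 1)"
definition Q :: int where "Q = 2 ^ (3 * m - 1)"

lemma P_pos [simp]: "P > 0" and Q_pos [simp]: "Q > 0" and h_pos: "h > 0"
  using r_pos by (simp_all add: P_def Q_def h_def)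

lemma even_h: "even h" and even_P: "even P" and P_dvd_Q: "P dvd Q"
  using m_gt_1 by (simp_all add: h_def P_def Q_def le_imp_power_dvd)

lemma two_h: "2 * h = 2 ^ m * r"
proof -
  obtain n where "m = Suc n" using m_gt_1 by (cases m) auto
  then show ?thesis unfolding h_def by simp
qed

lemma two_h2: "2 * h\<^sup>2 = P * r\<^sup>2"
proof -
  obtain n where n: "m = Suc n" using m_gt_1 by (cases m) auto
  then have "2 * m - 1 = Suc (2 * n)" "m - 1 = n" by simp_all
  then show ?thesis unfolding h_def P_def by (simp add: power_mult_distrib power_even_eq)
qed

lemma Q_eq: "Q = 2 ^ m * P"
  using m_gt_1 by (simp add: Q_def P_def flip: power_add)

lemma P_dvd_2h2: "P dvd 2 * h\<^sup>2"
  by (simp add: two_h2)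

lemma Q_dvd_4h3: "Q dvd 4 * h ^ 3"
proof -
  have "4 * h ^ 3 = (2 * h\<^sup>2) * (2 * h)" by (simp add: power2_eq_square power3_eq_cube)
  also have "\<dots> = Q * r ^ 3"
    unfolding two_h2 two_h Q_eq by (simp add: power2_eq_square power3_eq_cube)
  finally show ?thesis by simp
qed

lemma Q_dvd_2h_mult_iff: "Q dvd 2 * h * n \<longleftrightarrow> P dvd n"
proof -
  have "Q dvd 2 * h * n \<longleftrightarrow> P dvd r * n"
    unfolding two_h Q_eq by (simp add: mult.assoc)
  also have "\<dots> \<longleftrightarrow> P dvd n"
    using odd_r by (simp add: P_def coprime_dvd_mult_right_iff)
  finally show ?thesis .
qed

lemma Q_dvd_4he: assumes "P dvd 2 * e" shows "Q dvd 4 * h * e"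
  using Q_dvd_2h_mult_iff[of "2 * e"] assms by (simp add: mult.assoc)

lemma dvd_odd_mult_iff:
  assumes "odd c" shows "P dvd c * x \<longleftrightarrow> P dvd x" "Q dvd c * x \<longleftrightarrow> Q dvd x"
  using assms by (simp_all add: P_def Q_def coprime_dvd_mult_right_iff)

lemma Q_dvd_3: "Q dvd 3 * x \<Longrightarrow> Q dvd x"
  using dvd_odd_mult_iff(2)[of 3 x] by simp

definition \<alpha> :: int where "\<alpha> = 1 + 2 * h"
definition \<gamma> :: int where "\<gamma> = 1 - 2 * h + 4 * h\<^sup>2"

lemma alpha_gamma: "[\<alpha> * \<gamma> = 1] (mod Q)"
proof -
  have "\<alpha> * \<gamma> - 1 = 4 * h ^ 3 * 2"
    by (simp add: \<alpha>_def \<gamma>_def algebra_simps power2_eq_square power3_eq_cube)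
  then show ?thesis unfolding cong_iff_dvd_diff using Q_dvd_4h3 by (metis dvd_mult2)
qed

lemma gamma_power: "[\<gamma> ^ n = 1 + (4 * h\<^sup>2 - 2 * h) * int n + 4 * h\<^sup>2 * choose2 (int n)] (mod Q)"
proof (induction n)
  case (Suc n)
  let ?p = "\<lambda>n. 1 + (4 * h\<^sup>2 - 2 * h) * n + 4 * h\<^sup>2 * choose2 n"
  have "\<gamma> * ?p (int n) - ?p (int n + 1) = 4 * h ^ 3 * (4 * h * int n - 4 * int n + 4 * h * choose2 (int n) - 2 * choose2 (int n))"
    unfolding \<gamma>_def choose2_Suc by (simp add: algebra_simps power2_eq_square power3_eq_cube)
  then have "[\<gamma> * ?p (int n) = ?p (int n + 1)] (mod Q)"
    unfolding cong_iff_dvd_diff using Q_dvd_4h3 by (metis dvd_mult2)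
  from cong_trans[OF cong_mult[OF cong_refl[of \<gamma>] Suc] this] show ?case
    by (simp add: add.commute)
qed (simp add: choose2_def)

lemma alpha_power: "[\<alpha> ^ n = 1 + 2 * h * int n + 4 * h\<^sup>2 * choose2 (int n)] (mod Q)"
proof (induction n)
  case (Suc n)
  let ?p = "\<lambda>n. 1 + 2 * h * n + 4 * h\<^sup>2 * choose2 n"
  have "\<alpha> * ?p (int n) - ?p (int n + 1) = 4 * h ^ 3 * (2 * choose2 (int n))"
    unfolding \<alpha>_def choose2_Suc by (simp add: algebra_simps power2_eq_square power3_eq_cube)
  then have "[\<alpha> * ?p (int n) = ?p (int n + 1)] (mod Q)"
    unfolding cong_iff_dvd_diff using Q_dvd_4h3 by (metis dvd_mult2)
  from cong_trans[OF cong_mult[OF cong_refl[of \<alpha>] Suc] this] show ?case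
    by (simp add: add.commute)
qed (simp add: choose2_def)

text \<open>The exponent in \<open>(A C)\<^sup>n = A\<^sup>s C\<^sup>n\<close>, and also in \<open>(B C\<^sup>-\<^sup>1)\<^sup>n = B\<^sup>s C\<^sup>-\<^sup>n\<close>.\<close>

definition s :: "nat \<Rightarrow> int" where "s n = (\<Sum>k<n. \<gamma> ^ k)"

lemma s_0 [simp]: "s 0 = 0" and s_Suc: "s (Suc n) = s n + \<gamma> ^ n"
  by (simp_all add: s_def)

lemma s_cong: "[s n = int n + (4 * h\<^sup>2 - 2 * h) * choose2 (int n) + 4 * h\<^sup>2 * choose3 (int n)] (mod Q)"
proof (induction n)
  case (Suc n)
  have "[s n + \<gamma> ^ n = (int n + (4 * h\<^sup>2 - 2 * h) * choose2 (int n) + 4 * h\<^sup>2 * choose3 (int n))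
    + (1 + (4 * h\<^sup>2 - 2 * h) * int n + 4 * h\<^sup>2 * choose2 (int n))] (mod Q)"
    using Suc gamma_power by (rule cong_add)
  also have "(int n + (4 * h\<^sup>2 - 2 * h) * choose2 (int n) + 4 * h\<^sup>2 * choose3 (int n))
      + (1 + (4 * h\<^sup>2 - 2 * h) * int n + 4 * h\<^sup>2 * choose2 (int n))
    = int (Suc n) + (4 * h\<^sup>2 - 2 * h) * choose2 (int n + 1) + 4 * h\<^sup>2 * choose3 (int n + 1)"
    unfolding choose2_Suc choose3_Suc by (simp add: algebra_simps)
  finally show ?case by (simp add: s_Suc add.commute)
qed (simp add: choose2_def choose3_def)

lemma P_dvd_s_diff: assumes "P dvd int n" shows "P dvd s n - int n"
proof -
  have "[s n = int n + (4 * h\<^sup>2 - 2 * h) * choose2 (int n) + 4 * h\<^sup>2 * choose3 (int n)] (mod P)"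
    using s_cong P_dvd_Q by (rule cong_dvd_modulus)
  also have "int n + (4 * h\<^sup>2 - 2 * h) * choose2 (int n) + 4 * h\<^sup>2 * choose3 (int n)
    = int n + ((2 * h\<^sup>2) * (2 * choose2 (int n) + 2 * choose3 (int n)) - h * (int n * (int n - 1)))"
    unfolding two_choose2[symmetric] by (simp add: algebra_simps)
  finally have "P dvd s n - int n - ((2 * h\<^sup>2) * (2 * choose2 (int n) + 2 * choose3 (int n)) - h * (int n * (int n - 1)))"
    unfolding cong_iff_dvd_diff by (simp only: diff_diff_eq)
  moreover have "P dvd (2 * h\<^sup>2) * (2 * choose2 (int n) + 2 * choose3 (int n)) - h * (int n * (int n - 1))"
    using assms by (intro dvd_diff dvd_mult2[OF P_dvd_2h2]) simp
  ultimately have "P dvd (s n - int n - ((2 * h\<^sup>2) * (2 * choose2 (int n) + 2 * choose3 (int n)) - h * (int n * (int n - 1))))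
      + ((2 * h\<^sup>2) * (2 * choose2 (int n) + 2 * choose3 (int n)) - h * (int n * (int n - 1)))"
    by (rule dvd_add)
  then show ?thesis by (simp only: diff_add_cancel)
qed

text \<open>This number is the exponent of the relation between \<open>A\<close> and \<open>B\<close> that results from the two
  evaluations of \<open>A\<^sup>\<alpha> B\<close>; its exact 2-adic size is what makes \<open>A\<^sup>P\<close> central.\<close>

lemma s_alpha: "[s (nat \<alpha>) - \<alpha> = - (2 * h\<^sup>2)] (mod Q)"
proof -
  have n: "int (nat \<alpha>) = \<alpha>" using h_pos by (simp add: \<alpha>_def)
  have t: "choose2 \<alpha> = h * (2 * h + 1)" using two_choose2[of \<alpha>] by (simp add: \<alpha>_def)
  have t3: "3 * choose3 \<alpha> = h * (2 * h + 1) * (2 * h - 1)"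
    unfolding three_choose3 t by (simp add: \<alpha>_def)
  have "3 * (\<alpha> + (4 * h\<^sup>2 - 2 * h) * choose2 \<alpha> + 4 * h\<^sup>2 * choose3 \<alpha> - \<alpha> + 2 * h\<^sup>2)
      = 3 * ((4 * h\<^sup>2 - 2 * h) * (h * (2 * h + 1)) + 2 * h\<^sup>2) + 4 * h\<^sup>2 * (h * (2 * h + 1) * (2 * h - 1))"
    unfolding t t3[symmetric] by (simp add: algebra_simps)
  also have "\<dots> = 4 * h ^ 3 * (6 * h + (2 * h + 1) * (2 * h - 1))"
    by (simp add: algebra_simps power2_eq_square power3_eq_cube)
  finally have "3 * (\<alpha> + (4 * h\<^sup>2 - 2 * h) * choose2 \<alpha> + 4 * h\<^sup>2 * choose3 \<alpha> - \<alpha> + 2 * h\<^sup>2)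
     = 4 * h ^ 3 * (6 * h + (2 * h + 1) * (2 * h - 1))" .
  then have "Q dvd \<alpha> + (4 * h\<^sup>2 - 2 * h) * choose2 \<alpha> + 4 * h\<^sup>2 * choose3 \<alpha> - \<alpha> + 2 * h\<^sup>2"
    using Q_dvd_4h3 Q_dvd_3 by (metis dvd_mult2)
  moreover have "Q dvd s (nat \<alpha>) - (\<alpha> + (4 * h\<^sup>2 - 2 * h) * choose2 \<alpha> + 4 * h\<^sup>2 * choose3 \<alpha>)"
    using s_cong[of "nat \<alpha>"] unfolding n cong_iff_dvd_diff .
  ultimately have "Q dvd (s (nat \<alpha>) - (\<alpha> + (4 * h\<^sup>2 - 2 * h) * choose2 \<alpha> + 4 * h\<^sup>2 * choose3 \<alpha>))
      + (\<alpha> + (4 * h\<^sup>2 - 2 * h) * choose2 \<alpha> + 4 * h\<^sup>2 * choose3 \<alpha> - \<alpha> + 2 * h\<^sup>2)"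
    by (rule dvd_add[rotated])
  then show ?thesis unfolding cong_iff_dvd_diff by (simp add: algebra_simps)
qed

lemma alpha_power_order: assumes "Q dvd \<alpha> ^ n - 1" shows "P dvd int n"
proof -
  have "Q dvd \<alpha> ^ n - (1 + 2 * h * int n + 4 * h\<^sup>2 * choose2 (int n))"
    using alpha_power by (simp add: cong_iff_dvd_diff)
  from dvd_diff[OF assms this] have "Q dvd 2 * h * (int n + 2 * h * choose2 (int n))"
    by (simp add: algebra_simps power2_eq_square)
  then have "P dvd int n + h * (2 * choose2 (int n))"
    unfolding Q_dvd_2h_mult_iff by (simp only: ac_simps)
  also have "int n + h * (2 * choose2 (int n)) = (1 + h * (int n - 1)) * int n"
    unfolding two_choose2 by (simp add: algebra_simps)
  finally show ?thesis
    using dvd_odd_mult_iff(1)[of "1 + h * (int n - 1)"] even_h by simp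
qed

lemma two_h2_mult_cong:
  assumes "[x = 1] (mod 2 * h)" shows "[2 * h\<^sup>2 * x = 2 * h\<^sup>2] (mod Q)"
proof -
  obtain y where "x - 1 = 2 * h * y" using assms unfolding cong_iff_dvd_diff ..
  then have x: "x = 1 + 2 * h * y" by simp
  have "2 * h\<^sup>2 * x - 2 * h\<^sup>2 = 4 * h ^ 3 * y"
    unfolding x by (simp add: algebra_simps power2_eq_square power3_eq_cube)
  then show ?thesis unfolding cong_iff_dvd_diff using Q_dvd_4h3 by (metis dvd_mult2)
qed

text \<open>The group relations produce exponents \<open>2 h\<^sup>2 = P r\<^sup>2\<close>; as \<open>r\<close> is odd, they reach all multiples
  of \<open>P\<close>.\<close>

lemma P_multiple_cong:
  assumes "P dvd n" obtains q where "[n = 2 * h\<^sup>2 * q] (mod Q)"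
proof -
  have "coprime (r\<^sup>2) Q" using odd_r by (simp add: Q_def)
  then obtain w where w: "[r\<^sup>2 * w = 1] (mod Q)" using cong_solve_coprime_int by blast
  obtain y where y: "n = P * y" using assms ..
  have "[2 * h\<^sup>2 * (w * y) = n] (mod Q)"
    using cong_mult[OF w cong_refl[of n]] unfolding two_h2 by (simp add: y ac_simps)
  then show thesis using that cong_sym by blast
qed

end

section \<open>Polynomial identities for the permutation model\<close>

text \<open>A point \<open>(j, u)\<close> stands for the coset of \<open>B\<^sup>j A\<^sup>i\<close> with \<open>i = u + j\<close>.  From
  \<open>A\<^sup>-\<^sup>1 B\<^sup>j = B\<^sup>s C\<^sup>-\<^sup>j A\<^sup>-\<^sup>1\<close> with \<open>s = s j\<close>, and from \<open>C\<close> acting as \<open>A\<^sup>-\<^sup>x\<close> on the base coset, one finds that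
  \<open>A\<^sup>-\<^sup>1\<close> maps \<open>(j, i)\<close> to \<open>(s j, (i - 1) \<alpha>\<^sup>j + x \<alpha> (1 + \<alpha> + \<dots> + \<alpha>\<^sup>j\<^sup>-\<^sup>1))\<close>.  The following polynomials
  are this map in the coordinates \<open>(j, u)\<close>, with the powers expanded modulo \<open>P\<close> and \<open>Q\<close>.\<close>

definition inv_A_fst :: "int \<Rightarrow> int \<Rightarrow> int" where
  "inv_A_fst h j = j - 2 * h * choose2 j"

definition inv_A_snd :: "int \<Rightarrow> int \<Rightarrow> int \<Rightarrow> int" where
  "inv_A_snd h j u = u * (1 + 2 * h * j + 4 * h\<^sup>2 * choose2 j) - 1 + h * j + 6 * h * choose2 j
     + h\<^sup>2 * j + 2 * h\<^sup>2 * choose2 j + 8 * h\<^sup>2 * choose3 j + 2 * h ^ 3 * (choose2 j - j)"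

text \<open>In the coordinates \<open>(j, i)\<close>, left multiplication by \<open>C\<close> is \<open>(\<alpha> j, \<gamma> i - x)\<close>.\<close>

definition C_fst :: "int \<Rightarrow> int \<Rightarrow> int" where
  "C_fst h j = (1 + 2 * h) * j"

definition C_snd :: "int \<Rightarrow> int \<Rightarrow> int \<Rightarrow> int" where
  "C_snd h j u = (1 - 2 * h + 4 * h\<^sup>2) * u - h + h\<^sup>2 + (4 * h\<^sup>2 - 4 * h) * j"

text \<open>The second coordinate of the image of \<open>(j, u)\<close> under \<open>A\<^sup>-\<^sup>2\<^sup>h\<close>, which preserves \<open>j\<close>.\<close>

definition D_snd :: "int \<Rightarrow> int \<Rightarrow> int \<Rightarrow> int" where
  "D_snd h j u = u - 2 * h + 4 * h\<^sup>2 * (u * j + j + 3 * choose2 j)"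

text \<open>The factor 3, a unit modulo \<open>Q\<close>, clears the denominator of \<open>choose3\<close>; the factor 2 in the
  denominators cannot be cleared in this way and is absorbed by \<open>h\<close> being even.\<close>

lemma three_inv_A_snd:
  "3 * inv_A_snd h j u = 3 * (u * (1 + 2 * h * j + 4 * h\<^sup>2 * choose2 j) - 1 + h * j + 6 * h * choose2 j
     + h\<^sup>2 * j + 2 * h\<^sup>2 * choose2 j + 2 * h ^ 3 * (choose2 j - j)) + 8 * h\<^sup>2 * (choose2 j * (j - 2))"
  unfolding inv_A_snd_def three_choose3[symmetric] by (simp add: algebra_simps)

lemma three_C_snd:
  "3 * C_snd h j u = (1 - 2 * h + 4 * h\<^sup>2) * (3 * u) + 3 * (- h + h\<^sup>2 + (4 * h\<^sup>2 - 4 * h) * j)"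
  unfolding C_snd_def by (simp add: algebra_simps)

lemma three_D_snd:
  "3 * D_snd h j u = 3 * u * (1 + 4 * h\<^sup>2 * j) + 3 * (4 * h\<^sup>2 * (j + 3 * choose2 j) - 2 * h)"
  unfolding D_snd_def by (simp add: algebra_simps)

lemma choose2_C_fst: "choose2 (C_fst h j) = choose2 j + h * j * (2 * j - 1) + 2 * h\<^sup>2 * j\<^sup>2"
proof -
  have "2 * choose2 (C_fst h j) = 2 * (choose2 j + h * j * (2 * j - 1) + 2 * h\<^sup>2 * j\<^sup>2)"
    unfolding distrib_left two_choose2 C_fst_def by (simp add: algebra_simps power2_eq_square)
  then show ?thesis by simp
qed

lemma choose2_inv_A_fst: "choose2 (inv_A_fst h j) = choose2 j - h * choose2 j * (2 * j - 1) + 2 * h\<^sup>2 * (choose2 j)\<^sup>2"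
proof -
  have "2 * choose2 (inv_A_fst h j) = 2 * choose2 j - 2 * (h * choose2 j * (2 * j - 1)) + 2 * (2 * h\<^sup>2 * (choose2 j)\<^sup>2)"
    unfolding two_choose2[of "inv_A_fst h j"] two_choose2[of j] by (simp add: algebra_simps power2_eq_square inv_A_fst_def)
  then show ?thesis by simp
qed

text \<open>This and the next three lemmas are the relations \<open>C B\<^sup>-\<^sup>1 A\<^sup>-\<^sup>1 B = A\<^sup>-\<^sup>1\<close>, \<open>A\<^sup>-\<^sup>1 C = C A\<^sup>-\<^sup>1 D\<close>,
  \<open>A\<^sup>-\<^sup>1 D = D A\<^sup>-\<^sup>1\<close> and \<open>D C = C D T\<close>, read in the second coordinate; here \<open>T\<close> is the power of
  \<open>A\<close> with exponent \<open>- 4 h\<^sup>2\<close>.  In each case the quotient by \<open>4 h\<^sup>3\<close> is found by polynomial division after \<open>h = 2 g\<close> and \<open>j\<^sup>2 = j + 2 choose2 j\<close>.\<close>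

lemma commutator_identity:
  assumes "even h"
  shows "4 * h ^ 3 dvd 3 * (C_snd h (inv_A_fst h (j + 1) - 1) (inv_A_snd h (j + 1) (u - 1) + 1) - inv_A_snd h j u)"
proof -
  obtain g where h: "h = 2 * g" using assms ..
  define b where "b = choose2 j"
  obtain k where k: "j = 2 * k \<and> b = k * (2 * k - 1) \<or> j = 2 * k + 1 \<and> b = k * (2 * k + 1)"
    using choose2_parametrised[of j] unfolding b_def by blast
  have "3 * (C_snd h (inv_A_fst h (j + 1) - 1) (inv_A_snd h (j + 1) (u - 1) + 1) - inv_A_snd h j u)
      = 4 * h ^ 3 * (- 6 + 11 * b + 6 * u - 6 * u * b + 12 * j - 4 * j * b + 12 * g - 2 * g * b
          + 24 * g * u * b - 6 * g * j + 16 * g * j * b + 24 * g * j * u - 24 * g\<^sup>2 + 24 * g\<^sup>2 * b)"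
    using k unfolding right_diff_distrib three_C_snd distrib_left[of 3 "inv_A_snd h (j + 1) (u - 1)"] three_inv_A_snd choose2_Suc b_def[symmetric]
    unfolding inv_A_fst_def choose2_Suc b_def[symmetric] h
    by (elim disjE conjE; hypsubst; simp add: algebra_simps power2_eq_square power3_eq_cube)
  then show ?thesis by simp
qed

lemma inv_A_C_identity:
  assumes "even h"
  shows "4 * h ^ 3 dvd 3 * (inv_A_snd h (C_fst h j) (C_snd h j u) - C_snd h (inv_A_fst h j) (inv_A_snd h j (D_snd h j u)))"
proof -
  obtain g where h: "h = 2 * g" using assms ..
  define b where "b = choose2 j"
  obtain k where k: "j = 2 * k \<and> b = k * (2 * k - 1) \<or> j = 2 * k + 1 \<and> b = k * (2 * k + 1)"
    using choose2_parametrised[of j] unfolding b_def by blast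
  have "3 * (inv_A_snd h (C_fst h j) (C_snd h j u) - C_snd h (inv_A_fst h j) (inv_A_snd h j (D_snd h j u)))
      = 4 * h ^ 3 * (6 - 8 * b - 5 * j - 14 * j * b - 3 * j * u - 16 * g * b - 72 * g * b\<^sup>2
          + 24 * g * u * b + 15 * g * j + 8 * g * j * b + 24 * g * j * u - 24 * g * j * u * b
          - 128 * g\<^sup>2 * b + 288 * g\<^sup>2 * b\<^sup>2 - 96 * g\<^sup>2 * u * b - 88 * g\<^sup>2 * j - 128 * g\<^sup>2 * j * b
          - 96 * g\<^sup>2 * j * u + 96 * g\<^sup>2 * j * u * b + 480 * g ^ 3 * b - 1152 * g ^ 3 * b\<^sup>2
          + 384 * g ^ 3 * u * b + 240 * g ^ 3 * j + 192 * g ^ 3 * j * u - 384 * g ^ 3 * j * u * b)"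
    using k unfolding right_diff_distrib three_C_snd three_inv_A_snd choose2_C_fst b_def[symmetric]
    unfolding inv_A_fst_def C_fst_def C_snd_def D_snd_def b_def[symmetric] h
    by (elim disjE conjE; hypsubst; simp add: algebra_simps power2_eq_square power3_eq_cube)
  then show ?thesis by simp
qed

lemma inv_A_D_identity:
  assumes "even h"
  shows "4 * h ^ 3 dvd 3 * (inv_A_snd h j (D_snd h j u) - D_snd h (inv_A_fst h j) (inv_A_snd h j u))"
proof -
  obtain g where h: "h = 2 * g" using assms ..
  define b where "b = choose2 j"
  obtain k where k: "j = 2 * k \<and> b = k * (2 * k - 1) \<or> j = 2 * k + 1 \<and> b = k * (2 * k + 1)"
    using choose2_parametrised[of j] unfolding b_def by blast
  have "3 * (inv_A_snd h j (D_snd h j u) - D_snd h (inv_A_fst h j) (inv_A_snd h j u))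
      = 4 * h ^ 3 * (- 9 * b + 6 * u * b + 3 * j + 18 * j * b - 12 * g * b + 76 * g * b\<^sup>2
          - 6 * g * j + 40 * g * j * b + 24 * g * j * u * b + 48 * g\<^sup>2 * b - 80 * g\<^sup>2 * b\<^sup>2
          + 96 * g\<^sup>2 * u * b\<^sup>2 + 24 * g\<^sup>2 * j + 64 * g\<^sup>2 * j * b\<^sup>2 + 96 * g ^ 3 * b\<^sup>2 - 96 * g ^ 3 * j * b)"
    using k unfolding right_diff_distrib three_D_snd three_inv_A_snd choose2_inv_A_fst b_def[symmetric]
    unfolding inv_A_fst_def D_snd_def b_def[symmetric] h
    by (elim disjE conjE; hypsubst; simp add: algebra_simps power2_eq_square power3_eq_cube)
  then show ?thesis by simp
qed

lemma D_C_identity: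
  assumes "even h"
  shows "4 * h ^ 3 dvd D_snd h (C_fst h j) (C_snd h j u) - C_snd h j (D_snd h j (u - 4 * h\<^sup>2))"
proof -
  obtain g where h: "h = 2 * g" using assms ..
  define b where "b = choose2 j"
  obtain k where k: "j = 2 * k \<and> b = k * (2 * k - 1) \<or> j = 2 * k + 1 \<and> b = k * (2 * k + 1)"
    using choose2_parametrised[of j] unfolding b_def by blast
  have "D_snd h (C_fst h j) (C_snd h j u) - C_snd h j (D_snd h j (u - 4 * h\<^sup>2))
      = 4 * h ^ 3 * (10 * b + 2 * j + 2 * j * u + 8 * g - 16 * g * b + 2 * g * j - 8 * g * j * u
          + 64 * g\<^sup>2 * b + 8 * g\<^sup>2 * j + 32 * g\<^sup>2 * j * u + 128 * g ^ 3 * j)"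
    using k unfolding D_snd_def choose2_C_fst b_def[symmetric] unfolding C_snd_def C_fst_def h
    by (elim disjE conjE; hypsubst; simp add: algebra_simps power2_eq_square power3_eq_cube)
  then show ?thesis by simp
qed

text \<open>The iterates of the map of \<open>C\<close>, truncated like \<open>\<alpha>\<^sup>n\<close> and \<open>\<gamma>\<^sup>n\<close>.\<close>

definition C_pow_fst :: "int \<Rightarrow> int \<Rightarrow> int \<Rightarrow> int" where
  "C_pow_fst h n j = (1 + 2 * h * n + 4 * h\<^sup>2 * choose2 n) * j"

definition C_pow_snd :: "int \<Rightarrow> int \<Rightarrow> int \<Rightarrow> int \<Rightarrow> int" where
  "C_pow_snd h n j u = u * (1 - 2 * h * n + 4 * h\<^sup>2 * n + 4 * h\<^sup>2 * choose2 n) + j * (4 * h\<^sup>2 * n - 4 * h * n)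
     - (h - h\<^sup>2) * n + (2 * h\<^sup>2 - 2 * h ^ 3) * choose2 n"

lemma C_pow_Suc:
  "4 * h ^ 3 dvd C_fst h (C_pow_fst h n j) - C_pow_fst h (n + 1) j"
  "4 * h ^ 3 dvd C_snd h (C_pow_fst h n j) (C_pow_snd h n j u) - C_pow_snd h (n + 1) j u"
proof -
  have "C_fst h (C_pow_fst h n j) - C_pow_fst h (n + 1) j = 4 * h ^ 3 * (2 * j * choose2 n)"
    unfolding C_fst_def C_pow_fst_def choose2_Suc by (simp add: algebra_simps power2_eq_square power3_eq_cube)
  then show "4 * h ^ 3 dvd C_fst h (C_pow_fst h n j) - C_pow_fst h (n + 1) j" by simp
  have "C_snd h (C_pow_fst h n j) (C_pow_snd h n j u) - C_pow_snd h (n + 1) j u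
      = 4 * h ^ 3 * (- choose2 n - n - 2 * u * choose2 n - 4 * u * n - 4 * j * choose2 n - 4 * j * n
          + 3 * h * choose2 n + h * n + 4 * h * u * choose2 n + 4 * h * u * n + 4 * h * j * choose2 n
          + 4 * h * j * n - 2 * h\<^sup>2 * choose2 n)"
    unfolding C_snd_def C_pow_fst_def C_pow_snd_def choose2_Suc
    by (simp add: algebra_simps power2_eq_square power3_eq_cube)
  then show "4 * h ^ 3 dvd C_snd h (C_pow_fst h n j) (C_pow_snd h n j u) - C_pow_snd h (n + 1) j u" by simp
qed

text \<open>This makes the map of \<open>A\<^sup>-\<^sup>1\<close> well defined for \<open>j\<close> modulo \<open>P\<close>: a change of \<open>j\<close> by \<open>2 e\<close> with
  \<open>P\<close> dividing \<open>2 e\<close> changes the second coordinate by a multiple of \<open>4 h e\<close>, and \<open>Q\<close> divides \<open>4 h e\<close>.\<close>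

lemma inv_A_snd_shift:
  assumes "even h"
  shows "4 * h * e dvd 3 * (inv_A_snd h (j + 2 * e) u - inv_A_snd h j u)"
proof -
  obtain g where h: "h = 2 * g" using assms ..
  define b where "b = choose2 j"
  obtain k where k: "j = 2 * k \<and> b = k * (2 * k - 1) \<or> j = 2 * k + 1 \<and> b = k * (2 * k + 1)"
    using choose2_parametrised[of j] unfolding b_def by blast
  have te: "choose2 (2 * e) = e * (2 * e - 1)"
    using two_choose2[of "2 * e"] by simp
  have "3 * (inv_A_snd h (j + 2 * e) u - inv_A_snd h j u)
    = 4 * h * e * (- 3 + 9 * e + 3 * u + 9 * j + 4 * h - 9 * h * e + 8 * h * e\<^sup>2 + 12 * h * b
      - 3 * h * u + 6 * h * u * e - 3 * h * j + 12 * h * j * e + 6 * h * j * u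
      + 3 * h\<^sup>2 * e + 3 * h\<^sup>2 * j - 18 * g\<^sup>2)"
    using k unfolding right_diff_distrib three_inv_A_snd choose2_add te b_def[symmetric] unfolding h
    by (elim disjE conjE; hypsubst; simp add: algebra_simps power2_eq_square power3_eq_cube)
  then show ?thesis by simp
qed

section \<open>Collecting powers of a product\<close>

lemma (in group) inv_cancel [simp]:
  assumes "x \<in> carrier G" "y \<in> carrier G"
  shows "inv x \<otimes> (x \<otimes> y) = y" "x \<otimes> (inv x \<otimes> y) = y"
  using assms by (simp_all flip: m_assoc)

lemma (in group) int_pow_cong:
  assumes "x \<in> carrier G" "x [^] q = \<one>" "[i = j] (mod q)"
  shows "x [^] i = x [^] (j::int)"
proof -
  obtain k where "i = j + q * k" using cong_sym[OF assms(3)] unfolding cong_iff_lin by blast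
  then show ?thesis
    using assms by (simp add: int_pow_mult int_pow_pow[symmetric])
qed

lemma (in group) conj_int_pow:
  assumes [simp]: "x \<in> carrier G" "c \<in> carrier G"
  shows "(inv c \<otimes> x \<otimes> c) [^] (i::int) = inv c \<otimes> x [^] i \<otimes> c"
proof -
  have "(\<lambda>y. inv c \<otimes> y \<otimes> c) \<in> hom G G"
  proof (rule homI)
    fix y z assume "y \<in> carrier G" "z \<in> carrier G"
    then show "inv c \<otimes> (y \<otimes> z) \<otimes> c = inv c \<otimes> y \<otimes> c \<otimes> (inv c \<otimes> z \<otimes> c)"
      by (simp add: m_assoc)
  qed simp
  then show ?thesis
    using hom_int_pow[OF _ _ is_group is_group, of "\<lambda>y. inv c \<otimes> y \<otimes> c" x i] by simp
qed

lemma (in group) commutes_with_generated: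
  assumes "x \<in> carrier G" "S \<subseteq> carrier G" "\<And>y. y \<in> S \<Longrightarrow> x \<otimes> y = y \<otimes> x" "g \<in> generate G S"
  shows "x \<otimes> g = g \<otimes> x"
  using assms(4)
proof induction
  case (inv y)
  then have y: "y \<in> carrier G" "x \<otimes> y = y \<otimes> x" using assms(2,3) by auto
  then have "inv y \<otimes> (x \<otimes> y) \<otimes> inv y = inv y \<otimes> (y \<otimes> x) \<otimes> inv y" by simp
  then show ?case using y(1) assms(1) by (simp add: m_assoc)
next
  case (eng y z)
  then have yz: "y \<in> carrier G" "z \<in> carrier G" using generate_in_carrier assms(2) by auto
  then have "x \<otimes> (y \<otimes> z) = (x \<otimes> y) \<otimes> z" using assms(1) by (simp add: m_assoc)
  also have "\<dots> = y \<otimes> (x \<otimes> z)" using yz assms(1) by (simp only: eng.IH(1)) (simp add: m_assoc)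
  also have "\<dots> = (y \<otimes> z) \<otimes> x" using yz assms(1) by (simp only: eng.IH(2)) (simp add: m_assoc)
  finally show ?case .
qed (use assms in auto)

text \<open>Moving all \<open>c\<close> in \<open>(c a)\<^sup>n\<close> to the right produces one \<open>d\<close> for each pair \<open>c\<close>, \<open>a\<close> with \<open>c\<close> on the
  left, and one \<open>t\<close> for each \<open>c\<close> that passes a \<open>d\<close> on its way; this accounts for the two binomial
  coefficients.\<close>

lemma (in group) collect_power:
  assumes [simp]: "a \<in> carrier G" "c \<in> carrier G" "d \<in> carrier G" "t \<in> carrier G"
    and ca: "c \<otimes> a = a \<otimes> d \<otimes> c" and cd: "c \<otimes> d = d \<otimes> t \<otimes> c"
    and da: "d \<otimes> a = a \<otimes> d" and ta: "t \<otimes> a = a \<otimes> t" and tc: "c \<otimes> t = t \<otimes> c"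
    and td: "t \<otimes> d = d \<otimes> t"
  shows "(c \<otimes> a) [^] n = a [^] n \<otimes> d [^] (Suc n choose 2) \<otimes> t [^] (Suc n choose 3) \<otimes> c [^] (n::nat)"
proof -
  have comm: "x [^] i \<otimes> y = y \<otimes> x [^] i"
    if "x \<otimes> y = y \<otimes> x" "x \<in> carrier G" "y \<in> carrier G" for x y and i :: nat
    using that by (induction i) (simp_all add: m_assoc, metis m_assoc nat_pow_closed)
  have tn [simp]: "t [^] i \<otimes> (x \<otimes> y) = x \<otimes> (t [^] i \<otimes> y)"
    if "x = a \<or> x = d" "y \<in> carrier G" for x y and i :: nat
    using comm[of t x i] ta td that by (metis assms(1,3,4) m_assoc nat_pow_closed)
  have dn [simp]: "d [^] i \<otimes> (a \<otimes> y) = a \<otimes> (d [^] i \<otimes> y)" if "y \<in> carrier G" for y and i :: nat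
    using comm[of d a i] da that by (metis assms(1,3,4) m_assoc nat_pow_closed)
  have tdn: "t [^] j \<otimes> (d [^] i \<otimes> y) = d [^] i \<otimes> (t [^] j \<otimes> y)" if "y \<in> carrier G" for y and i j :: nat
    using comm[of d "t [^] j" i] comm[of t d j] td that by (metis assms(3,4) m_assoc nat_pow_closed)
  have cnd: "c [^] i \<otimes> d = d \<otimes> t [^] i \<otimes> c [^] i" for i :: nat
  proof (induction i)
    case (Suc i)
    have "c [^] Suc i \<otimes> d = (c [^] i \<otimes> d) \<otimes> (t \<otimes> c)"
      by (simp add: m_assoc cd)
    also have "\<dots> = d \<otimes> t [^] i \<otimes> (c [^] i \<otimes> t) \<otimes> c"
      by (simp only: Suc) (simp add: m_assoc del: tn dn)
    also have "c [^] i \<otimes> t = t \<otimes> c [^] i" by (rule comm) (simp_all add: tc)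
    also have "d \<otimes> t [^] i \<otimes> (t \<otimes> c [^] i) \<otimes> c = d \<otimes> t [^] Suc i \<otimes> c [^] Suc i"
      by (simp add: m_assoc del: tn dn)
    finally show ?case .
  qed simp
  have cna: "c [^] i \<otimes> a = a \<otimes> d [^] i \<otimes> t [^] (i choose 2) \<otimes> c [^] i" for i :: nat
  proof (induction i)
    case (Suc i)
    have "c [^] Suc i \<otimes> a = (c [^] i \<otimes> a) \<otimes> d \<otimes> c"
      by (simp add: m_assoc ca)
    also have "\<dots> = a \<otimes> d [^] i \<otimes> t [^] (i choose 2) \<otimes> (c [^] i \<otimes> d) \<otimes> c"
      by (simp only: Suc) (simp add: m_assoc del: tn dn)
    also have "\<dots> = a \<otimes> (d [^] i \<otimes> d) \<otimes> (t [^] (i choose 2) \<otimes> t [^] i) \<otimes> (c [^] i \<otimes> c)"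
      by (simp only: cnd) (simp add: m_assoc)
    also have "\<dots> = a \<otimes> d [^] Suc i \<otimes> t [^] (Suc i choose 2) \<otimes> c [^] Suc i"
      by (simp add: nat_pow_mult numeral_2_eq_2 add.commute)
    finally show ?case .
  qed (simp add: numeral_2_eq_2)
  show ?thesis
  proof (induction n)
    case (Suc n)
    let ?e = "Suc n choose 2" and ?f = "Suc n choose 3"
    have e: "Suc (Suc n) choose 2 = Suc (?e + n)" and f: "Suc (Suc n) choose 3 = ?f + (n choose 2) + n"
      by (simp_all add: numeral_2_eq_2 numeral_3_eq_3)
    have "(c \<otimes> a) [^] Suc n = (c \<otimes> a) [^] n \<otimes> (c \<otimes> a)" by simp
    also have "\<dots> = a [^] n \<otimes> d [^] ?e \<otimes> t [^] ?f \<otimes> c [^] n \<otimes> (a \<otimes> d \<otimes> c)"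
      by (simp only: Suc[symmetric]) (simp only: ca)
    also have "\<dots> = a [^] n \<otimes> (d [^] ?e \<otimes> (t [^] ?f \<otimes> ((c [^] n \<otimes> a) \<otimes> (d \<otimes> c))))"
      by (simp add: m_assoc del: tn dn)
    also have "\<dots> = a [^] n \<otimes> (d [^] ?e \<otimes> (t [^] ?f \<otimes> ((a \<otimes> d [^] n \<otimes> t [^] (n choose 2)) \<otimes> ((c [^] n \<otimes> d) \<otimes> c))))"
      by (simp only: cna) (simp add: m_assoc del: tn dn)
    also have "\<dots> = a [^] n \<otimes> (a \<otimes> (d [^] ?e \<otimes> (d [^] n \<otimes> (d \<otimes> (t [^] ?f \<otimes> (t [^] (n choose 2) \<otimes> (t [^] n \<otimes> (c [^] n \<otimes> c))))))))"
      by (simp only: cnd) (simp add: m_assoc tdn)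
    also have "\<dots> = (a [^] n \<otimes> a) \<otimes> (d [^] ?e \<otimes> d [^] n \<otimes> d) \<otimes> (t [^] ?f \<otimes> t [^] (n choose 2) \<otimes> t [^] n) \<otimes> (c [^] n \<otimes> c)"
      by (simp add: m_assoc del: tn dn)
    also have "\<dots> = a [^] Suc n \<otimes> d [^] (Suc (Suc n) choose 2) \<otimes> t [^] (Suc (Suc n) choose 3) \<otimes> c [^] Suc n"
      unfolding e f by (simp only: nat_pow_Suc nat_pow_mult assms)
    finally show ?case .
  qed (simp add: numeral_2_eq_2 numeral_3_eq_3)
qed

section \<open>Permutations of a finite quotient\<close>

text \<open>A quotient of the index set is represented by a map that chooses normal forms; maps between
  index points are compared only after normalisation.  Permutations of the normal forms then need
  no inverse maps, only injectivity.\<close>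

locale retraction =
  fixes nrm :: "'a \<Rightarrow> 'a"
  assumes idem [simp]: "nrm (nrm p) = nrm p" and fin: "finite (range nrm)"
begin

text \<open>One direction says that \<open>f\<close> is well defined on the classes, the other that it is injective on
  them.\<close>

definition faithful :: "('a \<Rightarrow> 'a) \<Rightarrow> bool" where
  "faithful f \<longleftrightarrow> (\<forall>p q. nrm (f p) = nrm (f q) \<longleftrightarrow> nrm p = nrm q)"

definition act :: "('a \<Rightarrow> 'a) \<Rightarrow> 'a \<Rightarrow> 'a" where
  "act f = (\<lambda>p\<in>range nrm. nrm (f p))"

abbreviation H :: "('a \<Rightarrow> 'a) monoid" where "H \<equiv> BijGroup (range nrm)"

lemma act_apply: "faithful f \<Longrightarrow> act f (nrm p) = nrm (f p)"
  by (simp add: act_def faithful_def)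

lemma act_closed: assumes "faithful f" shows "act f \<in> carrier H"
proof -
  have "inj_on (\<lambda>p. nrm (f p)) (range nrm)"
    using assms by (auto simp: inj_on_def faithful_def)
  moreover have "(\<lambda>p. nrm (f p)) ` range nrm = range nrm"
    by (rule endo_inj_surj[OF fin _ calculation]) auto
  ultimately have "bij_betw (\<lambda>p. nrm (f p)) (range nrm) (range nrm)"
    by (simp add: bij_betw_def)
  then show ?thesis
    by (simp add: BijGroup_def Bij_def act_def cong: bij_betw_cong)
qed

lemma mult_apply: "f \<in> carrier H \<Longrightarrow> g \<in> carrier H \<Longrightarrow> p \<in> range nrm \<Longrightarrow> (f \<otimes>\<^bsub>H\<^esub> g) p = f (g p)"
  by (simp add: BijGroup_def compose_def)

lemma act_mult:
  assumes "faithful f" "act g \<in> carrier H"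
  shows "act f \<otimes>\<^bsub>H\<^esub> act g = act (f \<circ> g)"
proof
  fix p
  show "(act f \<otimes>\<^bsub>H\<^esub> act g) p = act (f \<circ> g) p"
    using act_closed[OF assms(1)] assms by (simp add: BijGroup_def compose_def act_def faithful_def)
qed

lemma act_eqI: "(\<And>p. nrm (f p) = nrm (g p)) \<Longrightarrow> act f = act g"
  by (simp add: act_def)

lemma act_id: "act (\<lambda>p. p) = \<one>\<^bsub>H\<^esub>"
  unfolding act_def BijGroup_def by (auto intro!: restrict_ext)

lemma faithful_comp: "faithful f \<Longrightarrow> faithful g \<Longrightarrow> faithful (f \<circ> g)"
  by (simp add: faithful_def)

lemma closed_eqI:
  assumes "f \<in> carrier H" "g \<in> carrier H" "\<And>p. f (nrm p) = g (nrm p)"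
  shows "f = g"
  using assms by (intro extensionalityI[of f "range nrm"]) (auto simp: BijGroup_def Bij_def)

lemma act_pow:
  assumes "faithful f" "\<And>p. nrm (F 0 p) = nrm p" "\<And>n p. nrm (f (F n p)) = nrm (F (Suc n) p)"
  shows "act f [^]\<^bsub>H\<^esub> (n::nat) = act (F n)"
proof -
  interpret group H by (rule group_BijGroup)
  note [simp] = act_closed[OF assms(1)]
  show ?thesis
  proof (induction n)
    case 0
    show ?case using act_eqI[of "F 0" "\<lambda>p. p"] assms(2) act_id by simp
  next
    case (Suc n)
    have "act f [^]\<^bsub>H\<^esub> Suc n = act f \<otimes>\<^bsub>H\<^esub> act (F n)"
      using nat_pow_Suc2[of "act f" n] Suc by simp
    also have "\<dots> = act (f \<circ> F n)"
      using act_mult[OF assms(1), of "F n"] Suc nat_pow_closed[of "act f" n] by simp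
    also have "\<dots> = act (F (Suc n))" by (rule act_eqI) (simp add: assms(3))
    finally show ?case .
  qed
qed

end

section \<open>A permutation model of the Macdonald group\<close>

locale macdonald_permutations = macdonald_parameters
begin

definition nrm :: "int \<times> int \<Rightarrow> int \<times> int" where
  "nrm p = (fst p mod P, snd p mod Q)"

lemma nrm_eq_iff: "nrm p = nrm q \<longleftrightarrow> P dvd fst p - fst q \<and> Q dvd snd p - snd q"
  by (simp add: nrm_def mod_eq_dvd_iff)

lemma nrm_eqI: "P dvd j - j' \<Longrightarrow> Q dvd u - u' \<Longrightarrow> nrm (j, u) = nrm (j', u')"
  by (simp add: nrm_eq_iff)

sublocale retraction nrm
proof
  show "nrm (nrm p) = nrm p" for p by (simp add: nrm_def)
  have "range nrm \<subseteq> {0..<P} \<times> {0..<Q}" by (auto simp: nrm_def)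
  then show "finite (range nrm)" by (rule finite_subset) simp
qed

lemma Q_dvd_4h3_mult: "4 * h ^ 3 dvd x \<Longrightarrow> Q dvd x"
  using Q_dvd_4h3 by (rule dvd_trans)

lemma Q_dvd_4h3_mult3: "4 * h ^ 3 dvd 3 * x \<Longrightarrow> Q dvd x"
  using Q_dvd_4h3_mult Q_dvd_3 by blast

lemma P_dvd_4h3_mult: "4 * h ^ 3 dvd x \<Longrightarrow> P dvd x"
  using Q_dvd_4h3_mult P_dvd_Q dvd_trans by blast

text \<open>The even shift \<open>2 e\<close> keeps \<open>choose2 (j + 2 e)\<close> polynomial in \<open>e\<close>.\<close>

lemma faithfulI:
  assumes 1: "\<And>j j'. P dvd f1 j - f1 j' \<longleftrightarrow> P dvd j - j'"
    and 2: "\<And>j u v. Q dvd f2 j u - f2 j v \<longleftrightarrow> Q dvd u - v"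
    and 3: "\<And>j e u. P dvd 2 * e \<Longrightarrow> Q dvd f2 (j + 2 * e) u - f2 j u"
  shows "faithful (\<lambda>p. (f1 (fst p), f2 (fst p) (snd p)))"
  unfolding faithful_def nrm_eq_iff
proof (intro allI)
  fix p q :: "int \<times> int"
  obtain j u where p: "p = (j, u)" by fastforce
  obtain j' v where q: "q = (j', v)" by fastforce
  have "Q dvd f2 j u - f2 j' v \<longleftrightarrow> Q dvd u - v" if d: "P dvd j - j'"
  proof -
    obtain e where e: "j - j' = 2 * e"
      using even_P d by (meson dvdE dvd_trans)
    have "Q dvd f2 j u - f2 j' u"
      using 3[of e j' u] e d by (simp add: algebra_simps)
    moreover have "f2 j u - f2 j' v = (f2 j u - f2 j' u) + (f2 j' u - f2 j' v)" by simp
    ultimately show ?thesis using 2[of j' u v] by (metis dvd_add_right_iff)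
  qed
  then show "(P dvd fst (f1 (fst p), f2 (fst p) (snd p)) - fst (f1 (fst q), f2 (fst q) (snd q)) \<and>
      Q dvd snd (f1 (fst p), f2 (fst p) (snd p)) - snd (f1 (fst q), f2 (fst q) (snd q)))
    \<longleftrightarrow> P dvd fst p - fst q \<and> Q dvd snd p - snd q"
    using 1[of j j'] by (auto simp: p q)
qed

text \<open>\<open>T\<close> is the power of \<open>A\<close> with exponent \<open>- 4 h\<^sup>2\<close>, the factor by which \<open>C\<close> moves
  \<open>D\<close>; \<open>V\<close> is the product \<open>D\<^sup>e C\<^sup>-\<^sup>2\<^sup>h\<close> with \<open>e = h (2 h + 1)\<close>, by which \<open>D\<close> changes in passing \<open>B\<close>.\<close>

definition inv_A_map where "inv_A_map p = (inv_A_fst h (fst p), inv_A_snd h (fst p) (snd p))"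
definition B_map :: "int \<times> int \<Rightarrow> int \<times> int" where "B_map p = (fst p + 1, snd p - 1)"
definition B_inv_map :: "int \<times> int \<Rightarrow> int \<times> int" where "B_inv_map p = (fst p - 1, snd p + 1)"
definition C_map where "C_map p = (C_fst h (fst p), C_snd h (fst p) (snd p))"
definition D_map where "D_map p = (fst p, D_snd h (fst p) (snd p))"
definition T_map :: "int \<times> int \<Rightarrow> int \<times> int" where "T_map p = (fst p, snd p - 4 * h\<^sup>2)"
definition V_map :: "int \<times> int \<Rightarrow> int \<times> int" where "V_map p = (fst p, snd p + 4 * h\<^sup>2 * (snd p + 2 * fst p))"

lemma faithful_inv_A_map: "faithful inv_A_map"
  unfolding inv_A_map_def
proof (rule faithfulI)
  fix j j' u v e
  have "inv_A_fst h i = i - h * (i * (i - 1))" for i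
    unfolding inv_A_fst_def two_choose2[symmetric] by simp
  then have "inv_A_fst h j - inv_A_fst h j' = (1 - h * (j + j' - 1)) * (j - j')"
    by (simp only:) (simp add: algebra_simps)
  moreover have "odd (1 - h * (j + j' - 1))" using even_h by simp
  ultimately show "P dvd inv_A_fst h j - inv_A_fst h j' \<longleftrightarrow> P dvd j - j'"
    using dvd_odd_mult_iff(1) by metis
  have "inv_A_snd h j u - inv_A_snd h j v = (1 + 2 * h * j + 4 * h\<^sup>2 * choose2 j) * (u - v)"
    by (simp add: inv_A_snd_def algebra_simps)
  moreover have "odd (1 + 2 * h * j + 4 * h\<^sup>2 * choose2 j)" by simp
  ultimately show "Q dvd inv_A_snd h j u - inv_A_snd h j v \<longleftrightarrow> Q dvd u - v"
    using dvd_odd_mult_iff(2) by metis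
  assume "P dvd 2 * e"
  then show "Q dvd inv_A_snd h (j + 2 * e) u - inv_A_snd h j u"
    using inv_A_snd_shift[OF even_h] Q_dvd_4he Q_dvd_3 dvd_trans by blast
qed

lemma faithful_B_map: "faithful B_map"
  unfolding B_map_def by (rule faithfulI) simp_all

lemma faithful_B_inv_map: "faithful B_inv_map"
  unfolding B_inv_map_def by (rule faithfulI) simp_all

lemma faithful_T_map: "faithful T_map"
  unfolding T_map_def by (rule faithfulI) simp_all

lemma faithful_C_map: "faithful C_map"
  unfolding C_map_def
proof (rule faithfulI)
  fix j j' u v e
  have "C_fst h j - C_fst h j' = (1 + 2 * h) * (j - j')" by (simp add: C_fst_def algebra_simps)
  then show "P dvd C_fst h j - C_fst h j' \<longleftrightarrow> P dvd j - j'"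
    by (simp only: dvd_odd_mult_iff) (simp add: dvd_odd_mult_iff)
  have "C_snd h j u - C_snd h j v = (1 - 2 * h + 4 * h\<^sup>2) * (u - v)" by (simp add: C_snd_def algebra_simps)
  then show "Q dvd C_snd h j u - C_snd h j v \<longleftrightarrow> Q dvd u - v"
    by (simp add: dvd_odd_mult_iff)
  have "C_snd h (j + 2 * e) u - C_snd h j u = 4 * h * e * (2 * h - 2)"
    by (simp add: C_snd_def algebra_simps power2_eq_square)
  moreover assume "P dvd 2 * e"
  ultimately show "Q dvd C_snd h (j + 2 * e) u - C_snd h j u"
    using Q_dvd_4he by simp
qed

lemma faithful_D_map: "faithful D_map"
  unfolding D_map_def
proof (rule faithfulI)
  fix j j' u v e
  show "P dvd j - j' \<longleftrightarrow> P dvd j - j'" ..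
  have "D_snd h j u - D_snd h j v = (1 + 4 * h\<^sup>2 * j) * (u - v)" by (simp add: D_snd_def algebra_simps)
  then show "Q dvd D_snd h j u - D_snd h j v \<longleftrightarrow> Q dvd u - v"
    by (simp add: dvd_odd_mult_iff)
  have te: "choose2 (2 * e) = e * (2 * e - 1)"
    using two_choose2[of "2 * e"] by simp
  have "D_snd h (j + 2 * e) u - D_snd h j u = 4 * h * e * (h * (2 * u + 2 + 3 * (2 * e - 1 + 2 * j)))"
    unfolding D_snd_def choose2_add te by (simp add: algebra_simps power2_eq_square)
  moreover assume "P dvd 2 * e"
  ultimately show "Q dvd D_snd h (j + 2 * e) u - D_snd h j u"
    using Q_dvd_4he by simp
qed

lemma faithful_V_map: "faithful V_map"
  unfolding V_map_def
proof (rule faithfulI)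
  fix j j' u v e
  show "P dvd j - j' \<longleftrightarrow> P dvd j - j'" ..
  have "u + 4 * h\<^sup>2 * (u + 2 * j) - (v + 4 * h\<^sup>2 * (v + 2 * j)) = (1 + 4 * h\<^sup>2) * (u - v)"
    by (simp add: algebra_simps)
  then show "Q dvd u + 4 * h\<^sup>2 * (u + 2 * j) - (v + 4 * h\<^sup>2 * (v + 2 * j)) \<longleftrightarrow> Q dvd u - v"
    by (simp add: dvd_odd_mult_iff)
  have "u + 4 * h\<^sup>2 * (u + 2 * (j + 2 * e)) - (u + 4 * h\<^sup>2 * (u + 2 * j)) = 4 * h * e * (4 * h)"
    by (simp add: algebra_simps power2_eq_square)
  moreover assume "P dvd 2 * e"
  ultimately show "Q dvd u + 4 * h\<^sup>2 * (u + 2 * (j + 2 * e)) - (u + 4 * h\<^sup>2 * (u + 2 * j))"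
    by (simp only: Q_dvd_4he dvd_mult2)
qed

abbreviation "a \<equiv> act inv_A_map"
abbreviation "b \<equiv> act B_map"
abbreviation "c \<equiv> act C_map"
abbreviation "d \<equiv> act D_map"
abbreviation "t \<equiv> act T_map"
abbreviation "v \<equiv> act V_map"

lemmas closed [simp] = act_closed[OF faithful_inv_A_map] act_closed[OF faithful_B_map] act_closed[OF faithful_B_inv_map]
  act_closed[OF faithful_C_map] act_closed[OF faithful_D_map] act_closed[OF faithful_T_map] act_closed[OF faithful_V_map]

lemmas faithful_simps = faithful_inv_A_map faithful_B_map faithful_B_inv_map faithful_C_map faithful_D_map faithful_T_map
  faithful_V_map faithful_comp act_closed act_mult

lemma B_inv_relation: "act B_inv_map \<otimes>\<^bsub>H\<^esub> b = \<one>\<^bsub>H\<^esub>"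
  unfolding act_id[symmetric] by (simp add: faithful_simps) (rule act_eqI, simp add: B_map_def B_inv_map_def)

lemma commutator_relation: "c \<otimes>\<^bsub>H\<^esub> act B_inv_map \<otimes>\<^bsub>H\<^esub> a \<otimes>\<^bsub>H\<^esub> b = a"
proof -
  have "nrm ((C_map \<circ> B_inv_map \<circ> inv_A_map \<circ> B_map) p) = nrm (inv_A_map p)" for p
  proof -
    obtain j u where p: "p = (j, u)" by fastforce
    have "C_fst h (inv_A_fst h (j + 1) - 1) - inv_A_fst h j = - 2 * h\<^sup>2 * (2 * (choose2 j + j))"
      unfolding C_fst_def inv_A_fst_def choose2_Suc by (simp add: algebra_simps power2_eq_square)
    then have "P dvd C_fst h (inv_A_fst h (j + 1) - 1) - inv_A_fst h j" using P_dvd_2h2 by simp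
    then show ?thesis
      using Q_dvd_4h3_mult3[OF commutator_identity[OF even_h, of j u]]
      by (simp add: p C_map_def B_inv_map_def inv_A_map_def B_map_def nrm_eqI)
  qed
  then show ?thesis by (simp add: faithful_simps) (rule act_eqI, simp)
qed

lemma inv_A_C_relation: "a \<otimes>\<^bsub>H\<^esub> c = c \<otimes>\<^bsub>H\<^esub> a \<otimes>\<^bsub>H\<^esub> d"
proof -
  have "nrm ((inv_A_map \<circ> C_map) p) = nrm ((C_map \<circ> inv_A_map \<circ> D_map) p)" for p
  proof -
    obtain j u where p: "p = (j, u)" by fastforce
    have "inv_A_fst h (C_fst h j) - C_fst h (inv_A_fst h j) = 2 * h\<^sup>2 * (2 * choose2 j - j * (2 * j - 1) - 2 * h * j\<^sup>2)"
      by (simp add: C_fst_def[of h "inv_A_fst h j"] inv_A_fst_def choose2_C_fst) (simp add: C_fst_def algebra_simps power2_eq_square)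
    then have "P dvd inv_A_fst h (C_fst h j) - C_fst h (inv_A_fst h j)" using P_dvd_2h2 by simp
    then show ?thesis
      using Q_dvd_4h3_mult3[OF inv_A_C_identity[OF even_h, of j u]]
      by (simp add: p C_map_def D_map_def inv_A_map_def nrm_eqI)
  qed
  then show ?thesis by (simp add: faithful_simps) (rule act_eqI, simp)
qed

lemma D_inv_A_relation: "d \<otimes>\<^bsub>H\<^esub> a = a \<otimes>\<^bsub>H\<^esub> d"
proof -
  have "nrm ((inv_A_map \<circ> D_map) p) = nrm ((D_map \<circ> inv_A_map) p)" for p
    using Q_dvd_4h3_mult3[OF inv_A_D_identity[OF even_h, of "fst p" "snd p"]]
    by (simp add: D_map_def inv_A_map_def nrm_eqI)
  then show ?thesis by (simp add: faithful_simps) (rule act_eqI, simp)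
qed

lemma D_C_relation: "d \<otimes>\<^bsub>H\<^esub> c = c \<otimes>\<^bsub>H\<^esub> d \<otimes>\<^bsub>H\<^esub> t"
proof -
  have "nrm ((D_map \<circ> C_map) p) = nrm ((C_map \<circ> D_map \<circ> T_map) p)" for p
    using Q_dvd_4h3_mult[OF D_C_identity[OF even_h, of "fst p" "snd p"]]
    by (simp add: D_map_def C_map_def T_map_def nrm_eqI)
  then show ?thesis by (simp add: faithful_simps) (rule act_eqI, simp)
qed

lemma C_B_relation: "c \<otimes>\<^bsub>H\<^esub> b = act (\<lambda>p. (fst p + (1 + 2 * h), snd p - (1 + 2 * h))) \<otimes>\<^bsub>H\<^esub> c"
proof -
  have r: "faithful (\<lambda>p. (fst p + (1 + 2 * h), snd p - (1 + 2 * h)))"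
    by (rule faithfulI) simp_all
  have "nrm ((C_map \<circ> B_map) p) = nrm (((\<lambda>p. (fst p + (1 + 2 * h), snd p - (1 + 2 * h))) \<circ> C_map) p)" for p
    by (simp add: B_map_def C_map_def C_fst_def C_snd_def algebra_simps)
  then show ?thesis using r by (simp add: faithful_simps) (rule act_eqI, simp)
qed

lemma b_pow: "b [^]\<^bsub>H\<^esub> (n::nat) = act (\<lambda>p. (fst p + int n, snd p - int n))"
  using act_pow[OF faithful_B_map, of "\<lambda>n p. (fst p + int n, snd p - int n)" n]
  by (simp add: B_map_def algebra_simps)

lemma t_pow: "t [^]\<^bsub>H\<^esub> (n::nat) = act (\<lambda>p. (fst p, snd p - 4 * h\<^sup>2 * int n))"
  using act_pow[OF faithful_T_map, of "\<lambda>n p. (fst p, snd p - 4 * h\<^sup>2 * int n)" n]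
  by (simp add: T_map_def algebra_simps)

lemma c_pow: "c [^]\<^bsub>H\<^esub> (n::nat) = act (\<lambda>p. (C_pow_fst h (int n) (fst p), C_pow_snd h (int n) (fst p) (snd p)))"
proof (rule act_pow[OF faithful_C_map])
  fix n :: nat and p :: "int \<times> int"
  show "nrm (C_map (C_pow_fst h (int n) (fst p), C_pow_snd h (int n) (fst p) (snd p))) =
      nrm (C_pow_fst h (int (Suc n)) (fst p), C_pow_snd h (int (Suc n)) (fst p) (snd p))"
    using P_dvd_4h3_mult[OF C_pow_Suc(1)[of h "int n" "fst p"]]
      Q_dvd_4h3_mult[OF C_pow_Suc(2)[of h "int n" "fst p" "snd p"]]
    by (simp add: C_map_def nrm_eqI add.commute)
qed (simp add: C_pow_fst_def C_pow_snd_def choose2_def)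

definition D_pow_snd :: "int \<Rightarrow> int \<Rightarrow> int \<Rightarrow> int" where
  "D_pow_snd n j u = u - 2 * h * n + 4 * h\<^sup>2 * n * (u * j + j + 3 * choose2 j)"

lemma d_pow: "d [^]\<^bsub>H\<^esub> (n::nat) = act (\<lambda>p. (fst p, D_pow_snd (int n) (fst p) (snd p)))"
proof (rule act_pow[OF faithful_D_map])
  fix n :: nat and p :: "int \<times> int"
  obtain j u where p: "p = (j, u)" by fastforce
  have "D_snd h j (D_pow_snd (int n) j u) - D_pow_snd (int n + 1) j u
     = 4 * h ^ 3 * (int n * j * (4 * h * (u * j + j + 3 * choose2 j) - 2))"
    by (simp add: D_snd_def D_pow_snd_def algebra_simps power2_eq_square power3_eq_cube)
  then have "Q dvd D_snd h j (D_pow_snd (int n) j u) - D_pow_snd (int n + 1) j u"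
    by (intro Q_dvd_4h3_mult) simp
  then show "nrm (D_map (fst p, D_pow_snd (int n) (fst p) (snd p))) = nrm (fst p, D_pow_snd (int (Suc n)) (fst p) (snd p))"
    by (simp add: p D_map_def nrm_eqI add.commute)
qed (simp add: D_pow_snd_def)

lemma a_pow_axis: "(a [^]\<^bsub>H\<^esub> n) (nrm (0, u)) = nrm (0, u - int n)"
proof (induction n)
  case 0
  interpret group H by (rule group_BijGroup)
  show ?case by (simp add: BijGroup_def)
next
  case (Suc n)
  interpret group H by (rule group_BijGroup)
  have "(a [^]\<^bsub>H\<^esub> Suc n) (nrm (0, u)) = a (nrm (0, u - int n))"
    unfolding nat_pow_Suc2[OF closed(1)] by (simp add: mult_apply Suc)
  also have "\<dots> = nrm (0, u - int (Suc n))"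
    by (simp add: act_apply faithful_inv_A_map inv_A_map_def inv_A_fst_def inv_A_snd_def choose2_def choose3_def algebra_simps)
  finally show ?case .
qed

text \<open>Both \<open>a\<^sup>n\<close> and \<open>F\<close> obey the rule \<open>G b = b G V\<close>: for \<open>F\<close> by assumption, for \<open>a\<^sup>n\<close> because
  \<open>b\<^sup>-\<^sup>1 a b = c\<^sup>-\<^sup>1 a\<close> and the power of \<open>c\<^sup>-\<^sup>1 a\<close> can be collected.  As \<open>V\<close> preserves the first
  coordinate, this rule determines \<open>G\<close> on \<open>j + 1\<close> from \<open>G\<close> on \<open>j\<close>, and the two maps agree for
  \<open>j = 0\<close>.\<close>

lemma power_unique:
  assumes [simp]: "F \<in> carrier H" and V [simp]: "faithful V" and fst_V: "\<And>p. fst (V p) = fst p"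
    and axis: "\<And>u. F (nrm (0, u)) = nrm (0, u - int n)"
    and Fb: "F \<otimes>\<^bsub>H\<^esub> b = b \<otimes>\<^bsub>H\<^esub> F \<otimes>\<^bsub>H\<^esub> act V"
    and Vc: "act V \<otimes>\<^bsub>H\<^esub> c [^]\<^bsub>H\<^esub> n
      = d [^]\<^bsub>H\<^esub> (Suc n choose 2) \<otimes>\<^bsub>H\<^esub> t [^]\<^bsub>H\<^esub> (Suc n choose 3)"
  shows "a [^]\<^bsub>H\<^esub> n = F"
proof -
  interpret group H by (rule group_BijGroup)
  note [simp] = act_closed[OF V]
  define C where "C = inv\<^bsub>H\<^esub> c"
  have C [simp]: "C \<in> carrier H" by (simp add: C_def)
  have Cc: "C \<otimes>\<^bsub>H\<^esub> (c \<otimes>\<^bsub>H\<^esub> x) = x" "x \<otimes>\<^bsub>H\<^esub> c \<otimes>\<^bsub>H\<^esub> C = x" if "x \<in> carrier H" for x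
    using that by (simp_all add: C_def m_assoc flip: m_assoc[of "inv\<^bsub>H\<^esub> c"])
  have conj: "C \<otimes>\<^bsub>H\<^esub> x = y \<otimes>\<^bsub>H\<^esub> C"
    if "x \<otimes>\<^bsub>H\<^esub> c = c \<otimes>\<^bsub>H\<^esub> y" "x \<in> carrier H" "y \<in> carrier H" for x y
  proof -
    have "C \<otimes>\<^bsub>H\<^esub> x = C \<otimes>\<^bsub>H\<^esub> (x \<otimes>\<^bsub>H\<^esub> c \<otimes>\<^bsub>H\<^esub> C)" by (simp only: Cc(2)[OF that(2)])
    also have "\<dots> = y \<otimes>\<^bsub>H\<^esub> C" unfolding that(1) by (simp add: that(2,3) m_assoc Cc(1))
    finally show ?thesis .
  qed
  have t_comm: "t \<otimes>\<^bsub>H\<^esub> act f = act f \<otimes>\<^bsub>H\<^esub> t"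
    if "faithful f" "\<And>p. nrm (T_map (f p)) = nrm (f (T_map p))" for f
    using that by (simp add: faithful_simps) (rule act_eqI, simp)
  have four_h2: "Q dvd x" if "x = 4 * h ^ 3 * y" for x y
    using that by (intro Q_dvd_4h3_mult) simp
  have ta: "t \<otimes>\<^bsub>H\<^esub> a = a \<otimes>\<^bsub>H\<^esub> t"
  proof (rule t_comm[OF faithful_inv_A_map])
    fix p :: "int \<times> int"
    show "nrm (T_map (inv_A_map p)) = nrm (inv_A_map (T_map p))"
      unfolding T_map_def inv_A_map_def fst_conv snd_conv
      by (rule nrm_eqI, simp, rule four_h2[of _ "2 * fst p + 4 * h * choose2 (fst p)"])
        (simp add: inv_A_snd_def algebra_simps power2_eq_square power3_eq_cube)
  qed
  have tc: "t \<otimes>\<^bsub>H\<^esub> c = c \<otimes>\<^bsub>H\<^esub> t"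
  proof (rule t_comm[OF faithful_C_map])
    fix p :: "int \<times> int"
    show "nrm (T_map (C_map p)) = nrm (C_map (T_map p))"
      unfolding T_map_def C_map_def fst_conv snd_conv
      by (rule nrm_eqI, simp, rule four_h2[of _ "4 * h - 2"])
        (simp add: C_snd_def algebra_simps power2_eq_square power3_eq_cube)
  qed
  have td: "t \<otimes>\<^bsub>H\<^esub> d = d \<otimes>\<^bsub>H\<^esub> t"
  proof (rule t_comm[OF faithful_D_map])
    fix p :: "int \<times> int"
    show "nrm (T_map (D_map p)) = nrm (D_map (T_map p))"
      unfolding T_map_def D_map_def fst_conv snd_conv
      by (rule nrm_eqI, simp, rule four_h2[of _ "4 * h * fst p"])
        (simp add: D_snd_def algebra_simps power2_eq_square power3_eq_cube)
  qed
  have Ca: "C \<otimes>\<^bsub>H\<^esub> a = a \<otimes>\<^bsub>H\<^esub> d \<otimes>\<^bsub>H\<^esub> C"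
    by (rule conj) (simp_all add: inv_A_C_relation m_assoc)
  have Cd: "C \<otimes>\<^bsub>H\<^esub> d = d \<otimes>\<^bsub>H\<^esub> t \<otimes>\<^bsub>H\<^esub> C"
    by (rule conj) (simp_all add: D_C_relation m_assoc)
  have Ct: "C \<otimes>\<^bsub>H\<^esub> t = t \<otimes>\<^bsub>H\<^esub> C"
    by (rule conj) (simp_all add: tc)
  have collected: "(C \<otimes>\<^bsub>H\<^esub> a) [^]\<^bsub>H\<^esub> n
      = a [^]\<^bsub>H\<^esub> n \<otimes>\<^bsub>H\<^esub> act V"
  proof -
    have "(C \<otimes>\<^bsub>H\<^esub> a) [^]\<^bsub>H\<^esub> n
      = a [^]\<^bsub>H\<^esub> n \<otimes>\<^bsub>H\<^esub> (d [^]\<^bsub>H\<^esub> (Suc n choose 2) \<otimes>\<^bsub>H\<^esub> t [^]\<^bsub>H\<^esub> (Suc n choose 3)) \<otimes>\<^bsub>H\<^esub> C [^]\<^bsub>H\<^esub> n"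
      by (subst collect_power[OF _ _ _ _ Ca Cd D_inv_A_relation ta Ct td]) (simp_all add: m_assoc)
    also have "C [^]\<^bsub>H\<^esub> n = inv\<^bsub>H\<^esub> (c [^]\<^bsub>H\<^esub> n)"
      by (simp add: C_def nat_pow_inv)
    finally show ?thesis by (simp add: Vc[symmetric] m_assoc)
  qed
  have ab: "a \<otimes>\<^bsub>H\<^esub> b = b \<otimes>\<^bsub>H\<^esub> (C \<otimes>\<^bsub>H\<^esub> a)"
  proof -
    have "act B_inv_map = inv\<^bsub>H\<^esub> b" using B_inv_relation by (intro inv_equality[symmetric]) simp_all
    then have "C \<otimes>\<^bsub>H\<^esub> a = inv\<^bsub>H\<^esub> b \<otimes>\<^bsub>H\<^esub> (a \<otimes>\<^bsub>H\<^esub> b)"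
      by (subst commutator_relation[symmetric]) (simp add: m_assoc Cc)
    then show ?thesis by (simp flip: m_assoc)
  qed
  have "a [^]\<^bsub>H\<^esub> k \<otimes>\<^bsub>H\<^esub> b = b \<otimes>\<^bsub>H\<^esub> (C \<otimes>\<^bsub>H\<^esub> a) [^]\<^bsub>H\<^esub> k" for k :: nat
  proof (induction k)
    case (Suc k)
    have "a [^]\<^bsub>H\<^esub> Suc k \<otimes>\<^bsub>H\<^esub> b = (a [^]\<^bsub>H\<^esub> k \<otimes>\<^bsub>H\<^esub> b) \<otimes>\<^bsub>H\<^esub> (C \<otimes>\<^bsub>H\<^esub> a)"
      by (simp add: m_assoc ab)
    also have "\<dots> = b \<otimes>\<^bsub>H\<^esub> (C \<otimes>\<^bsub>H\<^esub> a) [^]\<^bsub>H\<^esub> Suc k"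
      by (simp only: Suc) (simp add: m_assoc)
    finally show ?case .
  qed simp
  then have anb: "a [^]\<^bsub>H\<^esub> n \<otimes>\<^bsub>H\<^esub> b = b \<otimes>\<^bsub>H\<^esub> a [^]\<^bsub>H\<^esub> n \<otimes>\<^bsub>H\<^esub> act V"
    by (simp add: collected m_assoc)
  have shift: "G (nrm (j + 1, u)) = b (G (nrm (V (j, u + 1))))"
    if "G \<otimes>\<^bsub>H\<^esub> b = b \<otimes>\<^bsub>H\<^esub> G \<otimes>\<^bsub>H\<^esub> act V" "G \<in> carrier H" for G j u
  proof -
    have "G (nrm (j + 1, u)) = (G \<otimes>\<^bsub>H\<^esub> b) (nrm (j, u + 1))"
      using that(2) by (simp add: mult_apply act_apply faithful_B_map B_map_def)
    also have "\<dots> = (b \<otimes>\<^bsub>H\<^esub> G \<otimes>\<^bsub>H\<^esub> act V) (nrm (j, u + 1))"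
      by (simp only: that(1))
    also have "\<dots> = b (G (nrm (V (j, u + 1))))"
      using that(2) by (simp add: mult_apply act_apply)
    finally show ?thesis .
  qed
  have agree: "(a [^]\<^bsub>H\<^esub> n) (nrm (int k, u)) = F (nrm (int k, u))" for k u
  proof (induction k arbitrary: u)
    case 0
    show ?case by (simp add: a_pow_axis axis)
  next
    case (Suc k)
    obtain w where w: "V (int k, 1 + u) = (int k, w)"
      using fst_V[of "(int k, 1 + u)"] by (metis fst_conv prod.exhaust_sel)
    show ?case
      using shift[OF anb, of "int k" u] shift[OF Fb, of "int k" u] Suc
      by (simp add: w add.commute)
  qed
  show ?thesis
  proof (rule closed_eqI)
    fix p :: "int \<times> int"
    have "nrm p = nrm (int (nat (fst p mod P)), snd p)"
      by (simp add: nrm_def)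
    then show "(a [^]\<^bsub>H\<^esub> n) (nrm p) = F (nrm p)"
      using agree by metis
  qed simp_all
qed

lemma Q_nonneg [simp]: "0 \<le> Q"
  using Q_pos by (rule less_imp_le)

lemma int_Suc_choose_2: "int (Suc n choose 2) = choose2 (int n + 1)"
  using choose2_of_nat[of "Suc n"] by (simp add: add.commute)

lemma three_int_Suc_choose_3: "3 * int (Suc n choose 3) = choose2 (int n + 1) * (int n - 1)"
  using choose3_of_nat[of "Suc n"] three_choose3[of "int n + 1"] by (simp add: add.commute)

lemma c_pow_closed: "act (\<lambda>p. (C_pow_fst h (int n) (fst p), C_pow_snd h (int n) (fst p) (snd p))) \<in> carrier H"
proof -
  interpret group H by (rule group_BijGroup)
  show ?thesis unfolding c_pow[symmetric] by simp
qed

lemma dt_pow: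
  "d [^]\<^bsub>H\<^esub> (e::nat) \<otimes>\<^bsub>H\<^esub> t [^]\<^bsub>H\<^esub> (f::nat)
    = act (\<lambda>p. (fst p, D_pow_snd (int e) (fst p) (snd p - 4 * h\<^sup>2 * int f)))"
proof -
  have "faithful (\<lambda>p. (fst p, D_pow_snd (int e) (fst p) (snd p)))"
  proof (rule faithfulI)
    fix j u v i :: int
    have "D_pow_snd (int e) j u - D_pow_snd (int e) j v = (1 + 4 * h\<^sup>2 * int e * j) * (u - v)"
      by (simp add: D_pow_snd_def algebra_simps)
    moreover have "odd (1 + 4 * h\<^sup>2 * int e * j)" by simp
    ultimately show "Q dvd D_pow_snd (int e) j u - D_pow_snd (int e) j v \<longleftrightarrow> Q dvd u - v"
      using dvd_odd_mult_iff(2) by metis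
    have ti: "choose2 (2 * i) = i * (2 * i - 1)"
      using two_choose2[of "2 * i"] by simp
    have "D_pow_snd (int e) (j + 2 * i) u - D_pow_snd (int e) j u
        = 4 * h * i * (h * int e * (2 * u + 2 + 3 * (2 * i - 1 + 2 * j)))"
      unfolding D_pow_snd_def choose2_add ti by (simp add: algebra_simps power2_eq_square)
    moreover assume "P dvd 2 * i"
    ultimately show "Q dvd D_pow_snd (int e) (j + 2 * i) u - D_pow_snd (int e) j u"
      by (simp only: Q_dvd_4he dvd_mult2)
  qed simp
  moreover have "faithful (\<lambda>p. (fst p, snd p - 4 * h\<^sup>2 * int f))"
    by (rule faithfulI) simp_all
  ultimately show ?thesis
    unfolding d_pow t_pow by (simp add: act_mult act_closed o_def)
qed

text \<open>Together with \<open>inv_A_C_relation\<close> this amounts to \<open>C\<^sup>-\<^sup>1 A C = A\<^sup>\<alpha>\<close>, as \<open>\<alpha> = 1 + 2 h\<close>.\<close>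

lemma a_pow_two_h: "a [^]\<^bsub>H\<^esub> nat (2 * h) = d"
proof -
  let ?n = "nat (2 * h)" and ?e = "Suc (nat (2 * h)) choose 2" and ?f = "Suc (nat (2 * h)) choose 3"
  have n: "int ?n = 2 * h" using h_pos by simp
  have e: "int ?e = h * (2 * h + 1)"
    unfolding int_Suc_choose_2 n using two_choose2[of "2 * h + 1"] by simp
  have "3 * (4 * h\<^sup>2 * int ?f) = 4 * h ^ 3 * ((2 * h + 1) * (2 * h - 1))"
    using three_int_Suc_choose_3[of ?n] e unfolding int_Suc_choose_2 n
    by (simp add: power2_eq_square power3_eq_cube)
  then have f: "Q dvd 4 * h\<^sup>2 * int ?f"
    by (intro Q_dvd_4h3_mult3) (metis dvd_triv_left)
  have t: "choose2 (2 * h) = h * (2 * h - 1)" using two_choose2[of "2 * h"] by simp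
  show ?thesis
  proof (rule power_unique[OF _ faithful_V_map])
    show "d (nrm (0, u)) = nrm (0, u - int ?n)" for u
      unfolding n by (simp add: act_apply faithful_D_map D_map_def D_snd_def choose2_def)
    have "nrm ((D_map \<circ> B_map) p) = nrm ((B_map \<circ> D_map \<circ> V_map) p)" for p
    proof -
      obtain j u where p: "p = (j, u)" by fastforce
      have "D_snd h (j + 1) (u - 1) - (D_snd h j (u + 4 * h\<^sup>2 * (u + 2 * j)) - 1)
          = 4 * h ^ 3 * (- 4 * h * j * (u + 2 * j))"
        unfolding D_snd_def choose2_Suc by (simp add: algebra_simps power2_eq_square power3_eq_cube)
      then have "Q dvd D_snd h (j + 1) (u - 1) - (D_snd h j (u + 4 * h\<^sup>2 * (u + 2 * j)) - 1)"
        by (intro Q_dvd_4h3_mult) simp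
      then show ?thesis by (simp add: p D_map_def B_map_def V_map_def nrm_eqI)
    qed
    then show "d \<otimes>\<^bsub>H\<^esub> b = b \<otimes>\<^bsub>H\<^esub> d \<otimes>\<^bsub>H\<^esub> v"
      by (simp add: faithful_simps) (rule act_eqI, simp)
    let ?F = "\<lambda>p. (C_pow_fst h (int ?n) (fst p), C_pow_snd h (int ?n) (fst p) (snd p))"
    let ?D = "\<lambda>p. (fst p, D_pow_snd (int ?e) (fst p) (snd p - 4 * h\<^sup>2 * int ?f))"
    have key: "nrm ((V_map \<circ> ?F) p) = nrm (?D p)" for p
    proof -
      obtain j u where p: "p = (j, u)" by fastforce
      obtain g where h: "h = 2 * g" using even_h ..
      have "C_pow_fst h (2 * h) j - j = 2 * h\<^sup>2 * (2 * j + 2 * h * (2 * h - 1) * j)"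
        unfolding C_pow_fst_def t by (simp add: algebra_simps power2_eq_square)
      then have 1: "P dvd C_pow_fst h (2 * h) j - j" using P_dvd_2h2 by simp
      have "C_pow_snd h (2 * h) j u + 4 * h\<^sup>2 * (C_pow_snd h (2 * h) j u + 2 * C_pow_fst h (2 * h) j)
          - (u - 2 * h * (h * (2 * h + 1)) + 4 * h\<^sup>2 * (h * (2 * h + 1)) * (u * j + j + 3 * choose2 j))
        = 4 * h ^ 3 * (1 - 3 * choose2 j + u + j - j * u - g - 12 * g * choose2 j - 4 * g * u - 4 * g * j
            - 4 * g * j * u - 4 * g\<^sup>2 + 16 * g\<^sup>2 * u + 48 * g ^ 3 + 64 * g ^ 3 * u + 128 * g ^ 3 * j
            - 64 * g ^ 4)"
        unfolding C_pow_snd_def C_pow_fst_def t unfolding h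
        by (simp add: algebra_simps power2_eq_square power3_eq_cube power4_eq_xxxx)
      then have 2: "Q dvd C_pow_snd h (2 * h) j u + 4 * h\<^sup>2 * (C_pow_snd h (2 * h) j u + 2 * C_pow_fst h (2 * h) j)
          - (u - 2 * h * (h * (2 * h + 1)) + 4 * h\<^sup>2 * (h * (2 * h + 1)) * (u * j + j + 3 * choose2 j))"
        by (intro Q_dvd_4h3_mult) simp
      have "C_pow_snd h (2 * h) j u + 4 * h\<^sup>2 * (C_pow_snd h (2 * h) j u + 2 * C_pow_fst h (2 * h) j)
          - D_pow_snd (h * (2 * h + 1)) j (u - 4 * h\<^sup>2 * int ?f)
        = C_pow_snd h (2 * h) j u + 4 * h\<^sup>2 * (C_pow_snd h (2 * h) j u + 2 * C_pow_fst h (2 * h) j)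
          - (u - 2 * h * (h * (2 * h + 1)) + 4 * h\<^sup>2 * (h * (2 * h + 1)) * (u * j + j + 3 * choose2 j))
          + 4 * h\<^sup>2 * int ?f * (1 + 4 * h\<^sup>2 * (h * (2 * h + 1)) * j)"
        unfolding D_pow_snd_def by (simp add: algebra_simps)
      then have "Q dvd C_pow_snd h (2 * h) j u + 4 * h\<^sup>2 * (C_pow_snd h (2 * h) j u + 2 * C_pow_fst h (2 * h) j)
          - D_pow_snd (h * (2 * h + 1)) j (u - 4 * h\<^sup>2 * int ?f)"
        using dvd_add[OF 2 dvd_mult2[OF f]] by metis
      then show ?thesis
        using 1 unfolding o_def fst_conv snd_conv V_map_def p n e by (intro nrm_eqI)
    qed
    show "v \<otimes>\<^bsub>H\<^esub> c [^]\<^bsub>H\<^esub> ?n = d [^]\<^bsub>H\<^esub> ?e \<otimes>\<^bsub>H\<^esub> t [^]\<^bsub>H\<^esub> ?f"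
      unfolding dt_pow c_pow act_mult[OF faithful_V_map c_pow_closed] by (rule act_eqI) (rule key)
  qed (simp_all add: V_map_def)
qed
text \<open>For \<open>n = Q\<close> all correction terms are trivial, so the comparison of \<open>a\<^sup>n\<close> with the identity
  needs \<open>V = 1\<close>.\<close>

lemma a_pow_Q: "a [^]\<^bsub>H\<^esub> nat Q = \<one>\<^bsub>H\<^esub>"
proof -
  interpret group H by (rule group_BijGroup)
  let ?e = "Suc (nat Q) choose 2" and ?f = "Suc (nat Q) choose 3"
  have n: "int (nat Q) = Q" by simp
  have e: "2 * int ?e = Q * (Q + 1)"
    unfolding int_Suc_choose_2 n two_choose2 by simp
  have "3 * (4 * h\<^sup>2 * int ?f) = 2 * h\<^sup>2 * (2 * int ?e * (Q - 1))"
    using three_int_Suc_choose_3[of "nat Q"] unfolding int_Suc_choose_2 n by simp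
  also have "\<dots> = Q * (2 * h\<^sup>2 * (Q + 1) * (Q - 1))" unfolding e by simp
  finally have f: "Q dvd 4 * h\<^sup>2 * int ?f" by (rule Q_dvd_3[OF dvdI])
  have id: "faithful (\<lambda>p. p)" by (simp add: faithful_def)
  show ?thesis
  proof (rule power_unique[OF _ id])
    show "\<one>\<^bsub>H\<^esub> (nrm (0, u)) = nrm (0, u - int (nat Q))" for u
      using nrm_eqI[of 0 0 u "u - Q"] by (simp add: BijGroup_def)
    show "\<one>\<^bsub>H\<^esub> \<otimes>\<^bsub>H\<^esub> b = b \<otimes>\<^bsub>H\<^esub> \<one>\<^bsub>H\<^esub> \<otimes>\<^bsub>H\<^esub> act (\<lambda>p. p)"
      by (simp add: act_id)
    have key: "nrm (C_pow_fst h Q j, C_pow_snd h Q j u) = nrm (j, D_pow_snd (int ?e) j (u - 4 * h\<^sup>2 * int ?f))" for j u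
    proof (rule nrm_eqI)
      have "C_pow_fst h Q j - j = Q * (2 * h * j) + 2 * h\<^sup>2 * (2 * choose2 Q * j)"
        by (simp add: C_pow_fst_def algebra_simps)
      then show "P dvd C_pow_fst h Q j - j"
        by (simp only: dvd_add dvd_mult2 P_dvd_2h2 P_dvd_Q)
      have "C_pow_snd h Q j u - D_pow_snd (int ?e) j (u - 4 * h\<^sup>2 * int ?f)
        = Q * (u * (4 * h\<^sup>2 - 2 * h) + j * (4 * h\<^sup>2 - 4 * h) - h + h\<^sup>2)
          + 2 * choose2 Q * (2 * h\<^sup>2 * u + h\<^sup>2 - h ^ 3)
          + 2 * int ?e * (h - 2 * h\<^sup>2 * (u * j + j + 3 * choose2 j))
          + 4 * h\<^sup>2 * int ?f * (1 + 4 * h\<^sup>2 * int ?e * j)"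
        by (simp add: C_pow_snd_def D_pow_snd_def algebra_simps)
      also have "Q dvd \<dots>" unfolding two_choose2 e by (intro dvd_add dvd_mult2[OF f]) (simp_all add: mult.assoc)
      finally show "Q dvd C_pow_snd h Q j u - D_pow_snd (int ?e) j (u - 4 * h\<^sup>2 * int ?f)" .
    qed
    show "act (\<lambda>p. p) \<otimes>\<^bsub>H\<^esub> c [^]\<^bsub>H\<^esub> nat Q = d [^]\<^bsub>H\<^esub> ?e \<otimes>\<^bsub>H\<^esub> t [^]\<^bsub>H\<^esub> ?f"
      unfolding dt_pow c_pow act_mult[OF id c_pow_closed]
      by (rule act_eqI) (unfold o_def n, rule key)
  qed simp_all
qed

end

text \<open>The last two conclusions are visible at the base point: \<open>A\<^sup>n\<close> moves \<open>(0, u)\<close> to \<open>(0, u + n)\<close>, and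
  \<open>A\<close> and \<open>C\<close> preserve the points with \<open>j = 0\<close>, while \<open>B\<^sup>n\<close> moves them to \<open>j = n\<close>.\<close>

lemma (in macdonald_parameters) macdonald_model:
  obtains G :: "(int \<times> int \<Rightarrow> int \<times> int) monoid" and A B C
  where "group G" "A \<in> carrier G" "B \<in> carrier G"
    "C = inv\<^bsub>G\<^esub> A \<otimes>\<^bsub>G\<^esub> inv\<^bsub>G\<^esub> B \<otimes>\<^bsub>G\<^esub> A \<otimes>\<^bsub>G\<^esub> B"
    "inv\<^bsub>G\<^esub> C \<otimes>\<^bsub>G\<^esub> A \<otimes>\<^bsub>G\<^esub> C = A [^]\<^bsub>G\<^esub> \<alpha>" "C \<otimes>\<^bsub>G\<^esub> B \<otimes>\<^bsub>G\<^esub> inv\<^bsub>G\<^esub> C = B [^]\<^bsub>G\<^esub> \<alpha>"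
    "A [^]\<^bsub>G\<^esub> Q = \<one>\<^bsub>G\<^esub>" "B [^]\<^bsub>G\<^esub> Q = \<one>\<^bsub>G\<^esub>"
    "\<And>n::int. A [^]\<^bsub>G\<^esub> n = \<one>\<^bsub>G\<^esub> \<Longrightarrow> Q dvd n"
    "\<And>(n::int) (e::int) (k::nat). B [^]\<^bsub>G\<^esub> n = A [^]\<^bsub>G\<^esub> e \<otimes>\<^bsub>G\<^esub> C [^]\<^bsub>G\<^esub> k \<Longrightarrow> P dvd n"
proof -
  interpret macdonald_permutations by unfold_locales
  interpret group H by (rule group_BijGroup)
  define A where "A = inv\<^bsub>H\<^esub> a"
  have [simp]: "A \<in> carrier H" by (simp add: A_def)
  have aQ: "a [^]\<^bsub>H\<^esub> Q = \<one>\<^bsub>H\<^esub>"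
    using a_pow_Q int_pow_int[of H a "nat Q"] by simp
  have nat_rep: "\<exists>k::nat. a [^]\<^bsub>H\<^esub> n = a [^]\<^bsub>H\<^esub> k \<and> [n = int k] (mod Q)" for n :: int
  proof (intro exI conjI)
    have "a [^]\<^bsub>H\<^esub> n = a [^]\<^bsub>H\<^esub> (Q * (n div Q) + n mod Q)" by simp
    also have "\<dots> = a [^]\<^bsub>H\<^esub> (n mod Q)"
      unfolding int_pow_mult[OF closed(1)] int_pow_pow[OF closed(1), symmetric] aQ by simp
    also have "\<dots> = a [^]\<^bsub>H\<^esub> nat (n mod Q)"
      using int_pow_int[of H a "nat (n mod Q)"] by simp
    finally show "a [^]\<^bsub>H\<^esub> n = a [^]\<^bsub>H\<^esub> nat (n mod Q)" .
    show "[n = int (nat (n mod Q))] (mod Q)" by (simp add: cong_def)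
  qed
  have b_inv: "act B_inv_map = inv\<^bsub>H\<^esub> b" using B_inv_relation by (intro inv_equality[symmetric]) simp_all
  have C: "inv\<^bsub>H\<^esub> A \<otimes>\<^bsub>H\<^esub> inv\<^bsub>H\<^esub> b \<otimes>\<^bsub>H\<^esub> A \<otimes>\<^bsub>H\<^esub> b = c"
  proof -
    have "c \<otimes>\<^bsub>H\<^esub> (inv\<^bsub>H\<^esub> b \<otimes>\<^bsub>H\<^esub> a \<otimes>\<^bsub>H\<^esub> b) = a"
      using commutator_relation b_inv by (simp add: m_assoc)
    then have "c = a \<otimes>\<^bsub>H\<^esub> inv\<^bsub>H\<^esub> (inv\<^bsub>H\<^esub> b \<otimes>\<^bsub>H\<^esub> a \<otimes>\<^bsub>H\<^esub> b)"
      by (intro inv_solve_right[THEN iffD2]) simp_all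
    then show ?thesis by (simp only: A_def) (simp add: inv_mult_group m_assoc)
  qed
  have bn: "b [^]\<^bsub>H\<^esub> n = act (\<lambda>p. (fst p + n, snd p - n))" if "n \<ge> 0" for n :: int
    using b_pow[of "nat n"] int_pow_int[of H b "nat n"] that by simp
  have bQ: "b [^]\<^bsub>H\<^esub> Q = \<one>\<^bsub>H\<^esub>"
    unfolding bn[OF less_imp_le[OF Q_pos]] act_id[symmetric]
    by (rule act_eqI) (simp add: nrm_eq_iff P_dvd_Q)
  show thesis
  proof (rule that[of H A b c])
    show "group H" by (rule group_BijGroup)
    show "A \<in> carrier H" "b \<in> carrier H" by simp_all
    show "c = inv\<^bsub>H\<^esub> A \<otimes>\<^bsub>H\<^esub> inv\<^bsub>H\<^esub> b \<otimes>\<^bsub>H\<^esub> A \<otimes>\<^bsub>H\<^esub> b" by (rule C[symmetric])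
    show "A [^]\<^bsub>H\<^esub> Q = \<one>\<^bsub>H\<^esub>"
      by (simp add: A_def int_pow_inv aQ)
    show "b [^]\<^bsub>H\<^esub> Q = \<one>\<^bsub>H\<^esub>" by (rule bQ)
    fix n :: int
    assume "A [^]\<^bsub>H\<^esub> n = \<one>\<^bsub>H\<^esub>"
    then have "a [^]\<^bsub>H\<^esub> n = \<one>\<^bsub>H\<^esub>"
      by (simp add: A_def int_pow_inv)
    then obtain k :: nat where k: "a [^]\<^bsub>H\<^esub> k = \<one>\<^bsub>H\<^esub>" "[n = int k] (mod Q)"
      using nat_rep[of n] by metis
    then have "nrm (0, 0 - int k) = nrm (0, 0)"
      using a_pow_axis[of k 0] by (simp add: BijGroup_def)
    then have "Q dvd int k" by (simp add: nrm_eq_iff)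
    then show "Q dvd n" using k(2) by (metis cong_dvd_iff)
  next
    show "inv\<^bsub>H\<^esub> c \<otimes>\<^bsub>H\<^esub> A \<otimes>\<^bsub>H\<^esub> c = A [^]\<^bsub>H\<^esub> \<alpha>"
    proof -
      have "a [^]\<^bsub>H\<^esub> \<alpha> = a \<otimes>\<^bsub>H\<^esub> d"
        using a_pow_two_h int_pow_int[of H a "nat (2 * h)"] h_pos
        by (simp add: \<alpha>_def int_pow_mult)
      also have "\<dots> = inv\<^bsub>H\<^esub> c \<otimes>\<^bsub>H\<^esub> (a \<otimes>\<^bsub>H\<^esub> c)"
        using inv_A_C_relation by (simp add: inv_solve_left m_assoc)
      finally have "A [^]\<^bsub>H\<^esub> \<alpha> = inv\<^bsub>H\<^esub> (inv\<^bsub>H\<^esub> c \<otimes>\<^bsub>H\<^esub> (a \<otimes>\<^bsub>H\<^esub> c))"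
        by (simp add: A_def int_pow_inv)
      then show ?thesis by (simp add: A_def inv_mult_group m_assoc)
    qed
    show "c \<otimes>\<^bsub>H\<^esub> b \<otimes>\<^bsub>H\<^esub> inv\<^bsub>H\<^esub> c = b [^]\<^bsub>H\<^esub> \<alpha>"
    proof -
      have "0 \<le> \<alpha>" using h_pos by (simp add: \<alpha>_def)
      then have "b [^]\<^bsub>H\<^esub> \<alpha> = act (\<lambda>p. (fst p + (1 + 2 * h), snd p - (1 + 2 * h)))"
        unfolding \<alpha>_def by (rule bn)
      then have "c \<otimes>\<^bsub>H\<^esub> b = b [^]\<^bsub>H\<^esub> \<alpha> \<otimes>\<^bsub>H\<^esub> c" using C_B_relation by simp
      then show ?thesis by (simp add: inv_solve_right')
    qed
    show "P dvd n" if eq: "b [^]\<^bsub>H\<^esub> n = A [^]\<^bsub>H\<^esub> e \<otimes>\<^bsub>H\<^esub> c [^]\<^bsub>H\<^esub> k" for n e :: int and k :: nat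
    proof -
      define n' where "n' = n mod Q"
      have "b [^]\<^bsub>H\<^esub> n = b [^]\<^bsub>H\<^esub> (Q * (n div Q) + n')" by (simp add: n'_def)
      also have "\<dots> = b [^]\<^bsub>H\<^esub> n'"
        unfolding int_pow_mult[OF closed(2)] int_pow_pow[OF closed(2), symmetric] bQ by simp
      also have "\<dots> = b [^]\<^bsub>H\<^esub> nat n'"
        using int_pow_int[of H b "nat n'"] by (simp add: n'_def)
      finally have bn': "b [^]\<^bsub>H\<^esub> n = b [^]\<^bsub>H\<^esub> nat n'" .
      have L: "(b [^]\<^bsub>H\<^esub> n) (nrm (0, 0)) = nrm (n', - n')"
        unfolding bn' b_pow by (subst act_apply) (auto intro!: faithfulI simp: n'_def)
      obtain i :: nat where i: "a [^]\<^bsub>H\<^esub> (- e) = a [^]\<^bsub>H\<^esub> i" using nat_rep by blast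
      have A: "A [^]\<^bsub>H\<^esub> e = a [^]\<^bsub>H\<^esub> i"
        using i by (simp add: A_def int_pow_inv int_pow_neg)
      have "(c [^]\<^bsub>H\<^esub> k) (nrm (0, 0)) = nrm (C_pow_fst h (int k) (fst (nrm (0, 0))), C_pow_snd h (int k) (fst (nrm (0, 0))) (snd (nrm (0, 0))))"
        unfolding c_pow by (simp add: act_def)
      then have c0: "(c [^]\<^bsub>H\<^esub> k) (nrm (0, 0)) = nrm (0, C_pow_snd h (int k) 0 0)"
        by (simp add: nrm_def C_pow_fst_def)
      have "(A [^]\<^bsub>H\<^esub> e \<otimes>\<^bsub>H\<^esub> c [^]\<^bsub>H\<^esub> k) (nrm (0, 0)) = nrm (0, C_pow_snd h (int k) 0 0 - int i)"
        unfolding A by (simp add: mult_apply c0 a_pow_axis)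
      then have "nrm (n', - n') = nrm (0, C_pow_snd h (int k) 0 0 - int i)" using L eq by simp
      then have "P dvd n'" by (simp add: nrm_eq_iff)
      then show ?thesis using P_dvd_Q by (simp add: n'_def dvd_mod_iff)
    qed
  qed
qed

section \<open>Power relations and normal forms\<close>

text \<open>The last two assumptions express that the group is as large as the relations allow.\<close>

locale macdonald_group = group G + macdonald_parameters m r
  for G (structure) and m r +
  fixes A B C
  assumes A [simp]: "A \<in> carrier G" and B [simp]: "B \<in> carrier G"
    and C_eq: "C = inv A \<otimes> inv B \<otimes> A \<otimes> B"
    and rel_A: "inv C \<otimes> A \<otimes> C = A [^] \<alpha>" and rel_B: "C \<otimes> B \<otimes> inv C = B [^] \<alpha>"
    and A_Q: "A [^] Q = \<one>" and B_Q: "B [^] Q = \<one>"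
    and generated: "generate G {A, B} = carrier G"
    and A_order: "\<And>n::int. A [^] n = \<one> \<Longrightarrow> Q dvd n"
    and B_independent: "\<And>(n::int) (e::int) (k::nat). B [^] n = A [^] e \<otimes> C [^] k \<Longrightarrow> P dvd n"
begin

lemma C [simp]: "C \<in> carrier G"
  by (simp add: C_eq)

lemma A_cong: "[i = j] (mod Q) \<Longrightarrow> A [^] i = A [^] j"
  and B_cong: "[i = j] (mod Q) \<Longrightarrow> B [^] i = B [^] j"
  using int_pow_cong A_Q B_Q by auto

lemma A_add: "A [^] i \<otimes> A [^] j = A [^] (i + j)" and B_add: "B [^] i \<otimes> B [^] j = B [^] (i + j)" for i j :: int
  by (simp_all add: int_pow_mult)

lemma A_add': "x \<in> carrier G \<Longrightarrow> A [^] i \<otimes> (A [^] j \<otimes> x) = A [^] (i + j) \<otimes> x" for i j :: int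
  by (simp add: int_pow_mult m_assoc)

lemma A_eq_iff: "A [^] i = A [^] j \<longleftrightarrow> [i = j] (mod Q)" for i j :: int
proof
  assume "A [^] i = A [^] j"
  then have "A [^] (i - j) = \<one>" by (simp add: int_pow_diff)
  then show "[i = j] (mod Q)" using A_order by (simp add: cong_iff_dvd_diff)
qed (rule A_cong)

lemma A_C: "A [^] i \<otimes> C = C \<otimes> A [^] (\<alpha> * i)" for i :: int
proof -
  have "A [^] (\<alpha> * i) = inv C \<otimes> A [^] i \<otimes> C"
    using conj_int_pow[of A C i] by (simp add: rel_A int_pow_pow)
  then show ?thesis by (simp add: m_assoc)
qed

lemma C_B: "C \<otimes> B [^] i = B [^] (\<alpha> * i) \<otimes> C" for i :: int
proof -
  have "B [^] (\<alpha> * i) = C \<otimes> B [^] i \<otimes> inv C"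
    using conj_int_pow[of B "inv C" i] by (simp add: rel_B int_pow_pow)
  then show ?thesis by (simp add: m_assoc)
qed

lemma alpha_gamma_mult: "[\<alpha> * (\<gamma> * i) = i] (mod Q)"
  using cong_mult[OF alpha_gamma cong_refl[of i]] by (simp add: mult.assoc)

lemma C_A: "C \<otimes> A [^] i = A [^] (\<gamma> * i) \<otimes> C" for i :: int
  using A_C[of "\<gamma> * i"] A_cong[OF alpha_gamma_mult] by simp

lemma B_C: "B [^] i \<otimes> C = C \<otimes> B [^] (\<gamma> * i)" for i :: int
  using C_B[of "\<gamma> * i"] B_cong[OF alpha_gamma_mult] by simp

text \<open>The exponents of \<open>C\<close> are natural numbers so that \<open>\<alpha>\<^sup>n\<close> and \<open>\<gamma>\<^sup>n\<close> are integers; negative powers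
  of \<open>C\<close> are traded for positive ones later, \<open>C\<close> having finite order.\<close>

lemma A_Cn: "A [^] i \<otimes> C [^] n = C [^] n \<otimes> A [^] (\<alpha> ^ n * i)" for i :: int and n :: nat
proof (induction n)
  case (Suc n)
  have "A [^] i \<otimes> C [^] Suc n = (A [^] i \<otimes> C [^] n) \<otimes> C" by (simp add: m_assoc)
  also have "\<dots> = C [^] n \<otimes> (A [^] (\<alpha> ^ n * i) \<otimes> C)" by (simp add: Suc m_assoc)
  also have "\<dots> = C [^] Suc n \<otimes> A [^] (\<alpha> ^ Suc n * i)" by (simp add: A_C m_assoc mult.assoc)
  finally show ?case .
qed simp

lemma Cn_A: "C [^] n \<otimes> A [^] i = A [^] (\<gamma> ^ n * i) \<otimes> C [^] n" for i :: int and n :: nat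
proof (induction n arbitrary: i)
  case (Suc n)
  have "C [^] Suc n \<otimes> A [^] i = C [^] n \<otimes> (C \<otimes> A [^] i)" by (simp add: m_assoc)
  also have "\<dots> = (C [^] n \<otimes> A [^] (\<gamma> * i)) \<otimes> C" by (simp add: C_A m_assoc)
  also have "\<dots> = A [^] (\<gamma> ^ Suc n * i) \<otimes> C [^] Suc n" by (simp add: Suc m_assoc ac_simps)
  finally show ?case .
qed simp

lemma Cn_B: "C [^] n \<otimes> B [^] i = B [^] (\<alpha> ^ n * i) \<otimes> C [^] n" for i :: int and n :: nat
proof (induction n arbitrary: i)
  case (Suc n)
  have "C [^] Suc n \<otimes> B [^] i = C [^] n \<otimes> (C \<otimes> B [^] i)" by (simp add: m_assoc)
  also have "\<dots> = (C [^] n \<otimes> B [^] (\<alpha> * i)) \<otimes> C" by (simp add: C_B m_assoc)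
  also have "\<dots> = B [^] (\<alpha> ^ Suc n * i) \<otimes> C [^] Suc n" by (simp add: Suc m_assoc ac_simps)
  finally show ?case .
qed simp

lemma B_Cn: "B [^] i \<otimes> C [^] n = C [^] n \<otimes> B [^] (\<gamma> ^ n * i)" for i :: int and n :: nat
proof (induction n)
  case (Suc n)
  have "B [^] i \<otimes> C [^] Suc n = (B [^] i \<otimes> C [^] n) \<otimes> C" by (simp add: m_assoc)
  also have "\<dots> = C [^] n \<otimes> (B [^] (\<gamma> ^ n * i) \<otimes> C)" by (simp add: Suc m_assoc)
  also have "\<dots> = C [^] Suc n \<otimes> B [^] (\<gamma> ^ Suc n * i)" by (simp add: B_C m_assoc mult.assoc)
  finally show ?case .
qed simp

lemma AB: "A \<otimes> B = B \<otimes> A \<otimes> C"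
proof -
  have "C = inv (B \<otimes> A) \<otimes> (A \<otimes> B)"
    by (simp add: C_eq inv_mult_group m_assoc)
  then show ?thesis by (simp add: m_assoc inv_mult_group)
qed

lemma AC_pow: "(A \<otimes> C) [^] n = A [^] s n \<otimes> C [^] n" for n :: nat
proof (induction n)
  case (Suc n)
  have "(A \<otimes> C) [^] Suc n = A [^] s n \<otimes> (C [^] n \<otimes> A [^] (1::int)) \<otimes> C"
    by (simp add: Suc m_assoc)
  also have "\<dots> = A [^] s n \<otimes> A [^] (\<gamma> ^ n) \<otimes> (C [^] n \<otimes> C)"
    by (simp only: Cn_A) (simp add: m_assoc)
  finally show ?case by (simp add: A_add s_Suc)
qed simp

lemma An_B: "A [^] n \<otimes> B = B \<otimes> A [^] s n \<otimes> C [^] n" for n :: nat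
proof -
  have "A [^] n \<otimes> B = B \<otimes> (A \<otimes> C) [^] n"
  proof (induction n)
    case (Suc n)
    have "A [^] Suc n \<otimes> B = (A [^] n \<otimes> B) \<otimes> (A \<otimes> C)" by (simp add: m_assoc AB)
    also have "\<dots> = B \<otimes> (A \<otimes> C) [^] Suc n" by (simp add: Suc m_assoc)
    finally show ?case .
  qed simp
  then show ?thesis by (simp add: AC_pow m_assoc)
qed

lemma Bn_A: "B [^] int n \<otimes> A \<otimes> C [^] n = A \<otimes> B [^] s n" for n :: nat
proof (induction n)
  case (Suc n)
  have "B [^] int (Suc n) \<otimes> A \<otimes> C [^] Suc n = B [^] int n \<otimes> (B \<otimes> A \<otimes> C) \<otimes> C [^] n"
  proof -
    have "B [^] int (Suc n) = B [^] int n \<otimes> B"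
      using B_add[of "int n" 1] by (simp add: add.commute)
    then show ?thesis unfolding nat_pow_Suc2[OF C] by (simp add: m_assoc)
  qed
  also have "\<dots> = B [^] int n \<otimes> A \<otimes> (B [^] (1::int) \<otimes> C [^] n)"
    by (simp add: m_assoc flip: AB)
  also have "\<dots> = (B [^] int n \<otimes> A \<otimes> C [^] n) \<otimes> B [^] (\<gamma> ^ n)"
    by (simp only: B_Cn) (simp add: m_assoc)
  also have "\<dots> = A \<otimes> B [^] s (Suc n)"
    by (simp only: Suc) (simp add: m_assoc B_add s_Suc)
  finally show ?case .
qed simp

text \<open>Since \<open>A\<^sup>\<alpha> = C\<^sup>-\<^sup>1 A C\<close>, the product \<open>A\<^sup>\<alpha> B\<close> can be rewritten by moving \<open>B\<close> through powers of
  \<open>A\<close>, or by moving \<open>B\<close> past \<open>C\<close> first and then \<open>A\<close> through powers of \<open>B\<close>.  The two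
  results differ by a power of \<open>A\<close> on one side and a power of \<open>B\<close> on the other.\<close>

lemma B_2h2: "B [^] (2 * h\<^sup>2) = A [^] (- (2 * h\<^sup>2))"
proof -
  define n where "n = nat \<alpha>"
  define e where "e = s n - \<alpha>"
  have n: "int n = \<alpha>" using h_pos by (simp add: n_def \<alpha>_def)
  have "A [^] n = A [^] \<alpha>" unfolding n[symmetric] by (simp add: int_pow_int)
  then have 1: "A [^] \<alpha> \<otimes> B = B \<otimes> A [^] s n \<otimes> C [^] n"
    using An_B[of n] by simp
  have "A \<otimes> B [^] \<alpha> = A \<otimes> B [^] s n \<otimes> B [^] (- e)"
    by (simp add: m_assoc B_add e_def)
  also have "\<dots> = B [^] \<alpha> \<otimes> A \<otimes> C [^] n \<otimes> B [^] (- e)"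
    using Bn_A[of n] n by simp
  finally have 2: "A \<otimes> B [^] \<alpha> = B [^] \<alpha> \<otimes> A \<otimes> C [^] n \<otimes> B [^] (- e)" .
  \<comment> \<open>The second evaluation, starting from \<open>A\<^sup>\<alpha> = C\<^sup>-\<^sup>1 A C\<close>.\<close>
  have "A [^] \<alpha> \<otimes> B = inv C \<otimes> A \<otimes> (C \<otimes> B [^] (1::int))"
    by (simp add: m_assoc flip: rel_A)
  also have "\<dots> = inv C \<otimes> (A \<otimes> B [^] \<alpha>) \<otimes> C"
    by (simp only: C_B) (simp add: m_assoc)
  also have "\<dots> = inv C \<otimes> B [^] \<alpha> \<otimes> A \<otimes> C [^] n \<otimes> (B [^] (- e) \<otimes> C)"
    by (simp only: 2) (simp add: m_assoc)
  also have "\<dots> = inv C \<otimes> B [^] \<alpha> \<otimes> A \<otimes> (C [^] n \<otimes> C) \<otimes> B [^] (\<gamma> * - e)"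
    by (simp only: B_C) (simp add: m_assoc)
  also have "C [^] n \<otimes> C = C \<otimes> C [^] n" using nat_pow_Suc2[of C n] by simp
  also have "inv C \<otimes> B [^] \<alpha> \<otimes> A \<otimes> (C \<otimes> C [^] n) \<otimes> B [^] (\<gamma> * - e)
      = (inv C \<otimes> B [^] \<alpha> \<otimes> C) \<otimes> (inv C \<otimes> A \<otimes> C) \<otimes> C [^] n \<otimes> B [^] (\<gamma> * - e)"
    by (simp add: m_assoc)
  also have "inv C \<otimes> B [^] \<alpha> \<otimes> C = B"
    by (simp add: m_assoc flip: rel_B)
  also have "B \<otimes> (inv C \<otimes> A \<otimes> C) \<otimes> C [^] n \<otimes> B [^] (\<gamma> * - e)
      = B \<otimes> (A [^] \<alpha> \<otimes> C [^] n) \<otimes> B [^] (\<gamma> * - e)"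
    by (simp only: rel_A) (simp add: m_assoc)
  finally have "B \<otimes> (A [^] s n \<otimes> C [^] n) = B \<otimes> (A [^] \<alpha> \<otimes> C [^] n \<otimes> B [^] (\<gamma> * - e))"
    using 1 by (simp add: m_assoc)
  then have "A [^] s n \<otimes> C [^] n = A [^] \<alpha> \<otimes> C [^] n \<otimes> B [^] (\<gamma> * - e)"
    by simp
  then have "C [^] n \<otimes> A [^] (\<alpha> ^ n * s n) = C [^] n \<otimes> (A [^] (\<alpha> ^ n * \<alpha>) \<otimes> B [^] (\<gamma> * - e))"
    by (simp only: A_Cn) (simp add: m_assoc)
  then have "A [^] (\<alpha> ^ n * s n) = A [^] (\<alpha> ^ n * \<alpha>) \<otimes> B [^] (\<gamma> * - e)"
    by simp
  then have "A [^] (- (\<alpha> ^ n * \<alpha>)) \<otimes> A [^] (\<alpha> ^ n * s n) = B [^] (\<gamma> * - e)"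
    by (simp add: A_add')
  then have eq: "B [^] (\<gamma> * - e) = A [^] (\<alpha> ^ n * e)"
    by (simp add: A_add e_def algebra_simps)
  have e: "[e = - (2 * h\<^sup>2)] (mod Q)" using s_alpha by (simp add: e_def n_def)
  have "[\<gamma> = 1] (mod 2 * h)" "[\<alpha> = 1] (mod 2 * h)"
    by (auto simp: cong_iff_dvd_diff \<gamma>_def \<alpha>_def power2_eq_square mult.assoc intro: dvd_diff)
  then have \<gamma>: "[2 * h\<^sup>2 * \<gamma> = 2 * h\<^sup>2] (mod Q)" and \<alpha>: "[2 * h\<^sup>2 * \<alpha> ^ n = 2 * h\<^sup>2] (mod Q)"
    using two_h2_mult_cong cong_pow[of \<alpha> 1 "2 * h" n] by simp_all
  have "[\<gamma> * - e = \<gamma> * - (- (2 * h\<^sup>2))] (mod Q)"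
    using e by (intro cong_mult cong_refl) (simp only: cong_minus_minus_iff)
  with \<gamma> have "[\<gamma> * - e = 2 * h\<^sup>2] (mod Q)"
    by (metis cong_trans minus_minus mult.commute)
  moreover have "[\<alpha> ^ n * e = - (2 * h\<^sup>2)] (mod Q)"
    using cong_trans[OF cong_mult[OF cong_refl[of "\<alpha> ^ n"] e]] \<alpha>
    by (simp add: mult.commute[of "\<alpha> ^ n"] cong_minus_minus_iff)
  ultimately show ?thesis using eq A_cong B_cong by metis
qed

lemma B_P: assumes "P dvd n" shows "B [^] n = A [^] (- n)"
proof -
  obtain q where q: "[n = 2 * h\<^sup>2 * q] (mod Q)" using assms by (rule P_multiple_cong)
  have "B [^] n = (B [^] (2 * h\<^sup>2)) [^] q"
    using B_cong[OF q] by (simp add: int_pow_pow)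
  also have "\<dots> = A [^] (- (2 * h\<^sup>2 * q))"
    by (simp add: B_2h2 int_pow_pow)
  also have "\<dots> = A [^] (- n)"
    using q by (intro A_cong) (simp add: cong_minus_minus_iff cong_sym)
  finally show ?thesis .
qed

text \<open>By the previous lemma \<open>A\<^sup>n\<close> is also a power of \<open>B\<close>.\<close>

lemma A_P_central:
  assumes "P dvd n" "g \<in> carrier G" shows "A [^] n \<otimes> g = g \<otimes> A [^] n"
proof (rule commutes_with_generated[of _ "{A, B}"])
  have "A [^] n = B [^] (- n)" using B_P[of "- n"] assms by simp
  moreover have "B [^] (- n) \<otimes> B = B \<otimes> B [^] (- n)"
    using B_add[of "- n" 1] B_add[of 1 "- n"] by simp
  moreover have "A [^] n \<otimes> A = A \<otimes> A [^] n"
    using A_add[of "n" 1] A_add[of 1 "n"] by (simp add: add.commute)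
  ultimately show "A [^] n \<otimes> y = y \<otimes> A [^] n" if "y \<in> {A, B}" for y
    using that by auto
  show "g \<in> generate G {A, B}" using assms generated by simp
qed simp_all

text \<open>As \<open>B\<^sup>n\<close> is central, \<open>Bn_A\<close> loses \<open>A\<close> and expresses \<open>C\<^sup>n\<close> through \<open>B\<close>.\<close>

lemma Cn_power_of_A: assumes "P dvd int n" obtains e where "C [^] n = A [^] (e::int)"
proof -
  have d: "P dvd s n - int n" using assms by (rule P_dvd_s_diff)
  have Bn: "B [^] int n \<otimes> g = g \<otimes> B [^] int n" if "g \<in> carrier G" for g
    using A_P_central[of "- int n" g] B_P[OF assms] assms that by simp
  have "A \<otimes> (B [^] int n \<otimes> C [^] n) = A \<otimes> B [^] s n"
    using Bn_A[of n] Bn[OF A] by (simp add: m_assoc[symmetric])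
  also have "\<dots> = A \<otimes> (B [^] int n \<otimes> B [^] (s n - int n))"
    by (simp add: B_add)
  finally have "C [^] n = B [^] (s n - int n)" by simp
  then show thesis using that B_P[OF d] by simp
qed

lemma Cn_power_of_A_imp: assumes "C [^] n = A [^] (e::int)" shows "P dvd int n"
proof -
  have "A [^] (1::int) \<otimes> C [^] n = C [^] n \<otimes> A [^] (\<alpha> ^ n * 1)" by (rule A_Cn)
  then have "A [^] (1 + e) = A [^] (e + \<alpha> ^ n)"
    unfolding assms by (simp only: A_add) simp
  then have "Q dvd \<alpha> ^ n - 1"
    unfolding A_eq_iff cong_iff_dvd_diff by (simp add: dvd_diff_commute)
  then show ?thesis by (rule alpha_power_order)
qed

lemma C_finite_order: obtains N :: nat where "inv C = C [^] N"
proof -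
  obtain e where e: "C [^] nat P = A [^] (e::int)" by (rule Cn_power_of_A[of "nat P"]) simp
  define M where "M = nat P * nat Q"
  have "C [^] M = (C [^] nat P) [^] nat Q"
    unfolding M_def by (simp add: nat_pow_pow)
  also have "\<dots> = A [^] (e * Q)"
    unfolding e using int_pow_int[of G "A [^] e" "nat Q"] less_imp_le[OF Q_pos] by (simp add: int_pow_pow)
  also have "\<dots> = \<one>" using int_pow_pow[OF A, of Q e] A_Q by (simp add: mult.commute)
  finally have M: "C [^] M = \<one>" .
  have "0 < M" by (simp add: M_def)
  then obtain N where "M = Suc N" by (cases M) auto
  then have "C [^] N \<otimes> C = \<one>" using M by simp
  then show thesis using that inv_equality by simp
qed

definition normal_forms where
  "normal_forms = {B [^] (j::int) \<otimes> A [^] (i::int) \<otimes> C [^] (k::nat) | j i k. True}"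

lemma nat_reduce: obtains n where "[i = int n] (mod Q)"
  using that[of "nat (i mod Q)"] by (simp add: cong_def)

text \<open>Multiplication by \<open>A\<^sup>-\<^sup>1\<close> rather than by \<open>A\<close>, because \<open>Bn_A\<close> moves \<open>A\<^sup>-\<^sup>1\<close> past \<open>B\<^sup>n\<close> for given
  \<open>n\<close>, while for \<open>A\<close> one would have to invert \<open>s\<close>.\<close>

lemma inv_A_normal_forms: assumes "g \<in> normal_forms" shows "inv A \<otimes> g \<in> normal_forms"
proof -
  obtain j i :: int and k :: nat where g: "g = B [^] j \<otimes> A [^] i \<otimes> C [^] k"
    using assms by (auto simp: normal_forms_def)
  obtain n where n: "[j = int n] (mod Q)" by (rule nat_reduce)
  obtain N where N: "inv C = C [^] (N::nat)" by (rule C_finite_order)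
  define M where "M = N * n"
  have CM: "inv (C [^] n) = C [^] M"
    by (simp add: M_def nat_pow_inv[symmetric] N nat_pow_pow)
  have "A \<otimes> B [^] s n \<otimes> C [^] M = B [^] int n \<otimes> A"
    unfolding CM[symmetric] Bn_A[symmetric] by (simp add: m_assoc)
  then have "inv A \<otimes> B [^] int n \<otimes> A = B [^] s n \<otimes> C [^] M"
    by (simp add: m_assoc inv_solve_left')
  then have *: "inv A \<otimes> B [^] int n = B [^] s n \<otimes> C [^] M \<otimes> A [^] (-1::int)"
    by (simp add: int_pow_neg inv_solve_right)
  have "inv A \<otimes> g = (inv A \<otimes> B [^] int n) \<otimes> (A [^] i \<otimes> C [^] k)"
    by (simp add: g B_cong[OF n] m_assoc)
  also have "\<dots> = B [^] s n \<otimes> (C [^] M \<otimes> A [^] (i - 1)) \<otimes> C [^] k"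
    by (simp only: *) (simp add: m_assoc A_add')
  also have "\<dots> = B [^] s n \<otimes> A [^] (\<gamma> ^ M * (i - 1)) \<otimes> C [^] (M + k)"
    by (simp only: Cn_A) (simp add: m_assoc nat_pow_mult)
  finally show ?thesis by (auto simp: normal_forms_def)
qed

lemma normal_form:
  assumes "g \<in> carrier G"
  obtains j i :: int and k :: nat where "g = B [^] j \<otimes> A [^] i \<otimes> C [^] k"
proof -
  have closed: "normal_forms \<subseteq> carrier G" by (auto simp: normal_forms_def)
  have B_mult: "B [^] x \<otimes> g \<in> normal_forms" if g: "g \<in> normal_forms" for x :: int and g
  proof -
    obtain j i :: int and k :: nat where g: "g = B [^] j \<otimes> A [^] i \<otimes> C [^] k"
      using g by (auto simp: normal_forms_def)
    have "B [^] x \<otimes> g = B [^] (x + j) \<otimes> A [^] i \<otimes> C [^] k"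
      by (simp add: g m_assoc int_pow_mult)
    then show ?thesis by (auto simp: normal_forms_def)
  qed
  have pow: "inv A [^] n \<otimes> g \<in> normal_forms" if "g \<in> normal_forms" for n :: nat and g
  proof (induction n)
    case (Suc n)
    then show ?case
      using inv_A_normal_forms[OF Suc] that closed nat_pow_Suc2[of "inv A" n] by (simp add: m_assoc subsetD)
  qed (use that closed in auto)
  have A_mult: "A \<otimes> g \<in> normal_forms" if "g \<in> normal_forms" for g
  proof -
    obtain n where "[- 1 = int n] (mod Q)" by (rule nat_reduce)
    then have "[1 = - int n] (mod Q)"
      using cong_minus_minus_iff by fastforce
    then have "A [^] (1::int) = A [^] (- int n)" by (rule A_cong)
    then have "A = inv A [^] n" by (simp add: int_pow_neg int_pow_int nat_pow_inv)
    then show ?thesis using pow[OF that, of n] by simp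
  qed
  have "\<forall>x\<in>normal_forms. g \<otimes> x \<in> normal_forms" if "g \<in> generate G {A, B}" for g
    using that
  proof induction
    case one
    then show ?case using closed by auto
  next
    case (incl y)
    then show ?case using A_mult B_mult[of _ 1] by auto
  next
    case (inv y)
    then show ?case using inv_A_normal_forms B_mult[of _ "- 1"] by (auto simp: int_pow_neg)
  next
    case (eng y z)
    then have "y \<in> carrier G" "z \<in> carrier G" using generate_in_carrier[of "{A, B}"] by auto
    with eng closed show ?case by (auto simp: m_assoc subsetD)
  qed
  moreover have "\<one> \<in> normal_forms"
    unfolding normal_forms_def by (rule CollectI) (rule exI[of _ 0], rule exI[of _ 0], rule exI[of _ 0], simp)
  ultimately have "g \<otimes> \<one> \<in> normal_forms" using assms generated by blast
  then show thesis using that assms by (auto simp: normal_forms_def)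
qed

text \<open>For \<open>g = B\<^sup>j A\<^sup>i C\<^sup>k\<close> the hypothesis says that \<open>A B\<^sup>j = B\<^sup>j A\<^sup>e\<close> for some \<open>e\<close>.  Comparison
  with \<open>Bn_A\<close> puts first a power of \<open>B\<close> into \<open>\<langle>A\<rangle>\<langle>C\<rangle>\<close>, and then \<open>C\<^sup>j\<close> into
  \<open>\<langle>A\<rangle>\<close>.  Hence \<open>P\<close> divides \<open>j\<close>, and \<open>B\<^sup>j\<close> is absorbed by \<open>A\<^sup>i\<close>.\<close>

lemma almost_centralises_A:
  assumes g: "g \<in> carrier G" and "P dvd n" and eq: "g \<otimes> A = A \<otimes> g \<otimes> A [^] (n::int)"
  obtains i :: int and k :: nat where "g = A [^] i \<otimes> C [^] k" "P dvd \<alpha> ^ k + n - 1" "[\<alpha> ^ k + n = 1] (mod Q)"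
proof -
  obtain j' i :: int and k :: nat where g': "g = B [^] j' \<otimes> A [^] i \<otimes> C [^] k"
    using g by (rule normal_form)
  obtain j where j': "[j' = int j] (mod Q)" by (rule nat_reduce)
  have gj: "g = B [^] int j \<otimes> A [^] i \<otimes> C [^] k"
    unfolding g' using B_cong[OF j'] by simp
  have central: "x \<otimes> A [^] n = A [^] n \<otimes> x" if "x \<in> carrier G" for x
    using A_P_central[OF \<open>P dvd n\<close> that] by simp
  have "g \<otimes> A = B [^] int j \<otimes> A [^] i \<otimes> (C [^] k \<otimes> A [^] (1::int))"
    by (simp add: gj m_assoc)
  also have "\<dots> = B [^] int j \<otimes> A [^] (i + \<gamma> ^ k) \<otimes> C [^] k"
    by (simp only: Cn_A) (simp add: m_assoc A_add')
  finally have 1: "g \<otimes> A = B [^] int j \<otimes> A [^] (i + \<gamma> ^ k) \<otimes> C [^] k" .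
  have "A \<otimes> g \<otimes> A [^] n = A \<otimes> B [^] int j \<otimes> A [^] i \<otimes> (C [^] k \<otimes> A [^] n)"
    by (simp add: gj m_assoc)
  also have "\<dots> = A \<otimes> B [^] int j \<otimes> A [^] (i + n) \<otimes> C [^] k"
    by (simp only: central nat_pow_closed C) (simp add: m_assoc A_add')
  finally have "B [^] int j \<otimes> A [^] (i + \<gamma> ^ k) \<otimes> C [^] k = A \<otimes> B [^] int j \<otimes> A [^] (i + n) \<otimes> C [^] k"
    using eq 1 by simp
  then have "B [^] int j \<otimes> A [^] (i + \<gamma> ^ k) = A \<otimes> B [^] int j \<otimes> A [^] (i + n)"
    by simp
  then have "B [^] int j \<otimes> A [^] (i + \<gamma> ^ k) \<otimes> A [^] (- (i + n)) = A \<otimes> B [^] int j \<otimes> A [^] (i + n) \<otimes> A [^] (- (i + n))"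
    by simp
  then have AB: "A \<otimes> B [^] int j = B [^] int j \<otimes> A [^] (\<gamma> ^ k - n)"
    by (simp add: m_assoc A_add)
  let ?x = "\<gamma> ^ k - n"
  have "B [^] int j \<otimes> (A \<otimes> C [^] j) = (A \<otimes> B [^] int j) \<otimes> B [^] (s j - int j)"
    using Bn_A[of j] by (simp add: m_assoc B_add)
  also have "\<dots> = B [^] int j \<otimes> (A [^] ?x \<otimes> B [^] (s j - int j))"
    by (simp only: AB) (simp add: m_assoc)
  finally have "A \<otimes> C [^] j = A [^] ?x \<otimes> B [^] (s j - int j)" by simp
  then have "A [^] (- ?x) \<otimes> (A [^] (1::int) \<otimes> C [^] j) = A [^] (- ?x) \<otimes> (A [^] ?x \<otimes> B [^] (s j - int j))"
    by simp
  then have Bs: "B [^] (s j - int j) = A [^] (1 - ?x) \<otimes> C [^] j"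
    unfolding A_add'[OF nat_pow_closed[OF C]] A_add'[OF int_pow_closed[OF B]]
    by (simp add: algebra_simps)
  then have "P dvd s j - int j" by (rule B_independent)
  then have "A [^] (- (1 - ?x)) \<otimes> A [^] (- (s j - int j)) = A [^] (- (1 - ?x)) \<otimes> (A [^] (1 - ?x) \<otimes> C [^] j)"
    using Bs B_P by metis
  then have "C [^] j = A [^] (- (1 - ?x) + - (s j - int j))"
    unfolding A_add'[OF nat_pow_closed[OF C]] A_add by simp
  then have "P dvd int j" by (rule Cn_power_of_A_imp)
  then have gA: "g = A [^] (i - int j) \<otimes> C [^] k"
    by (simp add: gj B_P A_add)
  let ?i = "i - int j"
  have "A [^] ?i \<otimes> (C [^] k \<otimes> A) = A [^] ?i \<otimes> (A \<otimes> C [^] k \<otimes> A [^] n)"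
  proof -
    have "A [^] ?i \<otimes> A = A \<otimes> A [^] ?i"
      using A_add[of ?i 1] A_add[of 1 ?i] by (simp add: add.commute)
    then show ?thesis using eq unfolding gA by (simp add: m_assoc) (simp flip: m_assoc)
  qed
  then have "C [^] k \<otimes> A = A [^] (1::int) \<otimes> C [^] k \<otimes> A [^] n" by simp
  also have "\<dots> = C [^] k \<otimes> A [^] (\<alpha> ^ k + n)"
    unfolding A_Cn by (simp add: m_assoc A_add)
  finally have "A [^] (1::int) = A [^] (\<alpha> ^ k + n)" by simp
  then have c: "[\<alpha> ^ k + n = 1] (mod Q)" unfolding A_eq_iff by (rule cong_sym)
  moreover have "P dvd \<alpha> ^ k + n - 1"
    using c P_dvd_Q dvd_trans unfolding cong_iff_dvd_diff by blast
  ultimately show thesis using that gA by blast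
qed

text \<open>A central element is \<open>A\<^sup>i C\<^sup>k\<close>; commuting with \<open>A\<close> makes \<open>C\<^sup>k\<close> a power of \<open>A\<close>, and a power of
  \<open>A\<close> commutes with \<open>C\<close> only if \<open>P\<close> divides its exponent.\<close>

lemma center_eq: "group_center G = {A [^] n | n::int. P dvd n}"
proof (intro equalityI subsetI)
  fix g assume "g \<in> group_center G"
  then have g: "g \<in> carrier G" and comm: "\<And>x. x \<in> carrier G \<Longrightarrow> g \<otimes> x = x \<otimes> g"
    by (auto simp: group_center_def)
  have "g \<otimes> A = A \<otimes> g \<otimes> A [^] (0::int)" using comm[OF A] g by simp
  then obtain i :: int and k :: nat where gA: "g = A [^] i \<otimes> C [^] k" and "[\<alpha> ^ k + 0 = 1] (mod Q)"
    using almost_centralises_A[OF g dvd_0_right] by blast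
  then have "P dvd int k" by (intro alpha_power_order) (simp add: cong_iff_dvd_diff)
  then obtain e :: int where "C [^] k = A [^] e" by (rule Cn_power_of_A)
  then have gx: "g = A [^] (i + e)" by (simp add: gA A_add)
  have "C \<otimes> A [^] (i + e) = C \<otimes> A [^] (\<alpha> * (i + e))"
    using comm[OF C] unfolding gx A_C by simp
  then have "A [^] (\<alpha> * (i + e)) = A [^] (i + e)" by simp
  then have "Q dvd \<alpha> * (i + e) - (i + e)" unfolding A_eq_iff cong_iff_dvd_diff .
  also have "\<alpha> * (i + e) - (i + e) = 2 * h * (i + e)" by (simp add: \<alpha>_def algebra_simps)
  finally have "P dvd i + e" by (simp only: Q_dvd_2h_mult_iff)
  with gx show "g \<in> {A [^] n | n::int. P dvd n}" by blast
qed (auto simp: group_center_def A_P_central)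

text \<open>The hypothesis at \<open>A\<close> gives the shape \<open>A\<^sup>i C\<^sup>k\<close>, and that \<open>P\<close> divides \<open>\<alpha>\<^sup>k - 1\<close>, so that \<open>C\<^sup>k\<close>
  commutes with \<open>B\<close> up to a central factor.  At \<open>B\<close>, it therefore says that the commutator of
  \<open>A\<^sup>i\<close> and \<open>B\<close>, which is \<open>C\<^sup>i\<close> up to a power of \<open>A\<close>, is a power of \<open>A\<close>.\<close>

lemma second_center:
  assumes g: "g \<in> carrier G"
    and almost: "\<And>x. x \<in> carrier G \<Longrightarrow> \<exists>z\<in>group_center G. g \<otimes> x = x \<otimes> g \<otimes> z"
  obtains i :: int and k :: nat where "g = A [^] i \<otimes> C [^] k" "P dvd i"
proof -
  obtain n where n: "P dvd n" "g \<otimes> A = A \<otimes> g \<otimes> A [^] n"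
    using almost[OF A] unfolding center_eq by auto
  obtain i' :: int and k :: nat where gA': "g = A [^] i' \<otimes> C [^] k" and "P dvd \<alpha> ^ k + n - 1"
    using almost_centralises_A[OF g n] by blast
  with n(1) have d: "P dvd \<alpha> ^ k - 1" by (metis add_diff_eq add.commute dvd_add_right_iff)
  obtain i where i: "[i' = int i] (mod Q)" by (rule nat_reduce)
  have gA: "g = A [^] int i \<otimes> C [^] k" unfolding gA' using A_cong[OF i] by simp
  obtain n' where n': "P dvd n'" "g \<otimes> B = B \<otimes> g \<otimes> A [^] n'"
    using almost[OF B] unfolding center_eq by auto
  let ?z = "A [^] (- (\<alpha> ^ k - 1))"
  have z: "P dvd - (\<alpha> ^ k - 1)" using d by (simp only: dvd_minus_iff)
  have "g \<otimes> B = A [^] int i \<otimes> (C [^] k \<otimes> B [^] (1::int))" by (simp add: gA m_assoc)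
  also have "\<dots> = A [^] int i \<otimes> B [^] (1 + (\<alpha> ^ k - 1)) \<otimes> C [^] k"
    by (simp only: Cn_B) (simp add: m_assoc)
  also have "\<dots> = (A [^] i \<otimes> B) \<otimes> (?z \<otimes> C [^] k)"
    unfolding B_add[symmetric] B_P[OF d] by (simp add: m_assoc int_pow_int)
  also have "\<dots> = B \<otimes> A [^] s i \<otimes> C [^] i \<otimes> (C [^] k \<otimes> ?z)"
    unfolding An_B A_P_central[OF z nat_pow_closed[OF C]] ..
  finally have 1: "g \<otimes> B = B \<otimes> A [^] s i \<otimes> C [^] i \<otimes> (C [^] k \<otimes> ?z)" .
  have "B \<otimes> (A [^] s i \<otimes> (C [^] i \<otimes> (C [^] k \<otimes> ?z))) = B \<otimes> (A [^] int i \<otimes> (C [^] k \<otimes> A [^] n'))"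
    using 1 n'(2) unfolding gA by (simp add: m_assoc)
  then have "A [^] s i \<otimes> (C [^] i \<otimes> (C [^] k \<otimes> ?z)) = A [^] int i \<otimes> (C [^] k \<otimes> A [^] n')"
    by simp
  then have "A [^] s i \<otimes> (C [^] i \<otimes> (?z \<otimes> C [^] k)) = A [^] int i \<otimes> (A [^] n' \<otimes> C [^] k)"
    unfolding A_P_central[OF z nat_pow_closed[OF C]] A_P_central[OF n'(1) nat_pow_closed[OF C]] .
  then have "(A [^] s i \<otimes> (C [^] i \<otimes> ?z)) \<otimes> C [^] k = (A [^] int i \<otimes> A [^] n') \<otimes> C [^] k"
    by (simp add: m_assoc)
  then have "A [^] s i \<otimes> (?z \<otimes> C [^] i) = A [^] int i \<otimes> A [^] n'"
    unfolding A_P_central[OF z nat_pow_closed[OF C]] by simp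
  then have "A [^] (s i + - (\<alpha> ^ k - 1)) \<otimes> C [^] i = A [^] (int i + n')"
    unfolding A_add'[OF nat_pow_closed[OF C]] A_add .
  then have "A [^] (- (s i + - (\<alpha> ^ k - 1))) \<otimes> (A [^] (s i + - (\<alpha> ^ k - 1)) \<otimes> C [^] i)
      = A [^] (- (s i + - (\<alpha> ^ k - 1))) \<otimes> A [^] (int i + n')"
    by (simp only:)
  then have "C [^] i = A [^] (- (s i + - (\<alpha> ^ k - 1)) + (int i + n'))"
    unfolding A_add'[OF nat_pow_closed[OF C]] A_add by simp
  then have "P dvd int i" by (rule Cn_power_of_A_imp)
  with gA show thesis by (rule that)
qed

end

section \<open>Central series and central automorphisms of a group\<close>

context group
begin

lemma center_in_carrier: "z \<in> group_center G \<Longrightarrow> z \<in> carrier G"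
  and center_comm: "z \<in> group_center G \<Longrightarrow> x \<in> carrier G \<Longrightarrow> z \<otimes> x = x \<otimes> z"
  by (auto simp: group_center_def)

lemma center_subgroup: "subgroup (group_center G) G"
proof
  fix x y assume x: "x \<in> group_center G" and y: "y \<in> group_center G"
  note [simp] = x[THEN center_in_carrier] y[THEN center_in_carrier]
  have "x \<otimes> y \<otimes> g = g \<otimes> (x \<otimes> y)" if "g \<in> carrier G" for g
  proof -
    have "x \<otimes> y \<otimes> g = x \<otimes> g \<otimes> y" using that center_comm[OF y that] by (simp add: m_assoc)
    also have "\<dots> = g \<otimes> (x \<otimes> y)" using that by (simp add: center_comm[OF x] m_assoc)
    finally show ?thesis .
  qed
  then show "x \<otimes> y \<in> group_center G" by (simp add: group_center_def)
  have "inv x \<otimes> g = g \<otimes> inv x" if g: "g \<in> carrier G" for g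
  proof -
    have "inv x \<otimes> g = inv x \<otimes> (g \<otimes> x) \<otimes> inv x" using g by (simp add: m_assoc)
    also have "\<dots> = g \<otimes> inv x" using g by (simp add: center_comm[OF x g, symmetric] m_assoc)
    finally show ?thesis .
  qed
  then show "inv x \<in> group_center G" by (simp add: group_center_def)
qed (auto simp: group_center_def)

lemma center_normal: "group_center G \<lhd> G"
  unfolding normal_inv_iff
proof (intro conjI ballI center_subgroup)
  fix g z assume "g \<in> carrier G" "z \<in> group_center G"
  then have "g \<otimes> z \<otimes> inv g = z \<otimes> g \<otimes> inv g" "z \<in> carrier G"
    using center_comm[of z g] center_in_carrier by simp_all
  then have "g \<otimes> z \<otimes> inv g = z" using \<open>g \<in> carrier G\<close> by (simp add: m_assoc)
  then show "g \<otimes> z \<otimes> inv g \<in> group_center G" using \<open>z \<in> group_center G\<close> by simp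
qed

lemma upper_central_1: "upper_central G 1 = group_center G"
proof -
  have coset: "{\<one>} #> x = {x}" if "x \<in> carrier G" for x
    using that by (auto simp: r_coset_def)
  have *: "{z} \<in> group_center (G Mod {\<one>}) \<longleftrightarrow> z \<in> group_center G" if z: "z \<in> carrier G" for z
  proof -
    have "carrier (G Mod {\<one>}) = (\<lambda>x. {x}) ` carrier G"
      using coset by (auto simp: FactGroup_def RCOSETS_def)
    moreover have "{z} <#> {x} = {z \<otimes> x}" for z x by (auto simp: set_mult_def)
    ultimately show ?thesis using z by (auto simp: group_center_def FactGroup_def)
  qed
  have "upper_central G 1 = {z \<in> carrier G. z \<in> group_center G}"
    using coset * by auto
  then show ?thesis using center_in_carrier by auto
qed

lemma upper_central_2:
  assumes z: "z \<in> upper_central G 2" and x: "x \<in> carrier G"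
  shows "z \<in> carrier G" "\<exists>c\<in>group_center G. z \<otimes> x = x \<otimes> z \<otimes> c"
proof -
  interpret Z: normal "group_center G" G by (rule center_normal)
  have "z \<in> carrier G \<and> group_center G #> z \<in> group_center (G Mod group_center G)"
    using z unfolding numeral_2_eq_2 upper_central.simps(2)[of G "Suc 0"]
      upper_central_1[unfolded One_nat_def] by blast
  then have z: "z \<in> carrier G" and comm: "group_center G #> z \<in> group_center (G Mod group_center G)"
    by auto
  show "z \<in> carrier G" by fact
  have "group_center G #> x \<in> carrier (G Mod group_center G)"
    using x by (auto simp: FactGroup_def RCOSETS_def)
  then have "(group_center G #> z) <#> (group_center G #> x) = (group_center G #> x) <#> (group_center G #> z)"
    using comm unfolding group_center_def[of "G Mod group_center G"] by (simp add: FactGroup_def)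
  then have "group_center G #> (z \<otimes> x) = group_center G #> (x \<otimes> z)"
    unfolding Z.rcos_sum[OF x z] Z.rcos_sum[OF z x] .
  then have "z \<otimes> x \<in> group_center G #> (x \<otimes> z)"
    using rcos_self[OF m_closed[OF z x] center_subgroup] by simp
  then obtain c where c: "c \<in> group_center G" "z \<otimes> x = c \<otimes> (x \<otimes> z)"
    by (auto simp: r_coset_def)
  then have "z \<otimes> x = x \<otimes> z \<otimes> c" using center_comm[OF c(1), of "x \<otimes> z"] x z by simp
  then show "\<exists>c\<in>group_center G. z \<otimes> x = x \<otimes> z \<otimes> c" using c(1) by blast
qed

text \<open>The definition compares images of cosets; for an automorphism this amounts to multiplying every
  element by a central one, the inclusion of a coset in its image coming from surjectivity.\<close>

lemma Aut_sub_1_iff: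
  "f \<in> Aut_sub 1 G \<longleftrightarrow> f \<in> auto G \<and> (\<forall>g\<in>carrier G. \<exists>z\<in>group_center G. f g = g \<otimes> z)"
proof -
  interpret Z: normal "group_center G" G by (rule center_normal)
  have 1: "f \<in> Aut_sub 1 G \<longleftrightarrow> f \<in> auto G \<and> (\<forall>g\<in>carrier G. f ` (group_center G #> g) = group_center G #> g)"
  proof -
    have "(\<lambda>C\<in>carrier (G Mod group_center G). f ` C) = (\<lambda>C\<in>carrier (G Mod group_center G). C)
      \<longleftrightarrow> (\<forall>C\<in>carrier (G Mod group_center G). f ` C = C)"
      by (auto simp: fun_eq_iff restrict_def)
    also have "\<dots> \<longleftrightarrow> (\<forall>g\<in>carrier G. f ` (group_center G #> g) = group_center G #> g)"
      by (auto simp: FactGroup_def RCOSETS_def)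
    finally show ?thesis
      unfolding Aut_sub_def kernel_def upper_central_1 induced_aut_def
      by (simp add: AutoGroup_def BijGroup_def)
  qed
  show ?thesis
  proof (cases "f \<in> auto G")
    case True
    then have bij: "bij_betw f (carrier G) (carrier G)" by (simp add: auto_def Bij_def)
    show ?thesis
    proof
      assume "f \<in> Aut_sub 1 G"
      then have im: "f ` (group_center G #> g) = group_center G #> g" if "g \<in> carrier G" for g
        using 1 that by blast
      have "\<exists>z\<in>group_center G. f g = g \<otimes> z" if g: "g \<in> carrier G" for g
      proof -
        have "f g \<in> group_center G #> g" using im[OF g] rcos_self[OF g center_subgroup] by blast
        then obtain z where z: "z \<in> group_center G" "f g = z \<otimes> g" unfolding r_coset_def by blast
        then have "f g = g \<otimes> z" using center_comm[OF z(1) g] by simp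
        then show ?thesis using z(1) by blast
      qed
      then show "f \<in> auto G \<and> (\<forall>g\<in>carrier G. \<exists>z\<in>group_center G. f g = g \<otimes> z)"
        using True by blast
    next
      assume "f \<in> auto G \<and> (\<forall>g\<in>carrier G. \<exists>z\<in>group_center G. f g = g \<otimes> z)"
      then have right: "\<forall>g\<in>carrier G. \<exists>z\<in>group_center G. f g = g \<otimes> z" by blast
      have shift: "\<exists>z\<in>group_center G. f g = z \<otimes> g" if g: "g \<in> carrier G" for g
      proof -
        obtain z where z: "z \<in> group_center G" "f g = g \<otimes> z" using right g by blast
        then have "f g = z \<otimes> g" using center_comm[OF z(1) g] by simp
        then show ?thesis using z(1) by blast
      qed
      have "f ` (group_center G #> g) = group_center G #> g" if g: "g \<in> carrier G" for g
      proof (intro equalityI subsetI)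
        fix y assume "y \<in> f ` (group_center G #> g)"
        then obtain z where z: "z \<in> group_center G" "y = f (z \<otimes> g)" by (auto simp: r_coset_def)
        have zg: "z \<otimes> g \<in> carrier G" using z(1) g center_in_carrier by simp
        obtain z' where z': "z' \<in> group_center G" "y = z' \<otimes> (z \<otimes> g)"
          using shift[OF zg] unfolding z(2) by blast
        have "y = (z' \<otimes> z) \<otimes> g"
          unfolding z'(2) using z(1) z'(1) g center_in_carrier by (simp add: m_assoc)
        then show "y \<in> group_center G #> g"
          using Z.m_closed[OF z'(1) z(1)] unfolding r_coset_def by blast
      next
        fix y assume "y \<in> group_center G #> g"
        then obtain z where z: "z \<in> group_center G" "y = z \<otimes> g" by (auto simp: r_coset_def)
        then have y: "y \<in> carrier G" using g center_in_carrier by simp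
        then have "y \<in> f ` carrier G" using bij by (simp add: bij_betw_def)
        then obtain x where x: "x \<in> carrier G" "f x = y" by blast
        then obtain z' where z': "z' \<in> group_center G" "y = z' \<otimes> x" using shift[OF x(1)] unfolding x(2) by blast
        have [simp]: "z \<in> carrier G" "z' \<in> carrier G" using z(1) z'(1) center_in_carrier by auto
        have "(inv z' \<otimes> z) \<otimes> g = inv z' \<otimes> y" using g by (simp add: m_assoc z(2))
        also have "\<dots> = x" using x(1) by (simp add: z'(2))
        finally have "x = (inv z' \<otimes> z) \<otimes> g" by simp
        then have "x \<in> group_center G #> g"
          using Z.m_closed[OF Z.m_inv_closed[OF z'(1)] z(1)] unfolding r_coset_def by blast
        then show "y \<in> f ` (group_center G #> g)" using x(2) by blast
      qed
      then show "f \<in> Aut_sub 1 G" using 1 True by blast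
    qed
  qed (use 1 in blast)
qed

lemma hom_eq_on_generate:
  assumes f: "f \<in> hom G G" and g: "g \<in> hom G G" and S: "S \<subseteq> carrier G"
    and eq: "\<And>x. x \<in> S \<Longrightarrow> f x = g x" and x: "x \<in> generate G S"
  shows "f x = g x"
proof -
  interpret f: group_hom G G f using f by unfold_locales
  interpret g: group_hom G G g using g by unfold_locales
  show ?thesis
    using x
  proof induction
    case (eng y z)
    then have "y \<in> carrier G" "z \<in> carrier G" using generate_in_carrier S by auto
    with eng show ?case by simp
  qed (use S eq in \<open>auto simp: subsetD\<close>)
qed

lemma hom_shift_on_generate:
  assumes f: "f \<in> hom G G" and S: "S \<subseteq> carrier G"
    and shift: "\<And>x. x \<in> S \<Longrightarrow> \<exists>z\<in>group_center G. f x = x \<otimes> z" and x: "x \<in> generate G S"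
  shows "\<exists>z\<in>group_center G. f x = x \<otimes> z"
proof -
  interpret f: group_hom G G f using f by unfold_locales
  note Z = subgroup.m_closed[OF center_subgroup] subgroup.m_inv_closed[OF center_subgroup]
    subgroup.one_closed[OF center_subgroup]
  show ?thesis
    using x
  proof induction
    case one
    then show ?case using Z(3) by (intro bexI[of _ \<one>]) auto
  next
    case (incl y)
    then show ?case by (rule shift)
  next
    case (inv y)
    then have y: "y \<in> carrier G" using S by auto
    obtain z where z: "z \<in> group_center G" "f y = y \<otimes> z" using shift[OF inv] by blast
    note [simp] = center_in_carrier[OF z(1)]
    have "f (inv y) = inv y \<otimes> inv z"
      using y z(2) center_comm[OF z(1) y] by (simp add: inv_mult_group[symmetric])
    then show ?case using Z(2)[OF z(1)] by blast
  next
    case (eng y y')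
    then have y: "y \<in> carrier G" "y' \<in> carrier G" using generate_in_carrier S by auto
    obtain z z' where z: "z \<in> group_center G" "f y = y \<otimes> z" "z' \<in> group_center G" "f y' = y' \<otimes> z'"
      using eng by blast
    note [simp] = center_in_carrier[OF z(1)] center_in_carrier[OF z(3)]
    have "f (y \<otimes> y') = y \<otimes> (z \<otimes> y') \<otimes> z'" using y z by (simp add: m_assoc)
    also have "\<dots> = y \<otimes> y' \<otimes> (z \<otimes> z')" unfolding center_comm[OF z(1) y(2)] using y by (simp add: m_assoc)
    finally show ?case using Z(1)[OF z(1,3)] by blast
  qed
qed

text \<open>Both \<open>u v\<close> and \<open>v u\<close> are multiplied by the same central element \<open>x y\<close>, which cancels.\<close>

lemma commutator_shift:
  assumes [simp]: "u \<in> carrier G" "v \<in> carrier G" and x: "x \<in> group_center G" and y: "y \<in> group_center G"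
  shows "inv (u \<otimes> x) \<otimes> inv (v \<otimes> y) \<otimes> (u \<otimes> x) \<otimes> (v \<otimes> y) = inv u \<otimes> inv v \<otimes> u \<otimes> v"
proof -
  note [simp] = center_in_carrier[OF x] center_in_carrier[OF y]
  have xy: "x \<otimes> y \<in> group_center G" using x y subgroup.m_closed[OF center_subgroup] by blast
  have uv: "(u \<otimes> x) \<otimes> (v \<otimes> y) = (x \<otimes> y) \<otimes> (u \<otimes> v)"
  proof -
    have "(u \<otimes> x) \<otimes> (v \<otimes> y) = u \<otimes> (x \<otimes> v) \<otimes> y" by (simp add: m_assoc)
    also have "\<dots> = (u \<otimes> v) \<otimes> (x \<otimes> y)" unfolding center_comm[OF x \<open>v \<in> carrier G\<close>] by (simp add: m_assoc)
    also have "\<dots> = (x \<otimes> y) \<otimes> (u \<otimes> v)" using center_comm[OF xy, of "u \<otimes> v"] by simp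
    finally show ?thesis .
  qed
  have vu: "(v \<otimes> y) \<otimes> (u \<otimes> x) = (x \<otimes> y) \<otimes> (v \<otimes> u)"
  proof -
    have "(v \<otimes> y) \<otimes> (u \<otimes> x) = v \<otimes> (y \<otimes> (u \<otimes> x))" by (simp add: m_assoc)
    also have "\<dots> = (v \<otimes> u) \<otimes> (x \<otimes> y)" using center_comm[OF y, of "u \<otimes> x"] by (simp add: m_assoc)
    also have "\<dots> = (x \<otimes> y) \<otimes> (v \<otimes> u)" using center_comm[OF xy, of "v \<otimes> u"] by simp
    finally show ?thesis .
  qed
  have "inv (u \<otimes> x) \<otimes> inv (v \<otimes> y) \<otimes> (u \<otimes> x) \<otimes> (v \<otimes> y)
      = inv ((v \<otimes> y) \<otimes> (u \<otimes> x)) \<otimes> ((u \<otimes> x) \<otimes> (v \<otimes> y))"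
    by (simp add: inv_mult_group m_assoc)
  also have "\<dots> = inv (v \<otimes> u) \<otimes> (u \<otimes> v)"
    unfolding uv vu by (simp add: inv_mult_group[of "x \<otimes> y"] m_assoc[of "inv (v \<otimes> u)"] )
  also have "\<dots> = inv u \<otimes> inv v \<otimes> u \<otimes> v" by (simp add: inv_mult_group m_assoc)
  finally show ?thesis .
qed

lemma int_pow_shift:
  assumes "u \<in> carrier G" "x \<in> group_center G"
  shows "(u \<otimes> x) [^] (n::int) = u [^] n \<otimes> x [^] n"
  using assms center_comm[of x u] center_in_carrier[of x] by (intro int_pow_mult_distrib) auto

end

section \<open>Central automorphisms of the Macdonald group\<close>

context macdonald_group
begin

lemma center_power: assumes "x \<in> group_center G" "2 ^ m dvd n" shows "x [^] (n::int) = \<one>"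
proof -
  obtain y where y: "x = A [^] (y::int)" "P dvd y" using assms(1) unfolding center_eq by auto
  have "Q dvd y * n" unfolding Q_eq mult.commute[of "2 ^ m"] using y(2) assms(2) by (rule mult_dvd_mono)
  then have "A [^] (y * n) = A [^] (0::int)" by (intro A_cong) (simp add: cong_iff_dvd_diff)
  then show ?thesis by (simp add: y(1) int_pow_pow)
qed

lemma card_center: "card (group_center G) = 2 ^ m"
proof -
  have "group_center G = (\<lambda>y. A [^] (P * y)) ` {0..<2 ^ m}"
  proof (intro equalityI subsetI)
    fix x assume "x \<in> group_center G"
    then obtain y where y: "x = A [^] (P * y)" unfolding center_eq by auto
    have "[P * y = P * (y mod 2 ^ m)] (mod Q)"
      unfolding Q_eq cong_def by (simp add: mult.commute[of _ P] mod_mult_mult1)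
    then have "x = A [^] (P * (y mod 2 ^ m))" unfolding y by (rule A_cong)
    then show "x \<in> (\<lambda>y. A [^] (P * y)) ` {0..<2 ^ m}" by (intro image_eqI) auto
  qed (auto simp: center_eq)
  moreover have "inj_on (\<lambda>y. A [^] (P * y)) {0..<2 ^ m}"
  proof (rule inj_onI)
    fix y y' :: int assume y: "y \<in> {0..<2 ^ m}" "y' \<in> {0..<2 ^ m}" and "A [^] (P * y) = A [^] (P * y')"
    then have "P * 2 ^ m dvd P * (y - y')"
      unfolding A_eq_iff cong_iff_dvd_diff Q_eq by (simp add: algebra_simps)
    then have "2 ^ m dvd y - y'" using P_pos by auto
    then have "y mod 2 ^ m = y' mod 2 ^ m" by (simp add: mod_eq_dvd_iff)
    then show "y = y'" using y by simp
  qed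
  ultimately show ?thesis by (simp add: card_image nat_power_eq)
qed

lemma two_power_dvd_P: "2 ^ m dvd P"
  unfolding P_def using m_gt_1 by (simp add: le_imp_power_dvd)

text \<open>The factor by which \<open>f\<close> moves \<open>A\<^sup>i C\<^sup>k\<close> is \<open>x\<^sup>i\<close>, which is trivial for \<open>P\<close> dividing \<open>i\<close>.  So
  \<open>f\<close> is the identity on the second centre.  If \<open>f g = 1\<close>, then \<open>g\<close> is central and hence fixed, so
  \<open>g = 1\<close>; and if \<open>f g = g z\<close>, then \<open>g z\<^sup>-\<^sup>1\<close> is a preimage of \<open>g\<close>.\<close>

lemma central_endomorphism:
  assumes f: "f \<in> hom G G" and x: "x \<in> group_center G" and y: "y \<in> group_center G"
    and fA: "f A = A \<otimes> x" and fB: "f B = B \<otimes> y"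
  shows central_endomorphism_fixes: "\<And>g. g \<in> upper_central G 2 \<Longrightarrow> f g = g"
    and central_endomorphism_restrict: "restrict f (carrier G) \<in> Aut_sub 1 G"
proof -
  interpret f: group_hom G G f using f by unfold_locales
  have fC: "f C = C"
    unfolding C_eq using commutator_shift[OF A B x y] by (simp add: fA fB)
  have fix_form: "f (A [^] i \<otimes> C [^] k) = A [^] i \<otimes> C [^] k" if "P dvd i" for i :: int and k :: nat
  proof -
    have "x [^] i = \<one>" using center_power[OF x] two_power_dvd_P that dvd_trans by blast
    then show ?thesis
      using x by (simp add: f.hom_int_pow f.hom_nat_pow fA fC int_pow_shift)
  qed
  have fix2: "f g = g" if g: "g \<in> upper_central G 2" for g
  proof -
    obtain i :: int and k :: nat where "g = A [^] i \<otimes> C [^] k" "P dvd i"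
      using second_center[OF upper_central_2(1)[OF g A] upper_central_2(2)[OF g]] by blast
    then show ?thesis using fix_form by simp
  qed
  then show "\<And>g. g \<in> upper_central G 2 \<Longrightarrow> f g = g" .
  have fix1: "f z = z" if "z \<in> group_center G" for z
    using that fix_form[of _ 0] unfolding center_eq by auto
  have shift: "\<exists>z\<in>group_center G. f g = g \<otimes> z" if "g \<in> carrier G" for g
    using hom_shift_on_generate[OF f, of "{A, B}" g] x y fA fB that generated by auto
  have "inj_on f (carrier G)"
  proof (rule f.inj_on_one_iff[THEN iffD2], intro allI impI)
    fix g assume g: "g \<in> carrier G" "f g = \<one>"
    obtain z where z: "z \<in> group_center G" "f g = g \<otimes> z" using shift[OF g(1)] by blast
    then have "g \<otimes> z = \<one>" using g by simp
    then have "g = inv z" using g(1) center_in_carrier[OF z(1)] by (simp add: inv_equality)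
    then have "g \<in> group_center G" using z(1) subgroup.m_inv_closed[OF center_subgroup] by simp
    then show "g = \<one>" using fix1 g(2) by simp
  qed
  moreover have "f ` carrier G = carrier G"
  proof (intro equalityI subsetI)
    fix g assume g: "g \<in> carrier G"
    obtain z where z: "z \<in> group_center G" "f g = g \<otimes> z" using shift[OF g] by blast
    have iz: "inv z \<in> group_center G" using z(1) subgroup.m_inv_closed[OF center_subgroup] by simp
    have "f (g \<otimes> inv z) = g"
      using g z(2) fix1[OF iz] center_in_carrier[OF z(1)] by (simp add: m_assoc)
    moreover have "f (g \<otimes> inv z) \<in> f ` carrier G" using g center_in_carrier[OF iz] by blast
    ultimately show "g \<in> f ` carrier G" by simp
  qed auto
  ultimately have "bij_betw f (carrier G) (carrier G)" by (simp add: bij_betw_def)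
  then have "restrict f (carrier G) \<in> Bij (carrier G)"
    by (simp add: Bij_def cong: bij_betw_cong)
  moreover have "restrict f (carrier G) \<in> hom G G"
    using f by (simp add: hom_def Pi_iff)
  ultimately have "restrict f (carrier G) \<in> auto G" by (simp add: auto_def)
  then show "restrict f (carrier G) \<in> Aut_sub 1 G"
    unfolding Aut_sub_1_iff using shift by simp
qed

text \<open>The map is multiplicative because \<open>\<Omega> (x, y)\<close> sends \<open>A x'\<close> to \<open>A x x'\<close>, central elements being
  fixed, and because automorphisms that agree on \<open>A\<close> and \<open>B\<close> are equal.  The extension property
  is a hypothesis here, since it depends on the presentation and not only on the relations.\<close>

lemma central_automorphisms:
  assumes ext: "\<And>x y. x \<in> group_center G \<Longrightarrow> y \<in> group_center G \<Longrightarrow> \<exists>f\<in>hom G G. f A = A \<otimes> x \<and> f B = B \<otimes> y"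
  defines "Z \<equiv> upper_central G 1"
  shows "(\<exists>\<Omega>. (\<forall>x\<in>Z. \<forall>y\<in>Z. central_automorphism G (\<Omega> (x, y)) \<and> \<Omega> (x, y) A = A \<otimes> x \<and>
        \<Omega> (x, y) B = B \<otimes> y \<and> (\<forall>z\<in>upper_central G 2. \<Omega> (x, y) z = z)) \<and>
      \<Omega> \<in> mon (G\<lparr>carrier := Z\<rparr> \<times>\<times> G\<lparr>carrier := Z\<rparr>) (AutoGroup G) \<and> \<Omega> ` (Z \<times> Z) = Aut_sub 1 G)
    \<and> card (Aut_sub 1 G) = 2 ^ (2 * m)"
proof -
  have Z: "Z = group_center G" unfolding Z_def by (rule upper_central_1)
  define \<phi> where "\<phi> x y = (SOME f. f \<in> hom G G \<and> f A = A \<otimes> x \<and> f B = B \<otimes> y)" for x y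
  have \<phi>: "\<phi> x y \<in> hom G G" "\<phi> x y A = A \<otimes> x" "\<phi> x y B = B \<otimes> y" if "x \<in> Z" "y \<in> Z" for x y
  proof -
    have "\<exists>f. f \<in> hom G G \<and> f A = A \<otimes> x \<and> f B = B \<otimes> y" using ext that unfolding Z by blast
    from someI_ex[OF this] show "\<phi> x y \<in> hom G G" "\<phi> x y A = A \<otimes> x" "\<phi> x y B = B \<otimes> y"
      unfolding \<phi>_def by blast+
  qed
  define \<Omega> where "\<Omega> p = restrict (\<phi> (fst p) (snd p)) (carrier G)" for p
  have \<Omega>A: "\<Omega> (x, y) A = A \<otimes> x" and \<Omega>B: "\<Omega> (x, y) B = B \<otimes> y" if "x \<in> Z" "y \<in> Z" for x y
    using \<phi>[OF that] by (simp_all add: \<Omega>_def)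
  have \<Omega>_Aut: "\<Omega> (x, y) \<in> Aut_sub 1 G" if "x \<in> Z" "y \<in> Z" for x y
    using central_endomorphism_restrict[OF \<phi>(1)[OF that] _ _ \<phi>(2,3)[OF that]] that by (simp add: \<Omega>_def Z)
  have \<Omega>_fix: "\<Omega> (x, y) z = z" if "x \<in> Z" "y \<in> Z" "z \<in> upper_central G 2" for x y z
    using central_endomorphism_fixes[OF \<phi>(1)[OF that(1,2)] _ _ \<phi>(2,3)[OF that(1,2)] that(3)] that
      upper_central_2(1)[OF that(3) A] by (simp add: \<Omega>_def Z)
  have \<Omega>_fix1: "\<Omega> (x, y) z = z" if xy: "x \<in> Z" "y \<in> Z" and z: "z \<in> Z" for x y z
  proof -
    have hom: "\<Omega> (x, y) \<in> hom G G" using \<Omega>_Aut[OF xy] unfolding Aut_sub_1_iff auto_def by blast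
    obtain n where n: "z = A [^] (n::int)" "P dvd n" using z unfolding Z center_eq by auto
    have "\<Omega> (x, y) z = (A \<otimes> x) [^] n"
      using hom_int_pow[OF hom A is_group is_group] \<Omega>A[OF xy] n(1) by simp
    also have "\<dots> = z"
      using xy(1) center_power[of x n] dvd_trans[OF two_power_dvd_P n(2)] center_in_carrier[of x]
      by (simp add: Z int_pow_shift n(1))
    finally show ?thesis .
  qed
  have unique: "f = g"
    if f: "f \<in> auto G" and g: "g \<in> auto G" and "f A = g A" "f B = g B" for f g
  proof (rule extensionalityI[of _ "carrier G"])
    show "f x = g x" if "x \<in> carrier G" for x
      using hom_eq_on_generate[of f g "{A, B}" x] f g that \<open>f A = g A\<close> \<open>f B = g B\<close> generated
      by (auto simp: auto_def)
  qed (use f g in \<open>auto simp: auto_def Bij_def\<close>)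
  have auto: "\<Omega> (x, y) \<in> auto G" if "x \<in> Z" "y \<in> Z" for x y
    using \<Omega>_Aut[OF that] unfolding Aut_sub_1_iff by blast
  have mult: "\<Omega> (x \<otimes> x', y \<otimes> y') = \<Omega> (x, y) \<otimes>\<^bsub>AutoGroup G\<^esub> \<Omega> (x', y')"
    if xy: "x \<in> Z" "y \<in> Z" "x' \<in> Z" "y' \<in> Z" for x y x' y'
  proof (rule unique)
    have xx: "x \<otimes> x' \<in> Z" "y \<otimes> y' \<in> Z" using xy subgroup.m_closed[OF center_subgroup] by (auto simp: Z)
    note c = xy[unfolded Z, THEN center_in_carrier]
    show "\<Omega> (x \<otimes> x', y \<otimes> y') \<in> auto G" using auto xx by simp
    have cl: "\<Omega> (x, y) \<otimes>\<^bsub>AutoGroup G\<^esub> \<Omega> (x', y') \<in> carrier (AutoGroup G)"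
      using monoid.m_closed[OF group.is_monoid[OF AutoGroup]] auto xy
      by (simp add: AutoGroup_def)
    then show "\<Omega> (x, y) \<otimes>\<^bsub>AutoGroup G\<^esub> \<Omega> (x', y') \<in> auto G" by (simp add: AutoGroup_def)
    have app: "(\<Omega> (x, y) \<otimes>\<^bsub>AutoGroup G\<^esub> \<Omega> (x', y')) g = \<Omega> (x, y) (\<Omega> (x', y') g)" if "g \<in> carrier G" for g
      using auto xy that by (simp add: AutoGroup_def BijGroup_def auto_def compose_def)
    have hom: "\<Omega> (x, y) (g \<otimes> g') = \<Omega> (x, y) g \<otimes> \<Omega> (x, y) g'" if "g \<in> carrier G" "g' \<in> carrier G" for g g'
      using auto[OF xy(1,2)] that by (simp add: auto_def hom_mult)
    show "\<Omega> (x \<otimes> x', y \<otimes> y') A = (\<Omega> (x, y) \<otimes>\<^bsub>AutoGroup G\<^esub> \<Omega> (x', y')) A"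
      using xy xx c by (simp add: app \<Omega>A hom \<Omega>_fix1 m_assoc)
    show "\<Omega> (x \<otimes> x', y \<otimes> y') B = (\<Omega> (x, y) \<otimes>\<^bsub>AutoGroup G\<^esub> \<Omega> (x', y')) B"
      using xy xx c by (simp add: app \<Omega>B hom \<Omega>_fix1 m_assoc)
  qed
  have inj: "inj_on \<Omega> (Z \<times> Z)"
  proof (rule inj_onI, clarify)
    fix x y x' y' assume xy: "x \<in> Z" "y \<in> Z" "x' \<in> Z" "y' \<in> Z" and eq: "\<Omega> (x, y) = \<Omega> (x', y')"
    have "A \<otimes> x = A \<otimes> x'" "B \<otimes> y = B \<otimes> y'"
      using \<Omega>A[OF xy(1,2)] \<Omega>A[OF xy(3,4)] \<Omega>B[OF xy(1,2)] \<Omega>B[OF xy(3,4)] eq by simp_all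
    then show "x = x' \<and> y = y'" using xy[unfolded Z, THEN center_in_carrier] by simp
  qed
  have image: "\<Omega> ` (Z \<times> Z) = Aut_sub 1 G"
  proof (intro equalityI subsetI)
    fix f assume f: "f \<in> Aut_sub 1 G"
    then obtain x y where xy: "x \<in> Z" "y \<in> Z" "f A = A \<otimes> x" "f B = B \<otimes> y"
      unfolding Aut_sub_1_iff Z using A B by blast
    have "f = \<Omega> (x, y)"
      using f xy auto \<Omega>A \<Omega>B unfolding Aut_sub_1_iff by (intro unique) simp_all
    then show "f \<in> \<Omega> ` (Z \<times> Z)" using xy by auto
  qed (use \<Omega>_Aut in auto)
  have "card (Aut_sub 1 G) = card Z * card Z"
    unfolding image[symmetric] using card_image[OF inj] by (simp add: card_cartesian_product)
  then have card: "card (Aut_sub 1 G) = 2 ^ (2 * m)"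
    by (simp add: Z card_center mult_2 power_add)
  have "\<Omega> \<in> mon (G\<lparr>carrier := Z\<rparr> \<times>\<times> G\<lparr>carrier := Z\<rparr>) (AutoGroup G)"
    using inj mult auto by (auto simp: mon_def hom_def AutoGroup_def)
  then show ?thesis
    using \<Omega>_Aut \<Omega>A \<Omega>B \<Omega>_fix image card unfolding central_automorphism_def by blast
qed

end

section \<open>The presented group\<close>

context group
begin

lemma word_eval_winv:
  assumes "range f \<subseteq> carrier G"
  shows "word_eval G f (winv w) = inv (word_eval G f w)"
proof (induction w)
  case Nil
  then show ?case by (simp add: winv_def)
next
  case (Cons p w)
  obtain g b where p: "p = (g, b)" by fastforce
  have "f g \<in> carrier G" using assms by auto
  then show ?case
    using Cons by (simp add: p winv_Cons word_eval_append[OF assms] word_eval_closed[OF assms] inv_mult_group)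
qed

lemma word_eval_wpow:
  assumes f: "range f \<subseteq> carrier G"
  shows "word_eval G f (wpow w k) = word_eval G f w [^] k"
proof -
  have pow: "word_eval G f (concat (replicate n v)) = word_eval G f v [^] n" for n v
  proof (induction n)
    case (Suc n)
    then show ?case
      unfolding nat_pow_Suc2[OF word_eval_closed[OF f]] by (simp add: word_eval_append[OF f])
  qed simp
  show ?thesis
  proof (cases "0 \<le> k")
    case True
    then obtain n where k: "k = int n" by (rule nonneg_int_cases)
    show ?thesis unfolding k int_pow_int by (simp add: wpow_def pow)
  next
    case False
    then obtain n where n: "k = - int n" "0 < n" by (metis int_cases4 of_nat_0_le_iff)
    then have "wpow w k = concat (replicate n (winv w))" by (simp add: wpow_def)
    then show ?thesis
      unfolding n(1) int_pow_neg_int[OF word_eval_closed[OF f]]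
      by (simp add: pow word_eval_winv[OF f] nat_pow_inv word_eval_closed[OF f])
  qed
qed

lemma word_eval_wcomm:
  assumes "range f \<subseteq> carrier G"
  shows "word_eval G f (wcomm u v)
    = inv (word_eval G f u) \<otimes> inv (word_eval G f v) \<otimes> word_eval G f u \<otimes> word_eval G f v"
  by (simp add: wcomm_def word_eval_append word_eval_winv word_eval_closed assms m_assoc)

lemma word_eval_wconj:
  assumes "range f \<subseteq> carrier G"
  shows "word_eval G f (wconj u v) = inv (word_eval G f v) \<otimes> word_eval G f u \<otimes> word_eval G f v"
  by (simp add: wconj_def word_eval_append word_eval_winv word_eval_closed assms m_assoc)

lemma word_eval_J_rels:
  assumes f: "range f \<subseteq> carrier G"
  defines "a \<equiv> f GA" and "b \<equiv> f GB"
  defines "c \<equiv> inv a \<otimes> inv b \<otimes> a \<otimes> b"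
  assumes "inv c \<otimes> a \<otimes> c = a [^] J_alpha m l" "c \<otimes> b \<otimes> inv c = b [^] J_alpha m l"
    and "a [^] (2 ^ (3 * m - 1) :: int) = \<one>" "b [^] (2 ^ (3 * m - 1) :: int) = \<one>"
    and "(u, v) \<in> J_rels m l"
  shows "word_eval G f u = word_eval G f v"
proof -
  have [simp]: "a \<in> carrier G" "b \<in> carrier G" using f by (auto simp: a_def b_def)
  have word: "word_eval G f [(GA, True)] = a" "word_eval G f [(GB, True)] = b"
    using f by (simp_all add: a_def b_def image_subset_iff)
  have c: "c \<in> carrier G" by (simp add: c_def)
  have "inv b \<otimes> inv a \<otimes> b \<otimes> a = inv c"
    by (simp add: c_def inv_mult_group m_assoc)
  then have wc: "word_eval G f (wcomm [(GA, True)] [(GB, True)]) = c"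
    "word_eval G f (wcomm [(GB, True)] [(GA, True)]) = inv c"
    unfolding word_eval_wcomm[OF f] word using c_def by blast+
  consider "(u, v) = (wconj [(GA, True)] (wcomm [(GA, True)] [(GB, True)]), wpow [(GA, True)] (J_alpha m l))"
    | "(u, v) = (wconj [(GB, True)] (wcomm [(GB, True)] [(GA, True)]), wpow [(GB, True)] (J_alpha m l))"
    | "(u, v) = (wpow [(GA, True)] (2 ^ (3 * m - 1)), [])"
    | "(u, v) = (wpow [(GB, True)] (2 ^ (3 * m - 1)), [])"
    using assms(9) unfolding J_rels_def Let_def by blast
  then show ?thesis
    using assms(5-8) c
    by cases (simp_all only: prod.inject word_eval_wconj[OF f] word_eval_wpow[OF f] wc word inv_inv word_eval.simps(1))
qed

end

lemma J_generated: "generate (J_group m l) {J_A m l, J_B m l} = carrier (J_group m l)"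
proof -
  have "range (pres_gen (J_rels m l)) = {J_A m l, J_B m l}"
  proof -
    have gens: "(UNIV :: gen set) = {GA, GB}" using gen.exhaust by blast
    show ?thesis unfolding gens by (simp add: J_A_def J_B_def)
  qed
  then show ?thesis unfolding J_group_def using presented_group_generated[of "J_rels m l"] by simp
qed

lemma J_universal:
  assumes "group G" and ab: "a \<in> carrier G" "b \<in> carrier G"
  defines "c \<equiv> inv\<^bsub>G\<^esub> a \<otimes>\<^bsub>G\<^esub> inv\<^bsub>G\<^esub> b \<otimes>\<^bsub>G\<^esub> a \<otimes>\<^bsub>G\<^esub> b"
  assumes rel: "inv\<^bsub>G\<^esub> c \<otimes>\<^bsub>G\<^esub> a \<otimes>\<^bsub>G\<^esub> c = a [^]\<^bsub>G\<^esub> J_alpha m l"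
      "c \<otimes>\<^bsub>G\<^esub> b \<otimes>\<^bsub>G\<^esub> inv\<^bsub>G\<^esub> c = b [^]\<^bsub>G\<^esub> J_alpha m l"
      "a [^]\<^bsub>G\<^esub> (2 ^ (3 * m - 1) :: int) = \<one>\<^bsub>G\<^esub>" "b [^]\<^bsub>G\<^esub> (2 ^ (3 * m - 1) :: int) = \<one>\<^bsub>G\<^esub>"
  obtains f where "f \<in> hom (J_group m l) G" "f (J_A m l) = a" "f (J_B m l) = b"
proof -
  interpret group G by fact
  define \<phi> where "\<phi> = (\<lambda>g. case g of GA \<Rightarrow> a | GB \<Rightarrow> b)"
  have [simp]: "\<phi> GA = a" "\<phi> GB = b" by (simp_all add: \<phi>_def)
  have range: "range \<phi> \<subseteq> carrier G" using ab by (auto simp: \<phi>_def split: gen.split)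
  have "\<exists>f\<in>hom (presented_group (J_rels m l)) G. \<forall>g. f (pres_gen (J_rels m l) g) = \<phi> g"
    using word_eval_J_rels[OF range, of m l] rel unfolding c_def
    by (intro presented_group_universal[OF assms(1) range]) simp
  then show thesis using that by (auto simp: J_group_def J_A_def J_B_def)
qed

text \<open>The relations hold by definition.  The two facts that bound the group from below are pulled back
  from the permutation model along the homomorphism given by the universal property.\<close>

lemma J_macdonald_group:
  assumes "1 < m" "odd l"
  defines "r \<equiv> l mod 2 ^ (2 * m - 1)" and "J \<equiv> J_group m l" and "a \<equiv> J_A m l" and "b \<equiv> J_B m l"
  shows "macdonald_group J m r a b (inv\<^bsub>J\<^esub> a \<otimes>\<^bsub>J\<^esub> inv\<^bsub>J\<^esub> b \<otimes>\<^bsub>J\<^esub> a \<otimes>\<^bsub>J\<^esub> b)"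
    and "[J_alpha m l = macdonald_parameters.\<alpha> m r] (mod 2 ^ (3 * m - 1))"
proof -
  have "macdonald_parameters m r"
  proof
    have "even (2 ^ (2 * m - 1) :: int)" using assms(1) by simp
    then show "odd r" unfolding r_def using assms(2) by (simp add: dvd_mod_iff)
    moreover have "0 \<le> r" unfolding r_def by simp
    ultimately show "0 < r" by (cases "r = 0") auto
  qed (rule assms)
  then interpret macdonald_parameters m r .
  have "2 ^ (2 * m - 1) dvd l - r" unfolding r_def by (simp add: minus_mod_eq_mult_div)
  then have "Q dvd 2 ^ m * (l - r)" unfolding Q_eq P_def by (intro mult_dvd_mono) auto
  then have alpha: "[J_alpha m l = \<alpha>] (mod Q)"
    by (simp add: cong_iff_dvd_diff J_alpha_def \<alpha>_def two_h right_diff_distrib)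
  then show "[J_alpha m l = \<alpha>] (mod 2 ^ (3 * m - 1))" unfolding Q_def .
  interpret J: group J unfolding J_def J_group_def by (rule group_presented_group)
  have [simp]: "a \<in> carrier J" "b \<in> carrier J"
    by (simp_all add: a_def b_def J_def J_A_def J_B_def J_group_def pres_gen_def)
  define c where "c = inv\<^bsub>J\<^esub> a \<otimes>\<^bsub>J\<^esub> inv\<^bsub>J\<^esub> b \<otimes>\<^bsub>J\<^esub> a \<otimes>\<^bsub>J\<^esub> b"
  have [simp]: "c \<in> carrier J" by (simp add: c_def)
  have c': "inv\<^bsub>J\<^esub> b \<otimes>\<^bsub>J\<^esub> inv\<^bsub>J\<^esub> a \<otimes>\<^bsub>J\<^esub> b \<otimes>\<^bsub>J\<^esub> a = inv\<^bsub>J\<^esub> c"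
    by (simp add: c_def J.inv_mult_group J.m_assoc)
  note rels = J_relations[of m l, folded J_def a_def b_def, folded c_def, unfolded c', folded J_alpha_def Q_def]
  obtain G :: "(int \<times> int \<Rightarrow> int \<times> int) monoid" and A B C where G: "group G" "A \<in> carrier G" "B \<in> carrier G"
    and C: "C = inv\<^bsub>G\<^esub> A \<otimes>\<^bsub>G\<^esub> inv\<^bsub>G\<^esub> B \<otimes>\<^bsub>G\<^esub> A \<otimes>\<^bsub>G\<^esub> B"
    and model: "inv\<^bsub>G\<^esub> C \<otimes>\<^bsub>G\<^esub> A \<otimes>\<^bsub>G\<^esub> C = A [^]\<^bsub>G\<^esub> \<alpha>" "C \<otimes>\<^bsub>G\<^esub> B \<otimes>\<^bsub>G\<^esub> inv\<^bsub>G\<^esub> C = B [^]\<^bsub>G\<^esub> \<alpha>"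
    and Q: "A [^]\<^bsub>G\<^esub> Q = \<one>\<^bsub>G\<^esub>" "B [^]\<^bsub>G\<^esub> Q = \<one>\<^bsub>G\<^esub>"
    and order: "\<And>n::int. A [^]\<^bsub>G\<^esub> n = \<one>\<^bsub>G\<^esub> \<Longrightarrow> Q dvd n"
    and independent: "\<And>(n::int) (e::int) (k::nat). B [^]\<^bsub>G\<^esub> n = A [^]\<^bsub>G\<^esub> e \<otimes>\<^bsub>G\<^esub> C [^]\<^bsub>G\<^esub> k \<Longrightarrow> P dvd n"
    by (rule macdonald_model) blast
  interpret G: group G by (rule G)
  obtain \<phi> where \<phi>: "\<phi> \<in> hom J G" "\<phi> a = A" "\<phi> b = B"
  proof (rule J_universal[OF G, of m l])
    show "inv\<^bsub>G\<^esub> (inv\<^bsub>G\<^esub> A \<otimes>\<^bsub>G\<^esub> inv\<^bsub>G\<^esub> B \<otimes>\<^bsub>G\<^esub> A \<otimes>\<^bsub>G\<^esub> B) \<otimes>\<^bsub>G\<^esub> A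
        \<otimes>\<^bsub>G\<^esub> (inv\<^bsub>G\<^esub> A \<otimes>\<^bsub>G\<^esub> inv\<^bsub>G\<^esub> B \<otimes>\<^bsub>G\<^esub> A \<otimes>\<^bsub>G\<^esub> B) = A [^]\<^bsub>G\<^esub> J_alpha m l"
      using model(1) G.int_pow_cong[OF G(2) Q(1) alpha] unfolding C by simp
    show "inv\<^bsub>G\<^esub> A \<otimes>\<^bsub>G\<^esub> inv\<^bsub>G\<^esub> B \<otimes>\<^bsub>G\<^esub> A \<otimes>\<^bsub>G\<^esub> B \<otimes>\<^bsub>G\<^esub> B
        \<otimes>\<^bsub>G\<^esub> inv\<^bsub>G\<^esub> (inv\<^bsub>G\<^esub> A \<otimes>\<^bsub>G\<^esub> inv\<^bsub>G\<^esub> B \<otimes>\<^bsub>G\<^esub> A \<otimes>\<^bsub>G\<^esub> B) = B [^]\<^bsub>G\<^esub> J_alpha m l"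
      using model(2) G.int_pow_cong[OF G(3) Q(2) alpha] unfolding C by simp
    show "A [^]\<^bsub>G\<^esub> (2 ^ (3 * m - 1) :: int) = \<one>\<^bsub>G\<^esub>" "B [^]\<^bsub>G\<^esub> (2 ^ (3 * m - 1) :: int) = \<one>\<^bsub>G\<^esub>"
      using Q unfolding Q_def .
  qed (auto simp: J_def a_def b_def)
  interpret \<phi>: group_hom J G \<phi> using \<phi>(1) by unfold_locales
  have \<phi>c: "\<phi> c = C" by (simp add: c_def C \<phi>)
  show "macdonald_group J m r a b (inv\<^bsub>J\<^esub> a \<otimes>\<^bsub>J\<^esub> inv\<^bsub>J\<^esub> b \<otimes>\<^bsub>J\<^esub> a \<otimes>\<^bsub>J\<^esub> b)"
    unfolding c_def[symmetric]
  proof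
    show aQ: "a [^]\<^bsub>J\<^esub> Q = \<one>\<^bsub>J\<^esub>" and bQ: "b [^]\<^bsub>J\<^esub> Q = \<one>\<^bsub>J\<^esub>" by (rule rels)+
    show "inv\<^bsub>J\<^esub> c \<otimes>\<^bsub>J\<^esub> a \<otimes>\<^bsub>J\<^esub> c = a [^]\<^bsub>J\<^esub> \<alpha>"
      using rels(1) J.int_pow_cong[OF _ aQ alpha] by simp
    show "c \<otimes>\<^bsub>J\<^esub> b \<otimes>\<^bsub>J\<^esub> inv\<^bsub>J\<^esub> c = b [^]\<^bsub>J\<^esub> \<alpha>"
      using rels(2) J.int_pow_cong[OF _ bQ alpha] by simp
    show "generate J {a, b} = carrier J" unfolding J_def a_def b_def by (rule J_generated)
    fix n :: int
    show "Q dvd n" if "a [^]\<^bsub>J\<^esub> n = \<one>\<^bsub>J\<^esub>"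
      using order[of n] arg_cong[OF that, of \<phi>] by (simp add: \<phi>.hom_int_pow \<phi>)
    show "P dvd n" if "b [^]\<^bsub>J\<^esub> n = a [^]\<^bsub>J\<^esub> e \<otimes>\<^bsub>J\<^esub> c [^]\<^bsub>J\<^esub> k" for e :: int and k :: nat
      using independent[of n e k] arg_cong[OF that, of \<phi>] by (simp add: \<phi>.hom_int_pow \<phi>.hom_nat_pow \<phi> \<phi>c)
  qed (simp_all add: c_def)
qed

theorem proposition7p1:
  fixes m :: nat and l :: int
  assumes "m > 1" and "odd l"
  shows "(\<exists>\<Omega> :: gen word set \<times> gen word set \<Rightarrow> (gen word set \<Rightarrow> gen word set).
      (\<forall>x \<in> upper_central (J_group m l) 1. \<forall>y \<in> upper_central (J_group m l) 1.
          central_automorphism (J_group m l) (\<Omega> (x, y)) \<and>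
          \<Omega> (x, y) (J_A m l) = J_A m l \<otimes>\<^bsub>J_group m l\<^esub> x \<and>
          \<Omega> (x, y) (J_B m l) = J_B m l \<otimes>\<^bsub>J_group m l\<^esub> y \<and>
          (\<forall>z \<in> upper_central (J_group m l) 2. \<Omega> (x, y) z = z)) \<and>
      \<Omega> \<in> mon ((J_group m l)\<lparr>carrier := upper_central (J_group m l) 1\<rparr>
                \<times>\<times> (J_group m l)\<lparr>carrier := upper_central (J_group m l) 1\<rparr>)
              (AutoGroup (J_group m l)) \<and>
      \<Omega> ` (upper_central (J_group m l) 1 \<times> upper_central (J_group m l) 1)
        = Aut_sub 1 (J_group m l))
    \<and> card (Aut_sub 1 (J_group m l)) = 2 ^ (2 * m)"
proof -
  let ?J = "J_group m l" and ?a = "J_A m l" and ?b = "J_B m l" and ?r = "l mod 2 ^ (2 * m - 1)"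
  define c where "c = inv\<^bsub>?J\<^esub> ?a \<otimes>\<^bsub>?J\<^esub> inv\<^bsub>?J\<^esub> ?b \<otimes>\<^bsub>?J\<^esub> ?a \<otimes>\<^bsub>?J\<^esub> ?b"
  interpret macdonald_group ?J m ?r ?a ?b c
    unfolding c_def by (rule J_macdonald_group(1)[OF assms])
  have alpha: "[J_alpha m l = \<alpha>] (mod Q)"
    unfolding Q_def by (rule J_macdonald_group(2)[OF assms])
  show ?thesis
  proof (rule central_automorphisms)
    fix x y assume x: "x \<in> group_center ?J" and y: "y \<in> group_center ?J"
    note [simp] = center_in_carrier[OF x] center_in_carrier[OF y]
    \<comment> \<open>The centre has exponent dividing \<open>2\<^sup>m\<close>, and \<open>\<alpha>\<close> is 1 modulo \<open>2\<^sup>m\<close>.\<close>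
    have power: "z [^]\<^bsub>?J\<^esub> (2 ^ (3 * m - 1) :: int) = \<one>\<^bsub>?J\<^esub>" "z [^]\<^bsub>?J\<^esub> J_alpha m l = z"
      if z: "z \<in> group_center ?J" for z
    proof -
      note [simp] = center_in_carrier[OF z]
      show "z [^]\<^bsub>?J\<^esub> (2 ^ (3 * m - 1) :: int) = \<one>\<^bsub>?J\<^esub>"
        using assms(1) by (intro center_power[OF z] le_imp_power_dvd) simp
      have "z [^]\<^bsub>?J\<^esub> (2 ^ m * l) = \<one>\<^bsub>?J\<^esub>" by (rule center_power[OF z]) simp
      then show "z [^]\<^bsub>?J\<^esub> J_alpha m l = z" by (simp add: J_alpha_def int_pow_mult)
    qed
    have comm: "inv\<^bsub>?J\<^esub> (?a \<otimes>\<^bsub>?J\<^esub> x) \<otimes>\<^bsub>?J\<^esub> inv\<^bsub>?J\<^esub> (?b \<otimes>\<^bsub>?J\<^esub> y) \<otimes>\<^bsub>?J\<^esub> (?a \<otimes>\<^bsub>?J\<^esub> x) \<otimes>\<^bsub>?J\<^esub> (?b \<otimes>\<^bsub>?J\<^esub> y) = c"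
      unfolding c_def by (rule commutator_shift[OF A B x y])
    have "inv\<^bsub>?J\<^esub> c \<otimes>\<^bsub>?J\<^esub> (?a \<otimes>\<^bsub>?J\<^esub> x) \<otimes>\<^bsub>?J\<^esub> c = (inv\<^bsub>?J\<^esub> c \<otimes>\<^bsub>?J\<^esub> ?a \<otimes>\<^bsub>?J\<^esub> c) \<otimes>\<^bsub>?J\<^esub> x"
      using center_comm[OF x C] by (simp add: m_assoc)
    then have 1: "inv\<^bsub>?J\<^esub> c \<otimes>\<^bsub>?J\<^esub> (?a \<otimes>\<^bsub>?J\<^esub> x) \<otimes>\<^bsub>?J\<^esub> c = (?a \<otimes>\<^bsub>?J\<^esub> x) [^]\<^bsub>?J\<^esub> J_alpha m l"
      unfolding int_pow_shift[OF A x] power(2)[OF x] A_cong[OF alpha] rel_A .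
    have "c \<otimes>\<^bsub>?J\<^esub> (?b \<otimes>\<^bsub>?J\<^esub> y) \<otimes>\<^bsub>?J\<^esub> inv\<^bsub>?J\<^esub> c = (c \<otimes>\<^bsub>?J\<^esub> ?b \<otimes>\<^bsub>?J\<^esub> inv\<^bsub>?J\<^esub> c) \<otimes>\<^bsub>?J\<^esub> y"
      using center_comm[OF y inv_closed[OF C]] by (simp add: m_assoc)
    then have 2: "c \<otimes>\<^bsub>?J\<^esub> (?b \<otimes>\<^bsub>?J\<^esub> y) \<otimes>\<^bsub>?J\<^esub> inv\<^bsub>?J\<^esub> c = (?b \<otimes>\<^bsub>?J\<^esub> y) [^]\<^bsub>?J\<^esub> J_alpha m l"
      unfolding int_pow_shift[OF B y] power(2)[OF y] B_cong[OF alpha] rel_B .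
    have 3: "(?a \<otimes>\<^bsub>?J\<^esub> x) [^]\<^bsub>?J\<^esub> (2 ^ (3 * m - 1) :: int) = \<one>\<^bsub>?J\<^esub>"
      "(?b \<otimes>\<^bsub>?J\<^esub> y) [^]\<^bsub>?J\<^esub> (2 ^ (3 * m - 1) :: int) = \<one>\<^bsub>?J\<^esub>"
      unfolding int_pow_shift[OF A x] int_pow_shift[OF B y] power(1)[OF x] power(1)[OF y]
      using A_Q B_Q unfolding Q_def by simp_all
    obtain f where "f \<in> hom ?J ?J" "f ?a = ?a \<otimes>\<^bsub>?J\<^esub> x" "f ?b = ?b \<otimes>\<^bsub>?J\<^esub> y"
      by (rule J_universal[OF is_group, of "?a \<otimes>\<^bsub>?J\<^esub> x" "?b \<otimes>\<^bsub>?J\<^esub> y" m l, unfolded comm, OF _ _ 1 2 3]) simp_all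
    then show "\<exists>f\<in>hom ?J ?J. f ?a = ?a \<otimes>\<^bsub>?J\<^esub> x \<and> f ?b = ?b \<otimes>\<^bsub>?J\<^esub> y" by blast
  qed
qed

end
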